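(* Let $\alpha,h:\mathbb{R}\to\mathbb{R}$ be real-analytic with $\alpha'\gtrsim1$ on $\mathbb{R}$ and $h\in L^\infty(\mathbb{R})$, and let $U=\exp(i(-\alpha+h))$. Let $\Lambda\subset\mathbb{R}$ be a discrete set with $D_\alpha^-(\Lambda)>\frac1{2\pi}$. Then $\Lambda$ is not a zero set of $N^+(U)$; that is, there is no non-trivial (not identically zero) function in $N^+(U)$ that vanishes at every point of $\Lambda$.
   Context: $\alpha'\gtrsim1$ means there is $c>0$ with $\alpha'(x)\ge c$ for all $x$. For an interval $I$, $\alpha(I)=\int_I\alpha'(x)\,dx$, and the lower $\alpha$-density is $$D_\alpha^-(\Lambda)=\lim_{r\to\infty}\inf_{\alpha(I)=r}\frac{\#(\Lambda\cap I)}{r},$$ the infimum being over all intervals $I$ with $\alpha(I)=r$. Discrete means having no accumulation points in $\mathbb{R}$. $N^+$ denotes the Smirnov class of the upper half-plane $\mathbb{C}_+$: analytic functions $f$ on $\mathbb{C}_+$ of the form $f=p/q$ with $p,q\in H^\infty(\mathbb{C}_+)$ and $q$ outer; its elements are identified with their boundary functions on $\mathbb{R}$. The Smirnov Toeplitz kernel is $$N^+(U)=\{f\in N^+\cap L^1_{loc}(\mathbb{R}):\overline{Uf}\in N^+\},$$ where $f\in L^1_{loc}(\mathbb{R})$ refers to the boundary function and $\overline{Uf}\in N^+$ means that the function $\overline{Uf}$ on $\mathbb{R}$ is the boundary function of an element of $N^+$. Since $U=e^{i\gamma}$ with $\gamma$ real-analytic, elements of $N^+(U)$ have real-analytic boundary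 functions on $\mathbb{R}$, so vanishing at points of $\mathbb{R}$ makes sense. *)

theory Defs
  imports "HOL-Analysis.Analysis"
begin

definition real_analytic :: "(real \<Rightarrow> real) \<Rightarrow> bool" where
  "real_analytic f \<longleftrightarrow>
     (\<forall>x. \<exists>r>0. \<exists>a :: nat \<Rightarrow> real. \<forall>y. \<bar>y - x\<bar> < r \<longrightarrow> (\<lambda>n. a n * (y - x) ^ n) sums f y)"

definition ess_bounded :: "(real \<Rightarrow> real) \<Rightarrow> bool" where
  "ess_bounded h \<longleftrightarrow> h \<in> borel_measurable lebesgue \<and> (\<exists>C. AE x in lebesgue. \<bar>h x\<bar> \<le> C)"

definition upper_half_plane :: "complex set" where
  "upper_half_plane = {z. Im z > 0}"

definition H_infinity :: "(complex \<Rightarrow> complex) set" where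
  "H_infinity = {f. f holomorphic_on upper_half_plane \<and> bounded (f ` upper_half_plane)}"

text \<open>
  The real part of the kernel divided by \<open>pi * \<i>\<close> is the Poisson kernel of the upper half-plane,
  so \<open>u\<close> is the boundary function of \<open>log |q|\<close>.  The term \<open>t / (1 + t^2)\<close> only serves to make the
  integral converge absolutely.
\<close>

definition outer_function :: "(complex \<Rightarrow> complex) \<Rightarrow> bool" where
  "outer_function q \<longleftrightarrow>
     (\<exists>c u. norm c = 1 \<and>
        u \<in> borel_measurable lborel \<and>
        integrable lborel (\<lambda>t::real. u t / (1 + t\<^sup>2)) \<and>
        (\<forall>z\<in>upper_half_plane.
           q z = c * exp (1 / (of_real pi * \<i>) *
             (LINT t|lborel. (1 / (of_real t - z) - of_real (t / (1 + t\<^sup>2))) * of_real (u t)))))"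

text \<open>
  Analytic functions on the upper half-plane are represented by total functions on \<^typ>\<open>complex\<close>;
  their values off the upper half-plane are irrelevant everywhere below.
\<close>

definition smirnov :: "(complex \<Rightarrow> complex) set" where
  "smirnov = {f. \<exists>p\<in>H_infinity. \<exists>q\<in>H_infinity. outer_function q \<and>
                   (\<forall>z\<in>upper_half_plane. f z = p z / q z)}"

text \<open>Nontangential boundary value: the limit exists in every Stolz angle with vertex \<open>x\<close>.\<close>

definition has_boundary_value :: "(complex \<Rightarrow> complex) \<Rightarrow> real \<Rightarrow> complex \<Rightarrow> bool" where
  "has_boundary_value f x l \<longleftrightarrow>
     (\<forall>\<kappa>>0. (f \<longlongrightarrow> l)
        (at (of_real x) within {z \<in> upper_half_plane. \<bar>Re z - x\<bar> < \<kappa> * Im z}))"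

definition boundary_function :: "(complex \<Rightarrow> complex) \<Rightarrow> (real \<Rightarrow> complex) \<Rightarrow> bool" where
  "boundary_function f F \<longleftrightarrow> (AE x in lebesgue. has_boundary_value f x (F x))"

definition locally_integrable :: "(real \<Rightarrow> complex) \<Rightarrow> bool" where
  "locally_integrable F \<longleftrightarrow> (\<forall>a b. F absolutely_integrable_on {a..b})"

definition smirnov_toeplitz_kernel :: "(real \<Rightarrow> complex) \<Rightarrow> (complex \<Rightarrow> complex) set" where
  "smirnov_toeplitz_kernel U =
     {f \<in> smirnov. \<exists>F. boundary_function f F \<and> locally_integrable F \<and>
        (\<exists>g\<in>smirnov. boundary_function g (\<lambda>x. cnj (U x * F x)))}"

text \<open>
  When \<open>U = exp (\<i> * \<gamma>)\<close> with \<open>\<gamma>\<close> real-analytic, every element \<open>f\<close> of the kernel of \<open>U\<close> continues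
  analytically across the real line, so that the nontangential limit of \<open>f\<close> exists at every real
  point and is the value there of the real-analytic boundary function of \<open>f\<close>.
\<close>

definition vanishes_at :: "(complex \<Rightarrow> complex) \<Rightarrow> real \<Rightarrow> bool" where
  "vanishes_at f x \<longleftrightarrow> has_boundary_value f x 0"

definition zero_set_of :: "(complex \<Rightarrow> complex) set \<Rightarrow> real set \<Rightarrow> bool" where
  "zero_set_of N \<Lambda> \<longleftrightarrow>
     (\<exists>f\<in>N. (\<exists>z\<in>upper_half_plane. f z \<noteq> 0) \<and> (\<forall>x\<in>\<Lambda>. vanishes_at f x))"

definition interval_mass :: "(real \<Rightarrow> real) \<Rightarrow> real set \<Rightarrow> real" where
  "interval_mass \<alpha> I = (LINT x:I|lborel. deriv \<alpha> x)"

text \<open>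
  The density is extended-real valued since it may be infinite.  If \<open>deriv \<alpha>\<close> is bounded below by a
  positive constant, then only bounded intervals have positive \<^const>\<open>interval_mass\<close> (on unbounded
  ones the integral diverges and is \<open>0\<close> by convention); such intervals meet a set without
  accumulation points in a finite set, so that \<^const>\<open>card\<close> is the true number of points.
\<close>

definition lower_density :: "(real \<Rightarrow> real) \<Rightarrow> real set \<Rightarrow> ereal" where
  "lower_density \<alpha> \<Lambda> =
     Lim at_top (\<lambda>r::real.
       INF I\<in>{I. is_interval I \<and> interval_mass \<alpha> I = r}. ereal (real (card (\<Lambda> \<inter> I)) / r))"

end

theory Submission
  imports Defs "HOL-Complex_Analysis.Complex_Analysis" "HOL-Real_Asymp.Real_Asymp"
begin

text \<open>
  Put \<open>\<beta> = \<alpha> - h\<close>. If \<open>f\<close> lies in the kernel of \<open>U = exp (- \<i> \<beta>)\<close> and \<open>g\<close> is the Smirnov function with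
  boundary values \<open>cnj (U f)\<close>, then \<open>f = exp (\<i> \<beta>) cnj g\<close> on the real line, so both functions continue
  analytically across it, and \<open>\<Phi> = f g\<close> has the form \<open>\<bar>f\<bar>\<^sup>2 exp (\<i> \<beta>)\<close> there. In particular \<open>\<Phi>\<close> vanishes
  to even order on \<open>\<Lambda>\<close>. Jensen's formula on the half disc of radius \<open>R\<close> about a real point, taken to be \<open>0\<close>,
  expresses the integral of \<open>log \<bar>\<Phi>\<bar>\<close> over the arc through the zeros and the phase \<open>\<beta>\<close>: it is at least
  the integral over \<open>0 < t < R\<close> of \<open>(2 \<pi> #(\<Lambda> \<inter> (-t, t)) - (\<beta> t - \<beta> (-t))) / t\<close>, up to a constant. The density
  assumption makes the integrand bounded below by \<open>\<delta> - C / t\<close>, so the arc integrals grow linearly. But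
  \<open>log \<bar>\<Phi>\<bar>\<close> is dominated by the Poisson integral of a function integrable against \<open>1 / (1 + t\<^sup>2)\<close>, whose
  arc integrals are \<open>o(R)\<close> on average over \<open>R\<close>.
\<close>

section \<open>The Herglotz and Poisson integrals\<close>

text \<open>The outer denominator in the Smirnov class is what makes the two growth rates
  incompatible: exp (- i z) has log modulus Im z, whose integral over the arc of radius R is 2 R, so
  a general quotient of bounded functions may well have arc integrals of linear growth. The product
  \<open>f g\<close> is studied because the phase of \<open>f\<close> alone on the real line is
  unknown, while that of \<open>f g\<close> is \<beta>. The constant 1 / (2 \<pi>) is the rate at
  which boundary zeros of order two, worth 2 \<pi> each, balance the increase of the phase; the
  bounded \<open>h\<close> changes only the constant C. Two obstacles shape the rest. Near the real
  line \<open>f\<close> obeys no local bound, so Cauchy's formula is not directly available up to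
  the line; \<open>f\<close> is multiplied by outer functions that make it bounded, and the height
  of the segment is chosen for each of them separately. And the integral of the Poisson kernel over
  the arc of radius R has a logarithmic singularity at R = |t|, so the Poisson integrals are not
  estimated arc by arc; averaging over S \<le> R \<le> 2 S removes the singularity.\<close>

definition herglotz_kernel :: "complex \<Rightarrow> real \<Rightarrow> complex" where
  "herglotz_kernel z t = 1 / (of_real t - z) - of_real (t / (1 + t\<^sup>2))"

definition herglotz :: "(real \<Rightarrow> real) \<Rightarrow> complex \<Rightarrow> complex" where
  "herglotz u z = 1 / (of_real pi * \<i>) * (LINT t|lborel. herglotz_kernel z t * of_real (u t))"

definition poisson_kernel :: "complex \<Rightarrow> real \<Rightarrow> real" where
  "poisson_kernel z t = Im z / (pi * (cmod (of_real t - z))\<^sup>2)"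

definition poisson :: "(real \<Rightarrow> real) \<Rightarrow> complex \<Rightarrow> real" where
  "poisson u z = (LINT t|lborel. poisson_kernel z t * u t)"

definition log_integrable :: "(real \<Rightarrow> real) \<Rightarrow> bool" where
  "log_integrable u \<longleftrightarrow> u \<in> borel_measurable borel \<and> integrable lborel (\<lambda>t. u t / (1 + t\<^sup>2))"

lemma upper_half_plane_iff: "z \<in> upper_half_plane \<longleftrightarrow> Im z > 0"
  by (simp add: upper_half_plane_def)

lemma open_upper_half_plane: "open upper_half_plane"
  by (simp add: upper_half_plane_def open_halfspace_Im_gt)

lemma convex_upper_half_plane: "convex upper_half_plane"
  by (simp add: upper_half_plane_def convex_halfspace_Im_gt)

lemma Im_le_cmod_of_real_diff: "Im z \<le> cmod (of_real t - z)"
  using abs_Im_le_cmod[of "of_real t - z"] by simp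

text \<open>With d the distance from t to z, the constant comes from |t| \<le> d + |z| and from 1
  \<le> d^2 / (Im z)^2, which absorbs the terms free of d.\<close>

lemma one_plus_square_le_dist:
  assumes "Im z > 0"
  shows "1 + t\<^sup>2 \<le> (2 + (1 + 2 * (cmod z)\<^sup>2) / (Im z)\<^sup>2) * (cmod (of_real t - z))\<^sup>2"
proof -
  define d where "d = cmod (of_real t - z)"
  have d: "Im z \<le> d" using Im_le_cmod_of_real_diff by (simp add: d_def)
  have "\<bar>t\<bar> \<le> d + cmod z"
    using norm_triangle_ineq[of "of_real t - z" z] by (simp add: d_def)
  then have "t\<^sup>2 \<le> (d + cmod z)\<^sup>2"
    using abs_le_square_iff[of t "d + cmod z"] d assms by simp
  also have "\<dots> \<le> 2 * d\<^sup>2 + 2 * (cmod z)\<^sup>2"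
    using sum_squares_bound[of d "cmod z"] by (simp add: power2_sum)
  finally have 1: "1 + t\<^sup>2 \<le> 2 * d\<^sup>2 + (1 + 2 * (cmod z)\<^sup>2)" by simp
  have "1 + 2 * (cmod z)\<^sup>2 \<le> (1 + 2 * (cmod z)\<^sup>2) * (d\<^sup>2 / (Im z)\<^sup>2)"
  proof -
    have "1 \<le> d\<^sup>2 / (Im z)\<^sup>2" using d assms by (simp add: power_mono)
    then show ?thesis
      by (metis mult.right_neutral mult_left_mono add_nonneg_nonneg mult_nonneg_nonneg zero_le_numeral zero_le_one zero_le_power2)
  qed
  with 1 show ?thesis unfolding d_def[symmetric] by (simp add: algebra_simps)
qed

lemma inverse_square_dist_le:
  assumes "Im z > 0"
  shows "1 / (cmod (of_real t - z))\<^sup>2 \<le> (2 + (1 + 2 * (cmod z)\<^sup>2) / (Im z)\<^sup>2) / (1 + t\<^sup>2)"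
proof -
  have "0 < cmod (of_real t - z)" using Im_le_cmod_of_real_diff[of z t] assms by linarith
  then show ?thesis using one_plus_square_le_dist[OF assms, of t]
    by (simp add: divide_simps mult.commute add_pos_nonneg)
qed

lemma herglotz_kernel_le:
  assumes "Im z > 0"
  shows "norm (herglotz_kernel z t) \<le> (cmod z + cmod (1 + z\<^sup>2) / Im z) / (1 + t\<^sup>2)"
proof -
  have nz: "of_real t - z \<noteq> 0" "0 < cmod (of_real t - z)"
    using Im_le_cmod_of_real_diff[of z t] assms by auto
  have p: "complex_of_real (1 + t\<^sup>2) \<noteq> 0"
    by (metis add_pos_nonneg less_numeral_extra(1) of_real_eq_0_iff order_less_irrefl zero_le_power2)
  \<comment> \<open>Over a common denominator the kernel has numerator 1 + t z. Splitting off a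
    multiple of t - z shows that the subtracted term t / (1 + t^2) improves the decay from 1 / |t|
    to 1 / (1 + t^2).\<close>
  have "1 + of_real t * z = z * (of_real t - z) + (1 + z\<^sup>2)" by (simp add: algebra_simps power2_eq_square)
  moreover have "herglotz_kernel z t = (1 + of_real t * z) / ((of_real t - z) * of_real (1 + t\<^sup>2))"
    unfolding herglotz_kernel_def using nz p by (simp add: field_simps power2_eq_square)
  ultimately have "herglotz_kernel z t = (z + (1 + z\<^sup>2) / (of_real t - z)) / of_real (1 + t\<^sup>2)"
    using nz p by (simp add: field_simps)
  then have "norm (herglotz_kernel z t) = cmod (z + (1 + z\<^sup>2) / (of_real t - z)) / (1 + t\<^sup>2)"
    by (metis norm_divide norm_of_real abs_of_nonneg add_nonneg_nonneg zero_le_one zero_le_power2)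
  also have "\<dots> \<le> (cmod z + cmod (1 + z\<^sup>2) / cmod (of_real t - z)) / (1 + t\<^sup>2)"
    by (intro divide_right_mono) (metis norm_triangle_ineq norm_divide, simp)
  also have "\<dots> \<le> (cmod z + cmod (1 + z\<^sup>2) / Im z) / (1 + t\<^sup>2)"
    by (intro divide_right_mono add_left_mono divide_left_mono Im_le_cmod_of_real_diff) (use assms nz in auto)
  finally show ?thesis .
qed

lemma log_integrable_measurable [measurable_dest]: "log_integrable u \<Longrightarrow> u \<in> borel_measurable borel"
  by (simp add: log_integrable_def)

text \<open>The common integrability criterion: a kernel decaying like 1 / (1 + t^2) costs only a
  constant against the integrable function u t / (1 + t^2). The type is general because both real
  and complex kernels occur.\<close>

lemma log_integrable_kernel:
  fixes k :: "real \<Rightarrow> 'a :: {real_normed_field, second_countable_topology, banach}"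
  assumes u: "log_integrable u" and k: "k \<in> borel_measurable borel"
    and le: "\<And>t. norm (k t) \<le> C / (1 + t\<^sup>2)"
  shows "integrable lborel (\<lambda>t. k t * of_real (u t))"
proof (rule Bochner_Integration.integrable_bound)
  show "integrable lborel (\<lambda>t. C * (u t / (1 + t\<^sup>2)))"
    using u unfolding log_integrable_def by (intro integrable_mult_right) auto
  show "(\<lambda>t. k t * of_real (u t)) \<in> borel_measurable lborel"
    using u k by (auto simp: log_integrable_def)
  have C: "0 \<le> C" using order_trans[OF norm_ge_zero le, of 0] by simp
  have "norm (k t * of_real (u t)) \<le> norm (C * (u t / (1 + t\<^sup>2)))" for t
  proof -
    have "norm (k t * of_real (u t)) \<le> C / (1 + t\<^sup>2) * \<bar>u t\<bar>"
      using mult_right_mono[OF le[of t], of "\<bar>u t\<bar>"] by (simp add: norm_mult)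
    also have "\<dots> = norm (C * (u t / (1 + t\<^sup>2)))" using C by (simp add: abs_mult)
    finally show ?thesis .
  qed
  then show "AE t in lborel. norm (k t * of_real (u t)) \<le> norm (C * (u t / (1 + t\<^sup>2)))" by simp
qed

lemma borel_measurable_herglotz_kernel [measurable]: "herglotz_kernel z \<in> borel_measurable borel"
  unfolding herglotz_kernel_def by measurable

lemma borel_measurable_poisson_kernel [measurable]: "poisson_kernel z \<in> borel_measurable borel"
  unfolding poisson_kernel_def by measurable

lemma integrable_herglotz:
  assumes "log_integrable u" "Im z > 0"
  shows "integrable lborel (\<lambda>t. herglotz_kernel z t * of_real (u t))"
  by (rule log_integrable_kernel[OF assms(1) _ herglotz_kernel_le[OF assms(2)]]) simp

lemma poisson_kernel_nonneg: "Im z \<ge> 0 \<Longrightarrow> 0 \<le> poisson_kernel z t"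
  by (simp add: poisson_kernel_def)

lemma Re_herglotz_kernel: "Re (1 / (of_real pi * \<i>) * (herglotz_kernel z t * of_real v)) = poisson_kernel z t * v"
proof -
  have "Re (1 / (of_real pi * \<i>) * (herglotz_kernel z t * of_real v)) = Im (herglotz_kernel z t) * v / pi"
  proof -
    have "1 / (of_real pi * \<i>) = - \<i> / of_real pi" by (simp add: field_simps)
    then have "1 / (of_real pi * \<i>) * (herglotz_kernel z t * of_real v)
        = (- \<i> * herglotz_kernel z t) * of_real (v / pi)" by simp
    then show ?thesis by (simp only: Re_complex_of_real Im_complex_of_real) simp
  qed
  also have "Im (herglotz_kernel z t) = Im z / (cmod (of_real t - z))\<^sup>2"
    by (simp add: herglotz_kernel_def Im_divide cmod_power2)
  finally show ?thesis by (simp add: poisson_kernel_def)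
qed

lemma Re_herglotz:
  assumes "log_integrable u" "Im z > 0"
  shows "Re (herglotz u z) = poisson u z" "integrable lborel (\<lambda>t. poisson_kernel z t * u t)"
proof -
  note i = integrable_mult_right[OF integrable_herglotz[OF assms], of "1 / (of_real pi * \<i>)"]
  have "Re (herglotz u z) = Re (LINT t|lborel. 1 / (of_real pi * \<i>) * (herglotz_kernel z t * of_real (u t)))"
    by (simp only: herglotz_def integral_mult_right_zero)
  also have "\<dots> = poisson u z"
    unfolding integral_Re[OF i, symmetric] by (simp only: poisson_def Re_herglotz_kernel)
  finally show "Re (herglotz u z) = poisson u z" .
  show "integrable lborel (\<lambda>t. poisson_kernel z t * u t)"
    using integrable_Re[OF i] by (simp only: Re_herglotz_kernel)
qed

text \<open>Intended for \<open>psi n\<close> the part of the density beyond level n, so that the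
  corresponding outer functions tend to 1.\<close>

lemma herglotz_tendsto_0:
  assumes u: "log_integrable u" and z: "Im z > 0"
    and psi: "\<And>n. psi n \<in> borel_measurable borel" "\<And>n t. \<bar>psi n t\<bar> \<le> \<bar>u t\<bar>" "\<And>t. (\<lambda>n. psi n t) \<longlonglongrightarrow> 0"
  shows "(\<lambda>n. herglotz (psi n) z) \<longlonglongrightarrow> 0"
proof -
  have "(\<lambda>n. LINT t|lborel. herglotz_kernel z t * of_real (psi n t)) \<longlonglongrightarrow> (LINT t::real|lborel. (0::complex))"
  proof (rule integral_dominated_convergence)
    show "integrable lborel (\<lambda>t. norm (herglotz_kernel z t * of_real (u t)))"
      using integrable_herglotz[OF u z] by (rule integrable_norm)
    show "AE t in lborel. (\<lambda>n. herglotz_kernel z t * of_real (psi n t)) \<longlonglongrightarrow> 0"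
    proof (rule AE_I2)
      fix t
      have "(\<lambda>n. herglotz_kernel z t * complex_of_real (psi n t)) \<longlonglongrightarrow> herglotz_kernel z t * of_real 0"
        by (intro tendsto_intros psi(3))
      then show "(\<lambda>n. herglotz_kernel z t * complex_of_real (psi n t)) \<longlonglongrightarrow> 0" by simp
    qed
    show "AE t in lborel. norm (herglotz_kernel z t * of_real (psi n t)) \<le> norm (herglotz_kernel z t * of_real (u t))" for n
      using psi(2) by (simp add: norm_mult mult_left_mono)
  qed (use psi(1) in auto)
  then show ?thesis unfolding herglotz_def by (auto intro!: tendsto_eq_intros)
qed

text \<open>The difference quotient of the kernel differs from its derivative by (w - z) / ((t - w)
  (t - z)^2), which is at most |w - z| times a constant over 1 + t^2 as long as Im w stays above Im
  z / 2. Integrating against \<open>u\<close> gives a limit directly.\<close>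

lemma herglotz_holomorphic:
  assumes u: "log_integrable u"
  shows "herglotz u holomorphic_on upper_half_plane"
  unfolding holomorphic_on_def
proof
  fix z assume "z \<in> upper_half_plane"
  then have z: "Im z > 0" by (simp add: upper_half_plane_iff)
  define C where "C = 2 + (1 + 2 * (cmod z)\<^sup>2) / (Im z)\<^sup>2"
  define D where "D = (LINT t|lborel. 1 / (of_real t - z)\<^sup>2 * of_real (u t))"
  define B where "B = (LINT t|lborel. \<bar>u t\<bar> / (1 + t\<^sup>2))"
  let ?H = "\<lambda>w. LINT t|lborel. herglotz_kernel w t * of_real (u t)"
  have iD: "integrable lborel (\<lambda>t. 1 / (of_real t - z)\<^sup>2 * of_real (u t))"
    by (rule log_integrable_kernel[OF u, where C=C])
      (use inverse_square_dist_le[OF z] in \<open>auto simp: C_def norm_divide norm_power\<close>)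
  have iB: "integrable lborel (\<lambda>t. \<bar>u t\<bar> / (1 + t\<^sup>2))"
    using integrable_norm[of lborel "\<lambda>t. u t / (1 + t\<^sup>2)"] u by (simp add: log_integrable_def)
  have "(?H has_field_derivative D) (at z)"
    unfolding has_field_derivative_iff LIM_def
  proof (intro allI impI)
    fix r :: real assume r: "r > 0"
    \<comment> \<open>The final estimate is |w - z| times the first summand; the added 1 keeps
      \<open>K\<close> positive even if \<open>u\<close> vanishes almost everywhere.\<close>
    define K where "K = 2 / Im z * C * B + 1"
    have C0: "0 \<le> C" by (simp add: C_def)
    have B0: "0 \<le> B" unfolding B_def by (rule integral_nonneg_AE) simp
    have K: "K > 0" using z C0 B0 by (simp add: K_def add_nonneg_pos)
    show "\<exists>s>0. \<forall>w. w \<noteq> z \<and> dist w z < s \<longrightarrow> dist ((?H w - ?H z) / (w - z)) D < r"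
    proof (intro exI[of _ "min (Im z / 2) (r / K)"] conjI allI impI)
      show "0 < min (Im z / 2) (r / K)" using z r K by simp
      fix w assume w: "w \<noteq> z \<and> dist w z < min (Im z / 2) (r / K)"
      then have wz: "cmod (w - z) < Im z / 2" "cmod (w - z) < r / K" "w \<noteq> z" by (auto simp: dist_norm)
      have "\<bar>Im (w - z)\<bar> \<le> cmod (w - z)" by (rule abs_Im_le_cmod)
      then have Iw: "Im w > Im z / 2" using wz(1) by (simp add: abs_if split: if_splits)
      then have Iw0: "Im w > 0" using z by simp
      have iw: "integrable lborel (\<lambda>t. herglotz_kernel w t * of_real (u t))"
        and iz: "integrable lborel (\<lambda>t. herglotz_kernel z t * of_real (u t))"
        using integrable_herglotz[OF u] Iw0 z by auto
      have "(?H w - ?H z) / (w - z) - D =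
          (LINT t|lborel. (herglotz_kernel w t * of_real (u t) - herglotz_kernel z t * of_real (u t)) / (w - z)
             - 1 / (of_real t - z)\<^sup>2 * of_real (u t))"
        unfolding D_def
        by (simp only: Bochner_Integration.integral_diff[OF integrable_divide[OF Bochner_Integration.integrable_diff[OF iw iz]] iD]
            integral_divide_zero Bochner_Integration.integral_diff[OF iw iz])
      also have "\<dots> = (LINT t|lborel. (w - z) / ((of_real t - w) * (of_real t - z)\<^sup>2) * of_real (u t))"
      proof (rule Bochner_Integration.integral_cong[OF refl])
        fix t :: real
        have tw: "of_real t - w \<noteq> 0" using Im_le_cmod_of_real_diff[of w t] Iw0 by auto
        have tz: "of_real t - z \<noteq> 0" using Im_le_cmod_of_real_diff[of z t] z by auto
        have e: "1 / a - 1 / b = (b - a) / (a * b)" if "a \<noteq> 0" "b \<noteq> 0" for a b :: complex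
          using that by (simp add: field_simps)
        have "(herglotz_kernel w t - herglotz_kernel z t) / (w - z) = 1 / ((of_real t - w) * (of_real t - z))"
          unfolding herglotz_kernel_def using e[OF tw tz] wz(3) by simp
        moreover have "1 / ((of_real t - w) * (of_real t - z)) - 1 / (of_real t - z)\<^sup>2
          = (w - z) / ((of_real t - w) * (of_real t - z)\<^sup>2)"
          using tw tz by (simp add: divide_simps power2_eq_square)
        ultimately show "(herglotz_kernel w t * of_real (u t) - herglotz_kernel z t * of_real (u t)) / (w - z)
             - 1 / (of_real t - z)\<^sup>2 * of_real (u t) = (w - z) / ((of_real t - w) * (of_real t - z)\<^sup>2) * of_real (u t)"
          by (metis (no_types, lifting) left_diff_distrib times_divide_eq_left)
      qed
      finally have eq: "(?H w - ?H z) / (w - z) - D = \<dots>" .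
      have lek: "norm ((w - z) / ((of_real t - w) * (of_real t - z)\<^sup>2))
           \<le> (cmod (w - z) * (2 / Im z) * C) / (1 + t\<^sup>2)" for t
      proof -
        have "cmod (of_real t - w) \<ge> Im z / 2" using Im_le_cmod_of_real_diff[of w t] Iw by simp
        then have "1 / cmod (of_real t - w) \<le> 2 / Im z" 
          using z by (simp add: divide_simps)
        then have "1 / cmod (of_real t - w) * (1 / (cmod (of_real t - z))\<^sup>2) \<le> 2 / Im z * (C / (1 + t\<^sup>2))"
          using inverse_square_dist_le[OF z, of t] z by (intro mult_mono) (auto simp: C_def)
        then have "cmod (w - z) * (1 / cmod (of_real t - w) * (1 / (cmod (of_real t - z))\<^sup>2))
           \<le> cmod (w - z) * (2 / Im z * (C / (1 + t\<^sup>2)))"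
          by (intro mult_left_mono) auto
        then show ?thesis by (simp add: norm_mult norm_divide norm_power)
      qed
      have le: "norm ((w - z) / ((of_real t - w) * (of_real t - z)\<^sup>2) * of_real (u t))
           \<le> cmod (w - z) * (2 / Im z) * C * (\<bar>u t\<bar> / (1 + t\<^sup>2))" for t
        using mult_right_mono[OF lek[of t], of "\<bar>u t\<bar>"] by (simp add: norm_mult norm_divide)
      have "norm ((?H w - ?H z) / (w - z) - D) \<le> (LINT t|lborel. cmod (w - z) * (2 / Im z) * C * (\<bar>u t\<bar> / (1 + t\<^sup>2)))"
        unfolding eq
      proof (rule Bochner_Integration.integral_norm_bound_integral)
        show "integrable lborel (\<lambda>t. cmod (w - z) * (2 / Im z) * C * (\<bar>u t\<bar> / (1 + t\<^sup>2)))"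
          using iB by (intro integrable_mult_right)
        show "integrable lborel (\<lambda>t. (w - z) / ((of_real t - w) * (of_real t - z)\<^sup>2) * of_real (u t))"
          by (rule log_integrable_kernel[OF u _ lek]) simp
      qed (rule le)
      also have "\<dots> = cmod (w - z) * (2 / Im z * C * B)"
        by (simp only: B_def integral_mult_right_zero mult.assoc)
      also have "\<dots> \<le> cmod (w - z) * K" by (intro mult_left_mono) (auto simp: K_def)
      also have "\<dots> < r" using wz(2) K by (simp add: pos_less_divide_eq)
      finally show "dist ((?H w - ?H z) / (w - z)) D < r" by (simp add: dist_norm)
    qed
  qed
  then have "?H field_differentiable (at z)" by (auto simp: field_differentiable_def)
  then have "(\<lambda>w. 1 / (of_real pi * \<i>) * ?H w) field_differentiable (at z)"
    by (intro derivative_intros) auto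
  then show "herglotz u field_differentiable at z within upper_half_plane"
    unfolding herglotz_def by (rule field_differentiable_at_within)
qed

text \<open>By the antiderivative arctan ((t - x) / y) / \<pi>, each closed half line ending at x =
  Re z has mass 1/2. Both contain x, which is harmless for an upper bound.\<close>

lemma poisson_kernel_nn_integral_le:
  assumes "Im z > 0"
  shows "(\<integral>\<^sup>+t. ennreal (poisson_kernel z t) \<partial>lborel) \<le> 1"
proof -
  define x y where "x = Re z" and "y = Im z"
  have y: "y > 0" using assms by (simp add: y_def)
  define F where "F = (\<lambda>t. arctan ((t - x) / y) / pi)"
  have k: "poisson_kernel z t = y / (pi * ((t - x)\<^sup>2 + y\<^sup>2))" for t
    by (simp add: poisson_kernel_def cmod_power2 x_def y_def)
  have "(\<integral>\<^sup>+t. ennreal (poisson_kernel z t) * indicator {x..} t \<partial>lborel) = ennreal (1/2 - F x)"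
  proof (rule nn_integral_FTC_atLeast)
    show "DERIV F t :> poisson_kernel z t" for t
    proof -
      have pos: "(t - x)\<^sup>2 + y\<^sup>2 > 0" using y by (simp add: add_nonneg_pos)
      have "1 + ((t - x) / y)\<^sup>2 = ((t - x)\<^sup>2 + y\<^sup>2) / y\<^sup>2"
        using y by (simp add: field_simps)
      then have eq: "inverse (1 + ((t - x) / y)\<^sup>2) * (1 / y) / pi = y / (pi * ((t - x)\<^sup>2 + y\<^sup>2))"
        using y pos by (simp add: field_simps power2_eq_square)
      have "((\<lambda>t. (t - x) / y) has_real_derivative 1 / y) (at t)"
        using y by (auto intro!: derivative_eq_intros)
      from DERIV_cdivide[OF DERIV_chain2[OF DERIV_arctan this], of pi]
      show ?thesis unfolding F_def k eq .
    qed
    have "filterlim (\<lambda>t. (t - x) / y) at_top at_top" using y by real_asymp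
    then have "((\<lambda>t. arctan ((t - x) / y)) \<longlongrightarrow> pi / 2) at_top"
      by (rule filterlim_compose[OF tendsto_arctan_at_top])
    then show "(F \<longlongrightarrow> 1/2) at_top" unfolding F_def
      using tendsto_divide[OF _ tendsto_const[of pi]] by fastforce
  qed (use assms in \<open>auto simp: poisson_kernel_nonneg\<close>)
  then have half: "(\<integral>\<^sup>+t. ennreal (poisson_kernel z t) * indicator {x..} t \<partial>lborel) = ennreal (1/2)"
    by (simp add: F_def)
  \<comment> \<open>The reflection t -> 2 x - t preserves the kernel and exchanges the half
    lines.\<close>
  have "(\<integral>\<^sup>+t. ennreal (poisson_kernel z t) * indicator {..x} t \<partial>lborel)
      = (\<integral>\<^sup>+t. ennreal (poisson_kernel z (2 * x + (-1) * t)) * indicator {..x} (2 * x + (-1) * t) \<partial>lborel)"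
    by (subst nn_integral_real_affine[where c="-1" and t="2*x"]) auto
  also have "\<dots> = (\<integral>\<^sup>+t. ennreal (poisson_kernel z t) * indicator {x..} t \<partial>lborel)"
    by (intro nn_integral_cong) (auto simp: k indicator_def power2_eq_square algebra_simps)
  finally have half': "(\<integral>\<^sup>+t. ennreal (poisson_kernel z t) * indicator {..x} t \<partial>lborel) = ennreal (1/2)"
    using half by simp
  have "(\<integral>\<^sup>+t. ennreal (poisson_kernel z t) \<partial>lborel)
      \<le> (\<integral>\<^sup>+t. ennreal (poisson_kernel z t) * indicator {x..} t + ennreal (poisson_kernel z t) * indicator {..x} t \<partial>lborel)"
    by (intro nn_integral_mono) (auto simp: indicator_def)
  also have "\<dots> = ennreal (1/2) + ennreal (1/2)"
    by (subst nn_integral_add) (auto simp: half half')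
  also have "\<dots> = 1" by (subst ennreal_plus[symmetric]) auto
  finally show ?thesis .
qed

section \<open>The Smirnov class\<close>

lemma smirnovE:
  assumes "f \<in> smirnov"
  obtains p M u c where "p holomorphic_on upper_half_plane" "\<And>z. z \<in> upper_half_plane \<Longrightarrow> norm (p z) \<le> exp M"
    "log_integrable u" "norm c = 1" "\<And>z. z \<in> upper_half_plane \<Longrightarrow> f z = p z / (c * exp (herglotz u z))"
proof -
  obtain p q where p: "p \<in> H_infinity" and q: "outer_function q"
    and f: "\<And>z. z \<in> upper_half_plane \<Longrightarrow> f z = p z / q z"
    using assms unfolding smirnov_def by blast
  obtain B where B: "\<And>z. z \<in> upper_half_plane \<Longrightarrow> norm (p z) \<le> B"
    using p by (auto simp: H_infinity_def bounded_iff)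
  have "norm (p z) \<le> exp (ln (max 1 B))" if "z \<in> upper_half_plane" for z
    using B[OF that] by simp
  moreover obtain c u where "norm c = 1" "u \<in> borel_measurable lborel" "integrable lborel (\<lambda>t::real. u t / (1 + t\<^sup>2))"
    and "\<And>z. z \<in> upper_half_plane \<Longrightarrow> q z = c * exp (herglotz u z)"
    using q unfolding outer_function_def herglotz_def herglotz_kernel_def by blast
  ultimately show ?thesis
    using that[of p "ln (max 1 B)" u c] p f by (simp add: H_infinity_def log_integrable_def)
qed

lemma smirnov_holomorphic:
  assumes "f \<in> smirnov" shows "f holomorphic_on upper_half_plane"
proof -
  obtain p M u c where *: "p holomorphic_on upper_half_plane" "log_integrable u" "norm c = 1"
    "\<And>z. z \<in> upper_half_plane \<Longrightarrow> f z = p z / (c * exp (herglotz u z))"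
    using smirnovE[OF assms] by metis
  have "(\<lambda>z. p z / (c * exp (herglotz u z))) holomorphic_on upper_half_plane"
    using * by (intro holomorphic_intros herglotz_holomorphic) auto
  then show ?thesis using *(4) by (simp cong: holomorphic_cong)
qed

lemma norm_smirnov_quotient:
  assumes "norm c = 1" "log_integrable u" "z \<in> upper_half_plane"
  shows "norm (w / (c * exp (herglotz u z))) = norm w * exp (- poisson u z)"
  using assms by (simp add: norm_divide norm_mult Re_herglotz(1) upper_half_plane_iff exp_minus field_simps)

lemma log_integrable_abs_le:
  assumes "log_integrable u" "v \<in> borel_measurable borel" "\<And>t. \<bar>v t\<bar> \<le> \<bar>u t\<bar>"
  shows "log_integrable v"
  unfolding log_integrable_def
proof
  show "integrable lborel (\<lambda>t. v t / (1 + t\<^sup>2))"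
  proof (rule Bochner_Integration.integrable_bound)
    show "integrable lborel (\<lambda>t. u t / (1 + t\<^sup>2))" using assms(1) by (simp add: log_integrable_def)
  qed (use assms in \<open>auto intro!: divide_right_mono\<close>)
qed (use assms in simp)

lemma poisson_mono:
  assumes "log_integrable u" "log_integrable v" "Im z > 0" "\<And>t. u t \<le> v t"
  shows "poisson u z \<le> poisson v z"
  unfolding poisson_def using assms
  by (intro integral_mono Re_herglotz(2) mult_left_mono poisson_kernel_nonneg) auto

text \<open>The numerator is bounded and - u \<le> |u|. A nonnegative density is taken so that the
  later averages can be handled by Tonelli's theorem.\<close>

lemma smirnov_norm_le:
  assumes "f \<in> smirnov"
  obtains C v where "log_integrable v" "\<And>t. v t \<ge> 0"
    "\<And>z. z \<in> upper_half_plane \<Longrightarrow> norm (f z) \<le> exp (C + poisson v z)"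
proof -
  obtain p M u c where *: "\<And>z. z \<in> upper_half_plane \<Longrightarrow> norm (p z) \<le> exp M" "log_integrable u" "norm c = 1"
    "\<And>z. z \<in> upper_half_plane \<Longrightarrow> f z = p z / (c * exp (herglotz u z))"
    using smirnovE[OF assms] by metis
  have v: "log_integrable (\<lambda>t. \<bar>u t\<bar>)" "log_integrable (\<lambda>t. - u t)"
    by (rule log_integrable_abs_le[OF *(2)]; use log_integrable_measurable[OF *(2)] in simp)+
  show ?thesis
  proof (rule that[OF v(1)])
    fix z assume z: "z \<in> upper_half_plane"
    have "- poisson u z = poisson (\<lambda>t. - u t) z" by (simp add: poisson_def)
    also have "\<dots> \<le> poisson (\<lambda>t. \<bar>u t\<bar>) z"
      using z v by (intro poisson_mono) (auto simp: upper_half_plane_iff)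
    finally have "norm (f z) \<le> exp M * exp (poisson (\<lambda>t. \<bar>u t\<bar>) z)"
      using *(4)[OF z] norm_smirnov_quotient[OF *(3,2) z] *(1)[OF z] by (simp add: mult_mono)
    then show "norm (f z) \<le> exp (M + poisson (\<lambda>t. \<bar>u t\<bar>) z)" by (simp add: exp_add)
  qed simp
qed

text \<open>\<open>q n\<close> is the outer function with \<open>log \<bar>q n\<bar> = - max 0 (- u - n)\<close> on the real line, where \<open>u\<close> belongs to
  the denominator of \<open>f\<close>; hence \<open>\<bar>f * q n\<bar>\<close> is at most a constant times \<open>exp n\<close>.\<close>

lemma smirnov_regularization:
  assumes "f \<in> smirnov"
  obtains q :: "nat \<Rightarrow> complex \<Rightarrow> complex" where
    "\<And>n. q n holomorphic_on upper_half_plane"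
    "\<And>n z. z \<in> upper_half_plane \<Longrightarrow> norm (q n z) \<le> 1"
    "\<And>n. \<exists>C. \<forall>z\<in>upper_half_plane. norm (f z * q n z) \<le> C"
    "\<And>z. z \<in> upper_half_plane \<Longrightarrow> (\<lambda>n. q n z) \<longlonglongrightarrow> 1"
proof -
  obtain p M u c where *: "\<And>z. z \<in> upper_half_plane \<Longrightarrow> norm (p z) \<le> exp M" "log_integrable u" "norm c = 1"
    "\<And>z. z \<in> upper_half_plane \<Longrightarrow> f z = p z / (c * exp (herglotz u z))"
    using smirnovE[OF assms] by metis
  define v where "v = (\<lambda>(n::nat) t. max 0 (- u t - real n))"
  have [measurable]: "u \<in> borel_measurable borel" using *(2) by (simp add: log_integrable_def)
  have vm: "v n \<in> borel_measurable borel" for n unfolding v_def by measurable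
  have vu: "\<bar>v n t\<bar> \<le> \<bar>u t\<bar>" for n t by (auto simp: v_def)
  have vl: "log_integrable (v n)" for n by (rule log_integrable_abs_le[OF *(2) vm vu])
  have v0: "(\<lambda>n. v n t) \<longlonglongrightarrow> 0" for t
  proof (rule tendsto_eventually)
    obtain N :: nat where "- u t \<le> real N" using real_arch_simple by blast
    then have "v n t = 0" if "n \<ge> N" for n using that by (auto simp: v_def)
    then show "eventually (\<lambda>n. v n t = 0) sequentially" by (auto simp: eventually_sequentially)
  qed
  show ?thesis
  proof (rule that[of "\<lambda>n z. exp (- herglotz (v n) z)"])
    show "(\<lambda>z. exp (- herglotz (v n) z)) holomorphic_on upper_half_plane" for n
      by (intro holomorphic_intros herglotz_holomorphic vl)
    have pv: "poisson (v n) z \<ge> 0" if "z \<in> upper_half_plane" for n z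
      unfolding poisson_def using that
      by (intro integral_nonneg_AE AE_I2 mult_nonneg_nonneg poisson_kernel_nonneg) (auto simp: v_def upper_half_plane_iff)
    have norm_q: "norm (exp (- herglotz (v n) z)) = exp (- poisson (v n) z)" if "z \<in> upper_half_plane" for n z
      using Re_herglotz(1)[OF vl] that by (simp add: upper_half_plane_iff)
    then show "norm (exp (- herglotz (v n) z)) \<le> 1" if "z \<in> upper_half_plane" for n z
      using pv that by simp
    show "\<exists>C. \<forall>z\<in>upper_half_plane. norm (f z * exp (- herglotz (v n) z)) \<le> C" for n
    proof (intro exI ballI)
      fix z assume z: "z \<in> upper_half_plane"
      then have z': "Im z > 0" by (simp add: upper_half_plane_iff)
      \<comment> \<open>Pointwise - u - v n \<le> n, and the kernel has mass at most 1. Converting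
        to \<open>ennreal\<close> replaces negative values by 0, which only weakens an upper
        bound.\<close>
      have "(LINT t|lborel. - (poisson_kernel z t * u t) - poisson_kernel z t * v n t) \<le> real n"
      proof (rule integral_real_bounded)
        have "(\<integral>\<^sup>+t. ennreal (- (poisson_kernel z t * u t) - poisson_kernel z t * v n t) \<partial>lborel)
           \<le> (\<integral>\<^sup>+t. ennreal (real n) * ennreal (poisson_kernel z t) \<partial>lborel)"
        proof (intro nn_integral_mono)
          fix t
          have "- (poisson_kernel z t * u t) - poisson_kernel z t * v n t = poisson_kernel z t * (- u t - v n t)"
            by (simp add: algebra_simps)
          also have "\<dots> \<le> poisson_kernel z t * real n"
            using z' by (intro mult_left_mono poisson_kernel_nonneg) (auto simp: v_def)
          finally show "ennreal (- (poisson_kernel z t * u t) - poisson_kernel z t * v n t)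
             \<le> ennreal (real n) * ennreal (poisson_kernel z t)"
            by (subst ennreal_mult[symmetric]) (use z' in \<open>auto simp: poisson_kernel_nonneg mult.commute intro!: ennreal_leI\<close>)
        qed
        also have "\<dots> = ennreal (real n) * (\<integral>\<^sup>+t. ennreal (poisson_kernel z t) \<partial>lborel)"
          by (intro nn_integral_cmult) measurable
        also have "\<dots> \<le> ennreal (real n) * 1"
          by (intro mult_left_mono poisson_kernel_nn_integral_le z') simp
        finally show "(\<integral>\<^sup>+t. ennreal (- (poisson_kernel z t * u t) - poisson_kernel z t * v n t) \<partial>lborel) \<le> ennreal (real n)"
          by simp
      qed simp
      moreover have "(LINT t|lborel. - (poisson_kernel z t * u t) - poisson_kernel z t * v n t) = - poisson u z - poisson (v n) z"
        unfolding poisson_def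
        by (subst Bochner_Integration.integral_diff) (use Re_herglotz(2)[OF _ z'] *(2) vl in auto)
      ultimately have le: "- poisson u z - poisson (v n) z \<le> real n" by simp
      have "norm (f z * exp (- herglotz (v n) z)) = norm (p z) * (exp (- poisson u z) * exp (- poisson (v n) z))"
        using *(4)[OF z] norm_smirnov_quotient[OF *(3,2) z] norm_q[OF z] by (simp add: norm_mult)
      also have "exp (- poisson u z) * exp (- poisson (v n) z) = exp (- poisson u z - poisson (v n) z)"
        by (simp add: exp_add[symmetric])
      also have "norm (p z) * \<dots> \<le> exp M * exp (real n)"
        using *(1)[OF z] le by (intro mult_mono) auto
      finally show "norm (f z * exp (- herglotz (v n) z)) \<le> exp M * exp (real n)" .
    qed
    show "(\<lambda>n. exp (- herglotz (v n) z)) \<longlonglongrightarrow> 1" if "z \<in> upper_half_plane" for z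
      using tendsto_exp[OF tendsto_minus[OF herglotz_tendsto_0[OF *(2) _ vm vu v0, of z]]] that
      by (simp add: upper_half_plane_iff)
  qed
qed

section \<open>Analytic continuation across the real line\<close>

lemma has_contour_integral_horizontal_iff:
  assumes "a < b"
  shows "(k has_contour_integral J) (linepath (Complex a c) (Complex b c)) \<longleftrightarrow>
    ((\<lambda>x. k (Complex x c)) has_integral J) {a..b}"
proof -
  define k' where "k' = (\<lambda>w. k (w + \<i> * of_real c))"
  have "(k has_contour_integral J) (linepath (Complex a c) (Complex b c)) \<longleftrightarrow>
     (k' has_contour_integral J) (linepath (of_real a) (of_real b))"
  proof -
    have "linepath (Complex a c) (Complex b c) x = linepath (of_real a) (of_real b) x + \<i> * of_real c"
      "Complex b c - Complex a c = of_real b - of_real a" for x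
      by (simp_all add: linepath_def complex_eq_iff algebra_simps)
    then show ?thesis unfolding has_contour_integral_linepath k'_def by simp
  qed
  also have "\<dots> \<longleftrightarrow> ((\<lambda>x. k (Complex x c)) has_integral J) {a..b}"
    using assms by (subst has_contour_integral_linepath_Reals_iff) (auto simp: k'_def Complex_eq)
  finally show ?thesis .
qed

text \<open>Expresses the contour integral by four integrals over real intervals, so that the bottom
  side can be moved with the convergence theorems for real integrals.\<close>

lemma has_contour_integral_rectpath_iff:
  assumes ab: "a < b" and ys: "y < s"
    and cont: "continuous_on (path_image (rectpath (Complex a y) (Complex b s))) k"
    and I: "(k has_contour_integral I) (rectpath (Complex a y) (Complex b s))"
  shows "integral {a..b} (\<lambda>x. k (Complex x y)) + \<i> * integral {y..s} (\<lambda>t. k (Complex b t))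
    - integral {a..b} (\<lambda>x. k (Complex x s)) - \<i> * integral {y..s} (\<lambda>t. k (Complex a t)) = I"
proof -
  have im: "continuous_on {a..b} (\<lambda>x. k (Complex x y))" "continuous_on {a..b} (\<lambda>x. k (Complex x s))"
    "continuous_on {y..s} (\<lambda>t. k (Complex a t))" "continuous_on {y..s} (\<lambda>t. k (Complex b t))"
    using ab ys by (auto intro!: continuous_on_compose2[OF cont] continuous_intros simp: path_image_rectpath Complex_eq)
  have h: "(k has_contour_integral integral {a..b} (\<lambda>x. k (Complex x y))) (linepath (Complex a y) (Complex b y))"
    "(k has_contour_integral integral {a..b} (\<lambda>x. k (Complex x s))) (linepath (Complex a s) (Complex b s))"
    using im(1,2) ab by (auto simp: has_contour_integral_horizontal_iff intro!: integrable_integral integrable_continuous_real)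
  have v: "(k has_contour_integral (\<i> * integral {y..s} (\<lambda>t. k (Complex a t)))) (linepath (Complex a y) (Complex a s))"
    "(k has_contour_integral (\<i> * integral {y..s} (\<lambda>t. k (Complex b t)))) (linepath (Complex b y) (Complex b s))"
    using im(3,4) ys by (subst has_contour_integral_linepath_same_Re_iff; 
        auto intro!: integrable_integral integrable_continuous_real)+
  have "(k has_contour_integral (integral {a..b} (\<lambda>x. k (Complex x y)) + (\<i> * integral {y..s} (\<lambda>t. k (Complex b t))
     + (- integral {a..b} (\<lambda>x. k (Complex x s)) + - (\<i> * integral {y..s} (\<lambda>t. k (Complex a t))))))) (rectpath (Complex a y) (Complex b s))"
    unfolding rectpath_def Let_def complex.sel
    by (intro has_contour_integral_join h v has_contour_integral_reverse_linepath valid_path_join) auto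
  from has_contour_integral_unique[OF this I] show ?thesis by (simp add: algebra_simps)
qed

text \<open>The Cauchy integral, without the factor 1 / (2 \<pi> i), over the counterclockwise
  boundary of the rectangle [a, b] x [0, s] with its side on the real line left out.\<close>

definition three_sides :: "(complex \<Rightarrow> complex) \<Rightarrow> real \<Rightarrow> real \<Rightarrow> real \<Rightarrow> complex \<Rightarrow> complex" where
  "three_sides k a b s z = \<i> * integral {0..s} (\<lambda>t. k (Complex b t) / (Complex b t - z))
    - integral {a..b} (\<lambda>x. k (Complex x s) / (Complex x s - z))
    - \<i> * integral {0..s} (\<lambda>t. k (Complex a t) / (Complex a t - z))"

lemma Cauchy_integral_holomorphic:
  fixes c :: "real \<Rightarrow> complex"
  assumes "continuous_on {l..u} c" "continuous_on {l..u} g" "convex U" "\<And>t z. t \<in> {l..u} \<Longrightarrow> z \<in> U \<Longrightarrow> g t \<noteq> z"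
  shows "(\<lambda>z. integral {l..u} (\<lambda>t. c t / (g t - z))) holomorphic_on U"
proof -
  have "(\<lambda>z. integral (cbox l u) (\<lambda>t. c t / (g t - z))) holomorphic_on U"
  proof (rule leibniz_rule_holomorphic)
    fix z t assume zt: "z \<in> U" "t \<in> cbox l u"
    then have "g t - z \<noteq> 0" using assms(4) by auto
    then show "((\<lambda>z. c t / (g t - z)) has_field_derivative c t / (g t - z)\<^sup>2) (at z within U)"
      by (auto intro!: derivative_eq_intros simp: power2_eq_square)
  next
    fix z assume "z \<in> U"
    then show "(\<lambda>t. c t / (g t - z)) integrable_on cbox l u"
      using assms by (auto intro!: integrable_continuous_real continuous_intros)
  next
    show "continuous_on (U \<times> cbox l u) (\<lambda>(z, t). c t / (g t - z)\<^sup>2)"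
      unfolding split_beta using assms
      by (auto intro!: continuous_intros continuous_on_compose2[OF assms(1)] continuous_on_compose2[OF assms(2)])
  qed (rule assms)
  then show ?thesis by simp
qed

text \<open>None of the three sides separates the rectangle from the points below it, so the domain
  crosses the real line; this is where the analytic continuation comes from.\<close>

lemma three_sides_holomorphic:
  assumes "continuous_on {0..s} (\<lambda>t. k (Complex a t))" "continuous_on {0..s} (\<lambda>t. k (Complex b t))"
    "continuous_on {a..b} (\<lambda>x. k (Complex x s))"
  shows "three_sides k a b s holomorphic_on {z. a < Re z \<and> Re z < b \<and> Im z < s}"
proof -
  have "{z. a < Re z \<and> Re z < b \<and> Im z < s} = {z. a < Re z} \<inter> ({z. Re z < b} \<inter> {z. Im z < s})" by auto
  then have c: "convex {z. a < Re z \<and> Re z < b \<and> Im z < s}"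
    by (auto intro!: convex_Int convex_halfspace_Re_gt convex_halfspace_Re_lt convex_halfspace_Im_lt)
  show ?thesis unfolding three_sides_def[abs_def]
    using assms
    by (intro holomorphic_intros Cauchy_integral_holomorphic c) (auto intro!: continuous_intros simp: Complex_eq complex_eq_iff)
qed

lemma integral_shrinking_tendsto:
  fixes g :: "nat \<Rightarrow> real \<Rightarrow> complex"
  assumes b: "b integrable_on {0..s}" "\<And>t. 0 \<le> b t" and g: "\<And>n. continuous_on {0<..s} (g n)"
    and le: "\<And>n t. t \<in> {0<..s} \<Longrightarrow> norm (g n t) \<le> b t"
    and lim: "\<And>t. t \<in> {0<..s} \<Longrightarrow> (\<lambda>n. g n t) \<longlonglongrightarrow> k t"
    and Y: "\<And>n. Y n > 0" "Y \<longlonglongrightarrow> 0"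
  shows "(\<lambda>n. integral {Y n..s} (g n)) \<longlonglongrightarrow> integral {0..s} k"
proof -
  \<comment> \<open>As Y n > 0, every \<open>h n\<close> vanishes at 0, so the pointwise limit must
    be 0 there; the change of one value does not affect the integral.\<close>
  define k1 where "k1 = (\<lambda>t. if t = 0 then 0 else k t)"
  define h where "h = (\<lambda>n t. if t \<in> {Y n..s} then g n t else 0)"
  have sub: "{Y n..s} \<subseteq> {0<..s}" "{Y n..s} \<subseteq> {0..s}" for n using Y(1)[of n] by auto
  have hi: "h n integrable_on {0..s}" for n
    unfolding h_def integrable_restrict_Int using sub(2)[of n]
    by (auto simp: Int_absorb2 Int_absorb1 intro!: integrable_continuous_real continuous_on_subset[OF g sub(1)])
  have "(\<lambda>n. integral {0..s} (h n)) \<longlonglongrightarrow> integral {0..s} k1"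
  proof (rule dominated_convergence[OF hi])
    show "b integrable_on {0..s}" by (rule b)
    show "norm (h n t) \<le> b t" if "t \<in> {0..s}" for n t
      using le[of t n] b(2)[of t] sub(1)[of n] by (auto simp: h_def)
    show "(\<lambda>n. h n t) \<longlonglongrightarrow> k1 t" if t: "t \<in> {0..s}" for t
    proof (cases "t = 0")
      case True
      then have "h n t = 0" for n using Y(1)[of n] by (simp add: h_def)
      then show ?thesis by (simp add: k1_def True)
    next
      case False
      then have "t > 0" using t by simp
      then have "eventually (\<lambda>n. Y n < t) sequentially" using Y(2) by (simp add: order_tendstoD(2))
      then have "eventually (\<lambda>n. g n t = h n t) sequentially"
        by eventually_elim (use t in \<open>auto simp: h_def\<close>)
      then show ?thesis using lim[of t] False t tendsto_cong by (fastforce simp: k1_def)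
    qed
  qed
  also have "(\<lambda>n. integral {0..s} (h n)) = (\<lambda>n. integral {Y n..s} (g n))"
    unfolding h_def integral_restrict_Int using sub(2) by (simp add: Int_absorb2 Int_absorb1 del: Int_atLeastAtMost)
  also have "integral {0..s} k1 = integral {0..s} k"
    by (rule integral_spike[of "{0}"]) (auto simp: k1_def)
  finally show ?thesis .
qed

text \<open>Cauchy's theorem or formula is applied to \<open>G n\<close> on the rectangle with
  bottom at height \<open>Y n\<close>. As n grows, the three other sides converge by dominated
  convergence with majorant |k|, and the bottom converges by the assumed L1 convergence. The
  constant \<open>c\<close> covers both positions of z: below the line (value 0) and inside the
  rectangle.\<close>

lemma Cauchy_rectangle_boundary:
  fixes k :: "complex \<Rightarrow> complex" and F :: "real \<Rightarrow> complex"
  assumes ab: "a < b" and s: "0 < s"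
    and S: "open S" "convex S" "S \<subseteq> upper_half_plane" "\<And>x t. x \<in> {a..b} \<Longrightarrow> t \<in> {0<..s} \<Longrightarrow> Complex x t \<in> S"
    and G: "\<And>n. G n holomorphic_on S" "\<And>n w. w \<in> S \<Longrightarrow> norm (G n w) \<le> norm (k w)"
      "\<And>w. w \<in> S \<Longrightarrow> (\<lambda>n. G n w) \<longlonglongrightarrow> k w"
    and sides: "continuous_on {0..s} (\<lambda>t. k (Complex a t))" "continuous_on {0..s} (\<lambda>t. k (Complex b t))"
      "continuous_on {a..b} (\<lambda>x. k (Complex x s))"
    and F: "F absolutely_integrable_on {a..b}"
    and Y: "\<And>n. Y n > 0" "Y \<longlonglongrightarrow> 0"
    and conv: "(\<lambda>n. LINT x|lebesgue_on {a..b}. norm (G n (Complex x (Y n)) - F x)) \<longlonglongrightarrow> 0"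
    and z: "Im z < 0 \<and> c = 0 \<or> a < Re z \<and> Re z < b \<and> 0 < Im z \<and> Im z < s \<and> c = 2 * of_real pi * \<i> * k z"
  shows "three_sides k a b s z + integral {a..b} (\<lambda>x. F x / (of_real x - z)) = c"
proof -
  define d where "d = \<bar>Im z\<bar> / 2"
  have d: "d > 0" using z by (auto simp: d_def)
  define cn where "cn = (\<lambda>n. if Im z < 0 then 0 else 2 * of_real pi * \<i> * G n z)"
  have zS: "Im z > 0 \<Longrightarrow> z \<in> S" using S(4)[of "Re z" "Im z"] z by auto
  have cn: "cn \<longlonglongrightarrow> c"
  proof (cases "Im z < 0")
    case True
    then show ?thesis using z by (auto simp: cn_def)
  next
    case False
    then have "cn = (\<lambda>n. 2 * of_real pi * \<i> * G n z)" "c = 2 * of_real pi * \<i> * k z" "z \<in> S"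
      using z zS by (auto simp: cn_def)
    then show ?thesis using G(3) by (auto intro!: tendsto_intros)
  qed
  have Gc: "continuous_on S (G n)" for n using G(1) by (rule holomorphic_on_imp_continuous_on)
  \<comment> \<open>For \<open>Y n\<close> below this bound, the bottom side stays under the top
    side and, if z is above the line, at least Im z / 2 below z. This is the distance
    \<open>d\<close> used for the Cauchy kernel.\<close>
  define m where "m = min s (if Im z < 0 then s else Im z / 2)"
  have m: "m > 0" using s z by (auto simp: m_def)
  have evY: "eventually (\<lambda>n. Y n < m) sequentially" using Y(2) m by (simp add: order_tendstoD(2))
  let ?bot = "\<lambda>n. integral {a..b} (\<lambda>x. G n (Complex x (Y n)) / (Complex x (Y n) - z))"
  let ?top = "\<lambda>n. integral {a..b} (\<lambda>x. G n (Complex x s) / (Complex x s - z))"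
  let ?side = "\<lambda>n e. integral {Y n..s} (\<lambda>t. G n (Complex e t) / (Complex e t - z))"
  have id: "?bot n + \<i> * ?side n b - ?top n - \<i> * ?side n a = cn n" if Yn: "Y n < m" for n
  proof -
    have Yns: "Y n < s" using Yn by (simp add: m_def)
    let ?R = "rectpath (Complex a (Y n)) (Complex b s)"
    have im: "path_image ?R \<subseteq> S"
    proof
      fix w assume w: "w \<in> path_image ?R"
      then have "Re w \<in> {a..b}" "Im w \<in> {0<..s}"
        using ab Yns Y(1)[of n] by (auto simp: path_image_rectpath)
      then show "w \<in> S" using S(4)[of "Re w" "Im w"] by simp
    qed
    have znot: "z \<notin> path_image ?R"
      using z Yns Y(1)[of n] Yn ab by (auto simp: path_image_rectpath m_def split: if_splits)
    have I: "((\<lambda>w. G n w / (w - z)) has_contour_integral cn n) ?R"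
    proof (cases "Im z < 0")
      case True
      then have "z \<notin> S" using S(3) by (auto simp: upper_half_plane_iff)
      then have "(\<lambda>w. G n w / (w - z)) holomorphic_on S"
        by (intro holomorphic_intros G) auto
      then show ?thesis using True im
        by (auto simp: cn_def intro!: Cauchy_theorem_convex_simple[OF _ S(2)])
    next
      case False
      then have zin: "z \<in> S" "a < Re z" "Re z < b" "Im z < s" "Y n < Im z" using z zS Yn by (auto simp: m_def)
      have w: "winding_number ?R z = 1"
        using zin by (intro winding_number_rectpath) (auto simp: in_box_complex_iff)
      have "((\<lambda>w. G n w / (w - z)) has_contour_integral (2*pi * \<i> * winding_number ?R z * G n z)) ?R"
        using im znot zin S(1) by (intro Cauchy_integral_formula_convex_simple[OF S(2) G(1)]) (auto simp: interior_open)
      then show ?thesis using False w by (simp add: cn_def)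
    qed
    have "continuous_on (path_image ?R) (\<lambda>w. G n w / (w - z))"
      using znot by (auto intro!: continuous_intros continuous_on_subset[OF Gc im])
    from has_contour_integral_rectpath_iff[OF ab Yns this I] show ?thesis by simp
  qed
  have nz: "Complex a t - z \<noteq> 0" "Complex b t - z \<noteq> 0" if "t \<ge> 0" for t
    using z that by (auto simp: complex_eq_iff)
  have nztop: "Complex x s - z \<noteq> 0" for x
    using z s by (auto simp: complex_eq_iff)
  have sidelim: "(\<lambda>n. ?side n e) \<longlonglongrightarrow> integral {0..s} (\<lambda>t. k (Complex e t) / (Complex e t - z))"
    if e: "e = a \<or> e = b" for e
  proof (rule integral_shrinking_tendsto[where b="\<lambda>t. norm (k (Complex e t) / (Complex e t - z))", OF _ _ _ _ _ Y])
    have nze: "Complex e t - z \<noteq> 0" if "t \<ge> 0" for t using nz[OF that] e by auto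
    have ce: "continuous_on {0..s} (\<lambda>t. k (Complex e t))" using e sides by auto
    show "(\<lambda>t. norm (k (Complex e t) / (Complex e t - z))) integrable_on {0..s}"
      using nze ce by (auto intro!: integrable_continuous_real continuous_intros simp: Complex_eq)
    have inS: "Complex e t \<in> S" if "t \<in> {0<..s}" for t using S(4)[of e t] e ab that by auto
    show "continuous_on {0<..s} (\<lambda>t. G n (Complex e t) / (Complex e t - z))" for n
      using nze inS by (auto intro!: continuous_intros continuous_on_compose2[OF Gc] simp: Complex_eq)
    show "norm (G n (Complex e t) / (Complex e t - z)) \<le> norm (k (Complex e t) / (Complex e t - z))" if "t \<in> {0<..s}" for n t
      using G(2)[OF inS[OF that]] by (auto simp: norm_divide intro!: divide_right_mono)
    show "0 \<le> norm (k (Complex e t) / (Complex e t - z))" for t by simp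
    show "(\<lambda>n. G n (Complex e t) / (Complex e t - z)) \<longlonglongrightarrow> k (Complex e t) / (Complex e t - z)" if "t \<in> {0<..s}" for t
      using nze[of t] that by (intro tendsto_intros G(3) inS) auto
  qed
  have toplim: "?top \<longlonglongrightarrow> integral {a..b} (\<lambda>x. k (Complex x s) / (Complex x s - z))"
  proof (rule dominated_convergence)
    have inS: "Complex x s \<in> S" if "x \<in> {a..b}" for x using S(4)[of x s] s that by auto
    show "(\<lambda>x. G n (Complex x s) / (Complex x s - z)) integrable_on {a..b}" for n
      using nztop inS by (auto intro!: integrable_continuous_real continuous_intros continuous_on_compose2[OF Gc] simp: Complex_eq)
    show "(\<lambda>x. norm (k (Complex x s) / (Complex x s - z))) integrable_on {a..b}"
      using nztop sides(3) by (auto intro!: integrable_continuous_real continuous_intros simp: Complex_eq)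
    show "norm (G n (Complex x s) / (Complex x s - z)) \<le> norm (k (Complex x s) / (Complex x s - z))" if "x \<in> {a..b}" for n x
      using G(2)[OF inS[OF that]] by (auto simp: norm_divide intro!: divide_right_mono)
    show "(\<lambda>n. G n (Complex x s) / (Complex x s - z)) \<longlonglongrightarrow> k (Complex x s) / (Complex x s - z)" if "x \<in> {a..b}" for x
      using nztop that by (intro tendsto_intros G(3) inS) auto
  qed
  let ?M = "lebesgue_on {a..b}"
  have Fi: "integrable ?M F" using F by (simp add: integrable_restrict_space set_integrable_def)
  have distz: "d \<le> cmod (Complex x y - z)" if "y = 0 \<or> 0 < y \<and> y < m" for x y
  proof -
    have "d \<le> \<bar>Im (Complex x y - z)\<bar>" using that z by (auto simp: d_def m_def split: if_splits)
    then show ?thesis using abs_Im_le_cmod order_trans by blast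
  qed
  have botlim: "?bot \<longlonglongrightarrow> integral {a..b} (\<lambda>x. F x / (of_real x - z))"
  proof (rule Lim_transform2[OF _ Lim_null_comparison])
    show "(\<lambda>n. integral {a..b} (\<lambda>x. F x / (of_real x - z))) \<longlonglongrightarrow> integral {a..b} (\<lambda>x. F x / (of_real x - z))" by simp
    let ?B = "\<lambda>n. (LINT x|?M. norm (G n (Complex x (Y n)) - F x)) / d + Y n / d\<^sup>2 * (LINT x|?M. norm (F x))"
    have "?B \<longlonglongrightarrow> 0 / d + 0 / d\<^sup>2 * (LINT x|?M. norm (F x))"
      using d by (intro tendsto_intros conv Y(2)) auto
    then show "?B \<longlonglongrightarrow> 0" by simp
    show "eventually (\<lambda>n. norm (integral {a..b} (\<lambda>x. F x / (of_real x - z)) - ?bot n) \<le> ?B n) sequentially"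
    proof (rule eventually_mono[OF evY])
      fix n assume elim: "Y n < m"
      have inS: "Complex x (Y n) \<in> S" if "x \<in> {a..b}" for x
        using S(4)[of x "Y n"] that elim Y(1)[of n] by (auto simp: m_def)
      have nz1: "Complex x (Y n) - z \<noteq> 0" for x using distz[of "Y n" x] d Y(1)[of n] elim by auto
      have Ri: "integrable ?M (\<lambda>x. G n (Complex x (Y n)))"
      proof -
        have "continuous_on {a..b} (\<lambda>x. G n (Complex x (Y n)))"
          using inS by (auto intro!: continuous_on_compose2[OF Gc] continuous_intros simp: Complex_eq)
        then have "(\<lambda>x. G n (Complex x (Y n))) absolutely_integrable_on {a..b}"
          by (rule absolutely_integrable_continuous_real)
        then show ?thesis by (simp add: integrable_restrict_space set_integrable_def)
      qed
      have c1: "continuous_on {a..b} (\<lambda>x. 1 / (Complex x (Y n) - z))" 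
        using nz1 by (auto intro!: continuous_intros simp: Complex_eq)
      have c2: "continuous_on {a..b} (\<lambda>x. 1 / (complex_of_real x - z))" 
        using z by (auto intro!: continuous_intros)
      have m1: "(\<lambda>x. 1 / (Complex x (Y n) - z)) \<in> borel_measurable ?M" "(\<lambda>x. 1 / (complex_of_real x - z)) \<in> borel_measurable ?M"
        using c1 c2 by (auto intro!: continuous_imp_measurable_on_sets_lebesgue)
      have le1: "norm (1 / (Complex x (Y n) - z)) \<le> 1 / d" for x
        using distz[of "Y n" x] d Y(1)[of n] elim by (auto simp: norm_divide intro!: divide_left_mono mult_pos_pos)
      have le2: "norm (1 / (complex_of_real x - z)) \<le> 1 / d" for x
        using distz[of 0 x] d by (auto simp: norm_divide complex_of_real_def intro!: divide_left_mono mult_pos_pos)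
      have i1: "integrable ?M (\<lambda>x. G n (Complex x (Y n)) / (Complex x (Y n) - z))"
      proof (rule Bochner_Integration.integrable_bound)
        show "integrable ?M (\<lambda>x. 1 / d * norm (G n (Complex x (Y n))))" using Ri by simp
        show "(\<lambda>x. G n (Complex x (Y n)) / (Complex x (Y n) - z)) \<in> borel_measurable ?M"
          using borel_measurable_times[OF _ m1(1)] Ri by (simp add: borel_measurable_integrable)
        show "AE x in ?M. norm (G n (Complex x (Y n)) / (Complex x (Y n) - z)) \<le> norm (1 / d * norm (G n (Complex x (Y n))))"
          using mult_right_mono[OF le1] d by (auto simp: norm_divide)
      qed
      have i2: "integrable ?M (\<lambda>x. F x / (of_real x - z))"
      proof (rule Bochner_Integration.integrable_bound)
        show "integrable ?M (\<lambda>x. 1 / d * norm (F x))" using Fi by simp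
        show "(\<lambda>x. F x / (of_real x - z)) \<in> borel_measurable ?M"
          using borel_measurable_times[OF _ m1(2)] Fi by (simp add: borel_measurable_integrable)
        show "AE x in ?M. norm (F x / (of_real x - z)) \<le> norm (1 / d * norm (F x))"
          using mult_right_mono[OF le2] d by (auto simp: norm_divide)
      qed
      have "integral {a..b} (\<lambda>x. F x / (of_real x - z)) - ?bot n
        = (LINT x|?M. F x / (of_real x - z) - G n (Complex x (Y n)) / (Complex x (Y n) - z))"
        using i1 i2 by (simp add: lebesgue_integral_eq_integral)
      also have "norm \<dots> \<le> (LINT x|?M. 1 / d * norm (G n (Complex x (Y n)) - F x) + Y n / d\<^sup>2 * norm (F x))"
      proof (rule Bochner_Integration.integral_norm_bound_integral)
        show "integrable ?M (\<lambda>x. F x / (of_real x - z) - G n (Complex x (Y n)) / (Complex x (Y n) - z))"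
          using i1 i2 by simp
        show "integrable ?M (\<lambda>x. 1 / d * norm (G n (Complex x (Y n)) - F x) + Y n / d\<^sup>2 * norm (F x))"
          using Ri Fi by auto
        fix x
        have nz2: "of_real x - z \<noteq> 0" using z by (auto simp: complex_eq_iff)
        \<comment> \<open>The error has two sources: F against \<open>G n\<close>, controlled in L1,
          and the Cauchy kernel at height \<open>Y n\<close> against the one at height 0, whose
          difference is at most Y n / d^2.\<close>
        have "F x / (of_real x - z) - G n (Complex x (Y n)) / (Complex x (Y n) - z)
          = (F x - G n (Complex x (Y n))) * (1 / (Complex x (Y n) - z)) + \<i> * of_real (Y n) * F x * ((1 / (Complex x (Y n) - z)) * (1 / (of_real x - z)))"
          using nz2 nz1[of x] by (simp add: Complex_eq divide_simps) (simp add: algebra_simps)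
        also have "norm \<dots> \<le> norm (F x - G n (Complex x (Y n))) * (1 / d) + Y n * norm (F x) * ((1 / d) * (1 / d))"
        proof (intro norm_triangle_le add_mono)
          show "norm ((F x - G n (Complex x (Y n))) * (1 / (Complex x (Y n) - z))) \<le> norm (F x - G n (Complex x (Y n))) * (1 / d)"
            unfolding norm_mult by (intro mult_left_mono le1) simp
          show "norm (\<i> * of_real (Y n) * F x * ((1 / (Complex x (Y n) - z)) * (1 / (of_real x - z))))
             \<le> Y n * norm (F x) * ((1 / d) * (1 / d))"
            unfolding norm_mult using Y(1)[of n] d by (intro mult_mono le1 le2) auto
        qed
        finally show "norm (F x / (of_real x - z) - G n (Complex x (Y n)) / (Complex x (Y n) - z))
          \<le> 1 / d * norm (G n (Complex x (Y n)) - F x) + Y n / d\<^sup>2 * norm (F x)"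
          by (simp add: norm_minus_commute power2_eq_square)
      qed
      also have "\<dots> = ?B n" using Ri Fi by simp
      finally show "norm (integral {a..b} (\<lambda>x. F x / (of_real x - z)) - ?bot n) \<le> ?B n" .
    qed
  qed
  have "(\<lambda>n. ?bot n + \<i> * ?side n b - ?top n - \<i> * ?side n a) \<longlonglongrightarrow>
    integral {a..b} (\<lambda>x. F x / (of_real x - z)) + \<i> * integral {0..s} (\<lambda>t. k (Complex b t) / (Complex b t - z))
    - integral {a..b} (\<lambda>x. k (Complex x s) / (Complex x s - z)) - \<i> * integral {0..s} (\<lambda>t. k (Complex a t) / (Complex a t - z))"
    by (intro tendsto_intros botlim sidelim toplim) auto
  moreover have "eventually (\<lambda>n. ?bot n + \<i> * ?side n b - ?top n - \<i> * ?side n a = cn n) sequentially"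
    using evY by eventually_elim (rule id)
  ultimately have "cn \<longlonglongrightarrow> integral {a..b} (\<lambda>x. F x / (of_real x - z)) + \<i> * integral {0..s} (\<lambda>t. k (Complex b t) / (Complex b t - z))
    - integral {a..b} (\<lambda>x. k (Complex x s) / (Complex x s - z)) - \<i> * integral {0..s} (\<lambda>t. k (Complex a t) / (Complex a t - z))"
    by (rule Lim_transform_eventually)
  from LIMSEQ_unique[OF cn this] show ?thesis by (simp add: three_sides_def)
qed

section \<open>Boundary values along vertical segments\<close>

lemma has_boundary_value_vertical:
  assumes "has_boundary_value f x l" shows "((\<lambda>t. f (Complex x t)) \<longlongrightarrow> l) (at_right 0)"
proof -
  let ?S = "{z \<in> upper_half_plane. \<bar>Re z - x\<bar> < Im z}"
  have "(f \<longlongrightarrow> l) (at (of_real x) within ?S)"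
    using assms[unfolded has_boundary_value_def, rule_format, of 1] by simp
  moreover have "filterlim (\<lambda>t. Complex x t) (at (of_real x) within ?S) (at_right 0)"
    unfolding filterlim_at
  proof
    show "((\<lambda>t. Complex x t) \<longlongrightarrow> of_real x) (at_right 0)"
      by (auto simp: Complex_eq intro!: tendsto_eq_intros)
    show "\<forall>\<^sub>F t in at_right 0. Complex x t \<in> ?S \<and> Complex x t \<noteq> of_real x"
      unfolding eventually_at_right_field
      by (intro exI[of _ 1]) (auto simp: upper_half_plane_iff complex_eq_iff)
  qed
  ultimately show ?thesis by (rule filterlim_compose)
qed

lemma has_boundary_value_unique:
  assumes "has_boundary_value f x l" "has_boundary_value f x l'" shows "l = l'"
  using has_boundary_value_vertical[OF assms(1)] has_boundary_value_vertical[OF assms(2)]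
  by (intro tendsto_unique[of "at_right (0::real)"]) auto

text \<open>Makes a vertical side of a rectangle admissible down to the real line when its foot is a
  point with a boundary value.\<close>

lemma continuous_on_vertical_closed:
  assumes "has_boundary_value f x l" "f holomorphic_on upper_half_plane"
  shows "continuous_on {0..s} (\<lambda>t. if t = 0 then l else f (Complex x t))"
  unfolding continuous_on_def
proof
  fix t assume t: "t \<in> {0..s}"
  show "((\<lambda>t. if t = 0 then l else f (Complex x t)) \<longlongrightarrow> (if t = 0 then l else f (Complex x t))) (at t within {0..s})"
  proof (cases "t = 0")
    case True
    have "((\<lambda>t. if t = 0 then l else f (Complex x t)) \<longlongrightarrow> l) (at_right 0)"
      using has_boundary_value_vertical[OF assms(1)]
      by (rule Lim_transform_eventually) (auto simp: eventually_at_right_field intro!: exI[of _ 1])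
    then have "((\<lambda>t. if t = 0 then l else f (Complex x t)) \<longlongrightarrow> l) (at 0 within {0..})"
      by (simp add: at_within_Ici_at_right)
    then have "((\<lambda>t. if t = 0 then l else f (Complex x t)) \<longlongrightarrow> l) (at 0 within {0..s})"
      by (rule tendsto_within_subset) simp
    then show ?thesis using True by simp
  next
    case False
    then have "Complex x t \<in> upper_half_plane" using t by (simp add: upper_half_plane_iff)
    then have "isCont f (Complex x t)"
      using assms(2) open_upper_half_plane holomorphic_on_imp_continuous_on continuous_on_eq_continuous_at by blast
    then have "isCont (\<lambda>t. f (Complex x t)) t"
      by (intro isCont_o2[of t "\<lambda>t. Complex x t" f]) (simp_all add: Complex_eq)
    then have "((\<lambda>t. f (Complex x t)) \<longlongrightarrow> f (Complex x t)) (at t)" by (simp add: isCont_def)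
    moreover have "eventually (\<lambda>u. f (Complex x u) = (if u = 0 then l else f (Complex x u))) (at t)"
      by (rule eventually_mono[OF eventually_at_in_open'[of "-{0}" t]]) (use False in auto)
    ultimately have "((\<lambda>t. if t = 0 then l else f (Complex x t)) \<longlongrightarrow> f (Complex x t)) (at t)"
      by (rule Lim_transform_eventually)
    then have "((\<lambda>t. if t = 0 then l else f (Complex x t)) \<longlongrightarrow> f (Complex x t)) (at t within {0..s})"
      by (rule tendsto_within_subset) simp
    then show ?thesis using False by simp
  qed
qed

section \<open>Approximation of Smirnov functions in L1 on horizontal segments\<close>

lemma borel_measurable_cmod:
  "f \<in> borel_measurable M \<Longrightarrow> (\<lambda>x. cmod (f x)) \<in> borel_measurable M"
  by measurable

lemma integrable_lebesgue_on_iff: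
  fixes f :: "real \<Rightarrow> 'a::euclidean_space"
  shows "integrable (lebesgue_on {a..b}) f \<longleftrightarrow> f absolutely_integrable_on {a..b}"
  by (simp add: integrable_restrict_space set_integrable_def)

text \<open>Since \<open>\<bar>1 - q\<bar>\<^sup>2 \<le> 2 * Re (1 - q)\<close> for \<open>\<bar>q\<bar> \<le> 1\<close>, the integral is controlled by that of the holomorphic function
  \<open>1 - q\<close>, which Cauchy's theorem moves to the other three sides of a rectangle of height one. There
  dominated convergence applies, whatever the rate at which \<open>Y n\<close> tends to \<open>0\<close>.\<close>

lemma integral_norm_regularization_tendsto:
  fixes q :: "nat \<Rightarrow> complex \<Rightarrow> complex"
  assumes ab: "a < b"
    and q: "\<And>n. q n holomorphic_on upper_half_plane" "\<And>n z. z \<in> upper_half_plane \<Longrightarrow> norm (q n z) \<le> 1"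
      "\<And>z. z \<in> upper_half_plane \<Longrightarrow> (\<lambda>n. q n z) \<longlonglongrightarrow> 1"
    and Y: "\<And>n. 0 < Y n" "\<And>n. Y n < 1" "Y \<longlonglongrightarrow> 0"
  shows "(\<lambda>n. LINT x|lebesgue_on {a..b}. norm ((norm (1 - q n (Complex x (Y n))))\<^sup>2)) \<longlonglongrightarrow> 0"
proof -
  define K where "K = (\<lambda>n z. 1 - q n z)"
  have Kh: "K n holomorphic_on upper_half_plane" for n unfolding K_def by (intro holomorphic_intros q)
  note Kc = holomorphic_on_imp_continuous_on[OF Kh]
  have cv: "continuous_on {0<..1} (\<lambda>t. K n (Complex e t))" for n e
    by (auto intro!: continuous_on_compose2[OF Kc] continuous_intros simp: Complex_eq upper_half_plane_iff)
  have ch: "continuous_on {a..b} (\<lambda>x. K n (Complex x y))" if "y > 0" for n y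
    using that by (auto intro!: continuous_on_compose2[OF Kc] continuous_intros simp: Complex_eq upper_half_plane_iff)
  have K2: "norm (K n z) \<le> 2" if "z \<in> upper_half_plane" for n z
    using norm_triangle_ineq4[of 1 "q n z"] q(2)[OF that, of n] by (simp add: K_def)
  have K0: "(\<lambda>n. K n z) \<longlonglongrightarrow> 0" if "z \<in> upper_half_plane" for z
    using tendsto_diff[OF tendsto_const[of 1] q(3)[OF that]] by (simp add: K_def)
  have side: "(\<lambda>n. integral {Y n..1} (\<lambda>t. K n (Complex e t))) \<longlonglongrightarrow> integral {0..1::real} (\<lambda>_. 0)" for e
    by (rule integral_shrinking_tendsto[where b="\<lambda>_. 2", OF _ _ cv _ _ Y(1,3)])
      (auto intro!: K2 K0 simp: upper_half_plane_iff)
  have top: "(\<lambda>n. integral {a..b} (\<lambda>x. K n (Complex x 1))) \<longlonglongrightarrow> integral {a..b} (\<lambda>_. 0)"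
    by (rule dominated_convergence[where h="\<lambda>_. 2"])
      (auto intro!: K2 K0 integrable_continuous_real ch simp: upper_half_plane_iff)
  have eq: "integral {a..b} (\<lambda>x. K n (Complex x (Y n))) = integral {a..b} (\<lambda>x. K n (Complex x 1))
      + \<i> * integral {Y n..1} (\<lambda>t. K n (Complex a t)) - \<i> * integral {Y n..1} (\<lambda>t. K n (Complex b t))" for n
  proof -
    let ?R = "rectpath (Complex a (Y n)) (Complex b 1)"
    have im: "path_image ?R \<subseteq> upper_half_plane"
      using ab Y(1,2)[of n] by (auto simp: path_image_rectpath upper_half_plane_iff)
    have "(K n has_contour_integral 0) ?R"
      using im by (intro Cauchy_theorem_convex_simple[OF Kh convex_upper_half_plane]) auto
    from has_contour_integral_rectpath_iff[OF ab Y(2) continuous_on_subset[OF Kc im] this]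
    show ?thesis by (simp add: algebra_simps)
  qed
  have "(\<lambda>n. integral {a..b} (\<lambda>x. K n (Complex x (Y n)))) \<longlonglongrightarrow> integral {a..b} (\<lambda>_. 0)
     + \<i> * integral {0..1::real} (\<lambda>_. 0) - \<i> * integral {0..1::real} (\<lambda>_. 0)"
    unfolding eq by (intro tendsto_intros side top)
  from tendsto_mult_right[OF tendsto_Re[OF this], of 2]
  have lim: "(\<lambda>n. 2 * Re (integral {a..b} (\<lambda>x. K n (Complex x (Y n))))) \<longlonglongrightarrow> 0" by simp
  show ?thesis
  proof (rule tendsto_sandwich[OF _ _ tendsto_const lim])
    show "\<forall>\<^sub>F n in sequentially. 0 \<le> (LINT x|lebesgue_on {a..b}. norm ((norm (1 - q n (Complex x (Y n))))\<^sup>2))"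
      by (intro always_eventually allI integral_nonneg_AE) simp
    show "\<forall>\<^sub>F n in sequentially. (LINT x|lebesgue_on {a..b}. norm ((norm (1 - q n (Complex x (Y n))))\<^sup>2))
       \<le> 2 * Re (integral {a..b} (\<lambda>x. K n (Complex x (Y n))))"
    proof (intro always_eventually allI)
      fix n
      note c = ch[OF Y(1), of n n]
      have iK: "integrable (lebesgue_on {a..b}) (\<lambda>x. K n (Complex x (Y n)))"
        unfolding integrable_lebesgue_on_iff by (rule absolutely_integrable_continuous_real[OF c])
      have i2: "integrable (lebesgue_on {a..b}) (\<lambda>x. (norm (K n (Complex x (Y n))))\<^sup>2)"
        unfolding integrable_lebesgue_on_iff by (intro absolutely_integrable_continuous_real continuous_intros c)
      have "(LINT x|lebesgue_on {a..b}. (norm (K n (Complex x (Y n))))\<^sup>2)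
         \<le> (LINT x|lebesgue_on {a..b}. 2 * Re (K n (Complex x (Y n))))"
      proof (rule integral_mono[OF i2])
        show "integrable (lebesgue_on {a..b}) (\<lambda>x. 2 * Re (K n (Complex x (Y n))))"
          using iK by (intro integrable_mult_right integrable_Re)
        fix x
        have "Complex x (Y n) \<in> upper_half_plane" using Y(1) by (simp add: upper_half_plane_iff)
        then have "(norm (q n (Complex x (Y n))))\<^sup>2 \<le> 1" using q(2) by (simp add: power_le_one)
        then show "(norm (K n (Complex x (Y n))))\<^sup>2 \<le> 2 * Re (K n (Complex x (Y n)))"
          unfolding K_def cmod_power2 by (simp add: power2_eq_square algebra_simps)
      qed
      also have "\<dots> = 2 * Re (LINT x|lebesgue_on {a..b}. K n (Complex x (Y n)))"
        using integral_Re[OF iK] by simp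
      also have "(LINT x|lebesgue_on {a..b}. K n (Complex x (Y n))) = integral {a..b} (\<lambda>x. K n (Complex x (Y n)))"
        using iK by (simp add: lebesgue_integral_eq_integral)
      finally show "(LINT x|lebesgue_on {a..b}. norm ((norm (1 - q n (Complex x (Y n))))\<^sup>2))
         \<le> 2 * Re (integral {a..b} (\<lambda>x. K n (Complex x (Y n))))" by (simp add: K_def)
    qed
  qed
qed

text \<open>The error f q - F splits into (f - F) q - F (1 - q). For fixed n the function f (q n) is
  bounded, so dominated convergence yields a height at which the first part is small. At these
  heights q n tends to 1 in mean square, hence almost everywhere along a subsequence, and then 2 |F|
  dominates the second part.\<close>

lemma smirnov_L1_approximation:
  assumes f: "f \<in> smirnov" and ab: "a < b" and F: "F absolutely_integrable_on {a..b}"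
    and bv: "AE x in lebesgue. has_boundary_value f x (F x)"
  obtains G :: "nat \<Rightarrow> complex \<Rightarrow> complex" and Y :: "nat \<Rightarrow> real" where
    "\<And>n. G n holomorphic_on upper_half_plane" "\<And>n z. z \<in> upper_half_plane \<Longrightarrow> norm (G n z) \<le> norm (f z)"
    "\<And>z. z \<in> upper_half_plane \<Longrightarrow> (\<lambda>n. G n z) \<longlonglongrightarrow> f z" "\<And>n. Y n > 0" "Y \<longlonglongrightarrow> 0"
    "(\<lambda>n. LINT x|lebesgue_on {a..b}. norm (G n (Complex x (Y n)) - F x)) \<longlonglongrightarrow> 0"
proof -
  let ?M = "lebesgue_on {a..b}"
  obtain q :: "nat \<Rightarrow> complex \<Rightarrow> complex" where q: "\<And>n. q n holomorphic_on upper_half_plane"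
    "\<And>n z. z \<in> upper_half_plane \<Longrightarrow> norm (q n z) \<le> 1"
    and qb: "\<And>n. \<exists>C. \<forall>z\<in>upper_half_plane. norm (f z * q n z) \<le> C"
    and ql: "\<And>z. z \<in> upper_half_plane \<Longrightarrow> (\<lambda>n. q n z) \<longlonglongrightarrow> 1"
    using smirnov_regularization[OF f] by metis
  note fh = smirnov_holomorphic[OF f]
  have Fi: "integrable ?M F" using F by (simp add: integrable_lebesgue_on_iff)
  have ch: "continuous_on {a..b} (\<lambda>x. g (Complex x y))" if "g holomorphic_on upper_half_plane" "y > 0" for g y
    using that(2) by (auto intro!: continuous_on_compose2[OF holomorphic_on_imp_continuous_on[OF that(1)]]
        continuous_intros simp: Complex_eq upper_half_plane_iff)
  have gi: "integrable ?M (\<lambda>x. g (Complex x y))" if "g holomorphic_on upper_half_plane" "y > 0" for g :: "complex \<Rightarrow> complex" and y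
    unfolding integrable_lebesgue_on_iff by (intro absolutely_integrable_continuous_real ch that)
  have bvM: "AE x in ?M. has_boundary_value f x (F x)"
    by (subst AE_restrict_space_iff) (use bv in \<open>auto elim: eventually_mono\<close>)
  have uh: "Complex x y \<in> upper_half_plane" if "y > 0" for x y using that by (simp add: upper_half_plane_iff)
  have mF: "F \<in> borel_measurable ?M" using Fi by (rule borel_measurable_integrable)
  have mg: "(\<lambda>x. g (Complex x y)) \<in> borel_measurable ?M" if "g holomorphic_on upper_half_plane" "y > 0" for g :: "complex \<Rightarrow> complex" and y
    using gi[OF that] by (rule borel_measurable_integrable)
  \<comment> \<open>The bound C for f (q n) depends on n without any control, so the height is
    chosen after n.\<close>
  have first: "\<exists>y. 0 < y \<and> y < 1 / (real n + 1) \<and>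
     (LINT x|?M. norm ((f (Complex x y) - F x) * q n (Complex x y))) \<le> 1 / (real n + 1)" for n
  proof -
    obtain C where C: "\<And>z. z \<in> upper_half_plane \<Longrightarrow> norm (f z * q n z) \<le> C" using qb by blast
    define e where "e = (\<lambda>k::nat. 1 / (real k + 1))"
    have e: "e k > 0" for k by (simp add: e_def)
    have e0: "e \<longlonglongrightarrow> 0" unfolding e_def by real_asymp
    have er: "filterlim e (at_right 0) sequentially"
    proof -
      have "\<forall>\<^sub>F k in sequentially. e k \<in> {0<..} \<and> e k \<noteq> 0"
        by (intro always_eventually allI) (simp add: e_def)
      then show ?thesis unfolding filterlim_at using e0 by blast
    qed
    have "(\<lambda>k. LINT x|?M. norm ((f (Complex x (e k)) - F x) * q n (Complex x (e k)))) \<longlonglongrightarrow> (LINT x|?M. 0)"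
    proof (rule integral_dominated_convergence[where w="\<lambda>x. C + norm (F x)"])
      show "integrable ?M (\<lambda>x. C + norm (F x))"
      proof (rule Bochner_Integration.integrable_add)
        show "integrable ?M (\<lambda>x. C)"
          unfolding integrable_lebesgue_on_iff by (intro absolutely_integrable_continuous_real continuous_intros)
        show "integrable ?M (\<lambda>x. norm (F x))" using Fi by simp
      qed
      show "(\<lambda>x. norm ((f (Complex x (e k)) - F x) * q n (Complex x (e k)))) \<in> borel_measurable ?M" for k
        by (intro borel_measurable_cmod borel_measurable_times borel_measurable_diff mF mg[OF q(1) e] mg[OF fh e])
      show "AE x in ?M. (\<lambda>k. norm ((f (Complex x (e k)) - F x) * q n (Complex x (e k)))) \<longlonglongrightarrow> 0"
        using bvM
      proof eventually_elim
        case (elim x)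
        have "(\<lambda>k. f (Complex x (e k)) - F x) \<longlonglongrightarrow> F x - F x"
          by (intro tendsto_intros filterlim_compose[OF has_boundary_value_vertical[OF elim] er])
        from tendsto_norm[OF this]
        have l: "(\<lambda>k. norm (f (Complex x (e k)) - F x)) \<longlonglongrightarrow> 0" by simp
        show ?case
        proof (rule tendsto_sandwich[OF _ _ tendsto_const l])
          show "\<forall>\<^sub>F k in sequentially. norm ((f (Complex x (e k)) - F x) * q n (Complex x (e k))) \<le> norm (f (Complex x (e k)) - F x)"
            using q(2)[OF uh[OF e]] by (intro always_eventually allI) (simp add: norm_mult mult_left_le)
        qed simp
      qed
      show "AE x in ?M. norm (norm ((f (Complex x (e k)) - F x) * q n (Complex x (e k)))) \<le> C + norm (F x)" for k
      proof (rule AE_I2)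
        fix x
        have "norm ((f (Complex x (e k)) - F x) * q n (Complex x (e k)))
           \<le> norm (f (Complex x (e k)) * q n (Complex x (e k))) + norm (F x) * norm (q n (Complex x (e k)))"
          unfolding left_diff_distrib norm_mult[of "F x", symmetric] by (rule norm_triangle_ineq4)
        also have "\<dots> \<le> C + norm (F x) * 1"
          by (intro add_mono C mult_left_mono q uh e) simp
        finally show "norm (norm ((f (Complex x (e k)) - F x) * q n (Complex x (e k)))) \<le> C + norm (F x)" by simp
      qed
    qed simp
    then have "eventually (\<lambda>k. (LINT x|?M. norm ((f (Complex x (e k)) - F x) * q n (Complex x (e k)))) < 1 / (real n + 1)) sequentially"
      by (rule order_tendstoD(2)) simp
    moreover have "eventually (\<lambda>k. e k < 1 / (real n + 1)) sequentially"
      using e0 by (rule order_tendstoD(2)) simp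
    ultimately have "eventually (\<lambda>k. e k < 1 / (real n + 1) \<and> (LINT x|?M. norm ((f (Complex x (e k)) - F x) * q n (Complex x (e k)))) \<le> 1 / (real n + 1)) sequentially"
      by eventually_elim simp
    then obtain k where "e k < 1 / (real n + 1) \<and> (LINT x|?M. norm ((f (Complex x (e k)) - F x) * q n (Complex x (e k)))) \<le> 1 / (real n + 1)"
      using eventually_happens'[OF sequentially_bot] by blast
    then show ?thesis using e by blast
  qed
  have "\<exists>Y0. \<forall>n. 0 < Y0 n \<and> Y0 n < 1 / (real n + 1) \<and>
     (LINT x|?M. norm ((f (Complex x (Y0 n)) - F x) * q n (Complex x (Y0 n)))) \<le> 1 / (real n + 1)"
    by (intro choice allI first)
  then obtain Y0 where Y0: "\<And>n. 0 < Y0 n" "\<And>n. Y0 n < 1 / (real n + 1)"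
    and Y0l: "\<And>n. (LINT x|?M. norm ((f (Complex x (Y0 n)) - F x) * q n (Complex x (Y0 n)))) \<le> 1 / (real n + 1)"
    by blast
  have inv0: "(\<lambda>n. 1 / (real n + 1)) \<longlonglongrightarrow> 0" by real_asymp
  have Y00: "Y0 \<longlonglongrightarrow> 0"
    by (rule tendsto_sandwich[OF _ _ tendsto_const inv0]) (use Y0 in \<open>auto intro!: always_eventually less_imp_le\<close>)
  have Y01: "Y0 n < 1" for n using Y0(2)[of n] by (rule less_le_trans) simp
  \<comment> \<open>The heights are already fixed here and may tend to 0 at any speed; mean square
    convergence of 1 - q n is available regardless.\<close>
  have "\<exists>r::nat\<Rightarrow>nat. strict_mono r \<and> (AE x in ?M. (\<lambda>n. (norm (1 - q (r n) (Complex x (Y0 (r n)))))\<^sup>2) \<longlonglongrightarrow> 0)"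
  proof (rule tendsto_L1_AE_subseq)
    show "integrable ?M (\<lambda>x. (norm (1 - q n (Complex x (Y0 n))))\<^sup>2)" for n
      unfolding integrable_lebesgue_on_iff using Y0 q by (intro absolutely_integrable_continuous_real continuous_intros ch) auto
  qed (rule integral_norm_regularization_tendsto[OF ab q ql Y0(1) Y01 Y00])
  then obtain r :: "nat \<Rightarrow> nat" where r: "strict_mono r"
    and rl: "AE x in ?M. (\<lambda>n. (norm (1 - q (r n) (Complex x (Y0 (r n)))))\<^sup>2) \<longlonglongrightarrow> 0" by blast
  have rinf: "filterlim r at_top sequentially" using r by (rule filterlim_subseq)
  show ?thesis
  proof (rule that[of "\<lambda>n z. f z * q (r n) z" "\<lambda>n. Y0 (r n)"])
    show "(\<lambda>z. f z * q (r n) z) holomorphic_on upper_half_plane" for n by (intro holomorphic_intros fh q)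
    show "norm (f z * q (r n) z) \<le> norm (f z)" if "z \<in> upper_half_plane" for n z
      using q(2)[OF that] by (simp add: norm_mult mult_left_le)
    show "(\<lambda>n. f z * q (r n) z) \<longlonglongrightarrow> f z" if "z \<in> upper_half_plane" for z
      using tendsto_mult[OF tendsto_const filterlim_compose[OF ql[OF that] rinf], of "f z"] by simp
    show "Y0 (r n) > 0" for n by (rule Y0)
    show "(\<lambda>n. Y0 (r n)) \<longlonglongrightarrow> 0" using filterlim_compose[OF Y00 rinf] .
    define w where "w = (\<lambda>n x. q (r n) (Complex x (Y0 (r n))))"
    have mw: "w n \<in> borel_measurable ?M" for n unfolding w_def by (rule mg[OF q(1) Y0(1)])
    have w1: "norm (w n x) \<le> 1" for n x unfolding w_def by (rule q(2)[OF uh[OF Y0(1)]])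
    have w2: "norm (1 - w n x) \<le> 2" for n x using norm_triangle_ineq4[of 1 "w n x"] w1[of n x] by simp
    have sec: "(\<lambda>n. LINT x|?M. norm (F x * (1 - w n x))) \<longlonglongrightarrow> (LINT x|?M. 0)"
    proof (rule integral_dominated_convergence[where w="\<lambda>x. 2 * norm (F x)"])
      show "integrable ?M (\<lambda>x. 2 * norm (F x))" using Fi by simp
      show "(\<lambda>x. norm (F x * (1 - w n x))) \<in> borel_measurable ?M" for n
        by (intro borel_measurable_cmod borel_measurable_times borel_measurable_diff mF mw borel_measurable_const)
      show "AE x in ?M. norm (norm (F x * (1 - w n x))) \<le> 2 * norm (F x)" for n
      proof (rule AE_I2)
        fix x
        show "norm (norm (F x * (1 - w n x))) \<le> 2 * norm (F x)"
          using mult_left_mono[OF w2[of n x], of "norm (F x)"] by (simp add: norm_mult mult.commute)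
      qed
      show "AE x in ?M. (\<lambda>n. norm (F x * (1 - w n x))) \<longlonglongrightarrow> 0"
        using rl
      proof eventually_elim
        case (elim x)
        then have "(\<lambda>n. sqrt ((norm (1 - w n x))\<^sup>2)) \<longlonglongrightarrow> sqrt 0" unfolding w_def by (rule tendsto_real_sqrt)
        then have "(\<lambda>n. norm (F x) * norm (1 - w n x)) \<longlonglongrightarrow> norm (F x) * 0" by (intro tendsto_intros) simp
        then show ?case by (simp add: norm_mult)
      qed
    qed simp
    have bound: "(LINT x|?M. norm (f (Complex x (Y0 (r n))) * w n x - F x))
       \<le> 1 / (real (r n) + 1) + (LINT x|?M. norm (F x * (1 - w n x)))" for n
    proof -
      have i1: "integrable ?M (\<lambda>x. f (Complex x (Y0 (r n))) * w n x)"
        unfolding w_def using gi[OF holomorphic_on_mult[OF fh q(1)] Y0(1)] by simp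
      have i2: "integrable ?M (\<lambda>x. F x * w n x)"
        by (rule Bochner_Integration.integrable_bound[OF Fi])
          (use w1 in \<open>auto simp: norm_mult mult_left_le intro!: borel_measurable_times mF mw\<close>)
      have i3: "integrable ?M (\<lambda>x. norm ((f (Complex x (Y0 (r n))) - F x) * w n x))"
        using Bochner_Integration.integrable_diff[OF i1 i2] by (simp add: left_diff_distrib)
      have i4: "integrable ?M (\<lambda>x. norm (F x * (1 - w n x)))"
        using Bochner_Integration.integrable_diff[OF Fi i2] by (simp add: right_diff_distrib)
      have "(LINT x|?M. norm (f (Complex x (Y0 (r n))) * w n x - F x))
         \<le> (LINT x|?M. norm ((f (Complex x (Y0 (r n))) - F x) * w n x) + norm (F x * (1 - w n x)))"
      proof (rule integral_mono)
        show "integrable ?M (\<lambda>x. norm (f (Complex x (Y0 (r n))) * w n x - F x))"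
          using Bochner_Integration.integrable_diff[OF i1 Fi] by simp
        show "norm (f (Complex x (Y0 (r n))) * w n x - F x)
          \<le> norm ((f (Complex x (Y0 (r n))) - F x) * w n x) + norm (F x * (1 - w n x))" for x
        proof -
          have "f (Complex x (Y0 (r n))) * w n x - F x = (f (Complex x (Y0 (r n))) - F x) * w n x - F x * (1 - w n x)"
            by (simp add: algebra_simps)
          then show ?thesis by (metis norm_triangle_ineq4)
        qed
      qed (use i3 i4 in simp)
      also have "\<dots> = (LINT x|?M. norm ((f (Complex x (Y0 (r n))) - F x) * w n x)) + (LINT x|?M. norm (F x * (1 - w n x)))"
        using i3 i4 by simp
      finally show ?thesis using Y0l[of "r n"] by (simp add: w_def)
    qed
    have lim: "(\<lambda>n. 1 / (real (r n) + 1) + (LINT x|?M. norm (F x * (1 - w n x)))) \<longlonglongrightarrow> 0"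
      using tendsto_add[OF filterlim_compose[OF inv0 rinf] sec] by simp
    show "(\<lambda>n. LINT x|?M. norm (f (Complex x (Y0 (r n))) * q (r n) (Complex x (Y0 (r n))) - F x)) \<longlonglongrightarrow> 0"
      by (rule tendsto_sandwich[OF _ _ tendsto_const lim])
        (use bound in \<open>auto simp: w_def intro!: always_eventually integral_nonneg_AE\<close>)
  qed
qed

section \<open>Real-analytic functions and their local holomorphic extensions\<close>

lemma real_analytic_local_extension:
  assumes "real_analytic \<beta>"
  obtains r B where "r > 0" "B holomorphic_on ball (of_real x) r"
    "\<And>y. \<bar>y - x\<bar> < r \<Longrightarrow> B (of_real y) = of_real (\<beta> y)"
proof -
  obtain r a where r: "r > 0" and s: "\<And>y. \<bar>y - x\<bar> < r \<Longrightarrow> (\<lambda>n. a n * (y - x) ^ n) sums \<beta> y"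
    using assms unfolding real_analytic_def by metis
  define B where "B = (\<lambda>z. \<Sum>n. complex_of_real (a n) * (z - of_real x) ^ n)"
  have "B holomorphic_on ball (of_real x) r"
  proof (rule power_series_holomorphic)
    fix w assume w: "w \<in> ball (complex_of_real x) r"
    \<comment> \<open>Halfway between |w - x| and r: the real series converges at the point x +
      \<rho>, hence the complex one converges inside radius \<rho>, in particular at w.\<close>
    define \<rho> where "\<rho> = (norm (w - of_real x) + r) / 2"
    have rho: "norm (w - of_real x) < \<rho>" "0 < \<rho>" "\<rho> < r"
      using w r unfolding \<rho>_def mem_ball dist_norm by (auto simp: norm_minus_commute add_nonneg_pos)
    have "summable (\<lambda>n. complex_of_real (a n * ((x + \<rho>) - x) ^ n))"
      using s[of "x + \<rho>"] rho by (intro summable_of_real) (auto simp: sums_iff)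
    then have "summable (\<lambda>n. complex_of_real (a n) * (of_real \<rho>) ^ n)" by simp
    then have "summable (\<lambda>n. complex_of_real (a n) * (w - of_real x) ^ n)"
      by (rule powser_inside) (use rho in auto)
    then show "(\<lambda>n. complex_of_real (a n) * (w - of_real x) ^ n) sums B w"
      unfolding B_def by (rule summable_sums)
  qed
  moreover have "B (of_real y) = of_real (\<beta> y)" if "\<bar>y - x\<bar> < r" for y
    unfolding B_def using sums_of_real[OF s[OF that], where 'a=complex] by (simp add: sums_iff)
  ultimately show ?thesis using r that by blast
qed

lemma AE_lebesgue_obtain:
  assumes "AE x in lebesgue. P x" "l < u"
  obtains x :: real where "l < x" "x < u" "P x"
proof -
  have "\<exists>x. l < x \<and> x < u \<and> P x"
  proof (rule ccontr)
    assume "\<nexists>x. l < x \<and> x < u \<and> P x"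
    then have "{l<..<u} \<subseteq> {x. \<not> P x}" by auto
    moreover obtain N where "{x. \<not> P x} \<subseteq> N" "N \<in> null_sets lebesgue"
      using assms(1) by (auto elim!: AE_E simp: null_sets_def)
    ultimately have "negligible (box l u)"
      by (metis box_real(1) negligible_iff_null_sets negligible_subset subset_trans)
    then have "box l u = {}" by (simp only: negligible_interval)
    then show False using assms(2) by simp
  qed
  then show ?thesis using that by blast
qed

lemma real_analytic_has_derivative:
  assumes "real_analytic \<beta>"
  shows "(\<beta> has_real_derivative deriv \<beta> x) (at x)" and "continuous_on UNIV (deriv \<beta>)"
proof -
  have loc: "\<exists>r>0. \<exists>B'. continuous_on (ball x r) B' \<and> (\<forall>y\<in>ball x r. (\<beta> has_real_derivative B' y) (at y))" for x
  proof -
    obtain r B where r: "r > 0" and B: "B holomorphic_on ball (of_real x) r"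
      and Bb: "\<And>y. \<bar>y - x\<bar> < r \<Longrightarrow> B (of_real y) = of_real (\<beta> y)"
      using real_analytic_local_extension[OF assms] by metis
    have sub: "complex_of_real y \<in> ball (of_real x) r" if "y \<in> ball x r" for y
      using that by (simp add: dist_of_real)
    have "(\<beta> has_real_derivative Re (deriv B (of_real y))) (at y)" if y: "y \<in> ball x r" for y
    proof -
      have "(B has_field_derivative deriv B (of_real y)) (at (of_real y))"
        using holomorphic_derivI[OF B open_ball sub[OF y]] .
      from has_vector_derivative_real_field[OF this]
      have "((\<lambda>y. Re (B (of_real y))) has_vector_derivative Re (deriv B (of_real y))) (at y)"
        by (rule bounded_linear.has_vector_derivative[OF bounded_linear_Re])
      then have "((\<lambda>y. Re (B (of_real y))) has_real_derivative Re (deriv B (of_real y))) (at y)"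
        by (simp add: has_real_derivative_iff_has_vector_derivative)
      then show ?thesis
        by (rule has_field_derivative_transform_within_open[OF _ open_ball y])
          (simp add: Bb dist_real_def abs_minus_commute)
    qed
    moreover have "continuous_on (ball x r) (\<lambda>y. Re (deriv B (of_real y)))"
    proof (rule continuous_on_Re, rule continuous_on_compose2[of "ball (complex_of_real x) r" "deriv B"])
      show "continuous_on (ball (complex_of_real x) r) (deriv B)"
        by (rule holomorphic_on_imp_continuous_on[OF holomorphic_deriv[OF B open_ball]])
      show "continuous_on (ball x r) complex_of_real" by (rule continuous_on_of_real_id)
      show "complex_of_real ` ball x r \<subseteq> ball (of_real x) r" using sub by blast
    qed
    ultimately show ?thesis using r by blast
  qed
  obtain r B' where "r > 0" "\<forall>y\<in>ball x r. (\<beta> has_real_derivative B' y) (at y)"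
    using loc[of x] by blast
  then have "(\<beta> has_real_derivative B' x) (at x)" by simp
  then show "(\<beta> has_real_derivative deriv \<beta> x) (at x)" by (simp add: DERIV_imp_deriv)
  have "isCont (deriv \<beta>) x" for x
  proof -
    obtain r B' where r: "r > 0" and c: "continuous_on (ball x r) B'"
      and B': "\<forall>y\<in>ball x r. (\<beta> has_real_derivative B' y) (at y)"
      using loc[of x] by blast
    have "continuous_on (ball x r) (deriv \<beta>)"
      by (rule continuous_on_eq[OF c]) (simp add: B' DERIV_imp_deriv[symmetric])
    then show ?thesis using r by (simp add: continuous_on_eq_continuous_at)
  qed
  then show "continuous_on UNIV (deriv \<beta>)" by (simp add: continuous_at_imp_continuous_on)
qed

lemma real_analytic_continuous: "real_analytic \<beta> \<Longrightarrow> continuous_on S \<beta>"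
  by (rule DERIV_continuous_on[OF has_field_derivative_at_within[OF real_analytic_has_derivative(1)]])

section \<open>Continuation near a real point and gluing of the local continuations\<close>

lemma locally_integrable_cnj_times:
  assumes F: "locally_integrable F" and U: "continuous_on UNIV U" "\<And>x. norm (U x) = 1"
  shows "locally_integrable (\<lambda>x. cnj (U x * F x))"
  unfolding locally_integrable_def
proof (intro allI)
  fix a b
  have Fi: "integrable (lebesgue_on {a..b}) F"
    using F by (simp add: integrable_lebesgue_on_iff locally_integrable_def)
  have "integrable (lebesgue_on {a..b}) (\<lambda>x. cnj (U x * F x))"
  proof (rule Bochner_Integration.integrable_bound[OF Fi])
    have "(\<lambda>x. U x * F x) \<in> borel_measurable (lebesgue_on {a..b})"
      by (rule borel_measurable_times[OF continuous_imp_measurable_on_sets_lebesgue[OF continuous_on_subset[OF U(1)]]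
            borel_measurable_integrable[OF Fi]]) auto
    then show "(\<lambda>x. cnj (U x * F x)) \<in> borel_measurable (lebesgue_on {a..b})"
      by (rule borel_measurable_continuous_on[rotated]) (intro continuous_intros)
    show "AE x in lebesgue_on {a..b}. norm (cnj (U x * F x)) \<le> norm (F x)"
      by (simp add: norm_mult U)
  qed
  then show "(\<lambda>x. cnj (U x * F x)) absolutely_integrable_on {a..b}"
    by (simp add: integrable_lebesgue_on_iff)
qed

text \<open>Writing the difference as E (G - F) at the moving height plus (E at that height - E on
  the line) F, the first term is controlled by the bound of E on the compact rectangle, the second
  by dominated convergence. E will be the local extension of \<open>U\<close>.\<close>

lemma L1_convergence_times_continuous:
  fixes E :: "complex \<Rightarrow> complex"
  assumes E: "continuous_on {w. Re w \<in> {a..b} \<and> Im w \<in> {0..s}} E" and s: "s > 0"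
    and F: "F absolutely_integrable_on {a..b}"
    and G: "\<And>n. continuous_on {a..b} (\<lambda>x. G n (Complex x (Y n)))"
    and Y: "\<And>n. 0 < Y n" "\<And>n. Y n < s" "Y \<longlonglongrightarrow> 0"
    and conv: "(\<lambda>n. LINT x|lebesgue_on {a..b}. norm (G n (Complex x (Y n)) - F x)) \<longlonglongrightarrow> 0"
  shows "(\<lambda>n. LINT x|lebesgue_on {a..b}. norm (E (Complex x (Y n)) * G n (Complex x (Y n)) - E (of_real x) * F x)) \<longlonglongrightarrow> 0"
    and "(\<lambda>x. E (of_real x) * F x) absolutely_integrable_on {a..b}"
proof -
  let ?M = "lebesgue_on {a..b}" and ?Q = "{w. Re w \<in> {a..b} \<and> Im w \<in> {0..s}}"
  have "?Q = cbox (Complex a 0) (Complex b s)" by (auto simp: in_cbox_complex_iff)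
  then have "compact ?Q" by simp
  then obtain C where C: "\<And>w. w \<in> ?Q \<Longrightarrow> norm (E w) \<le> C"
    using compact_continuous_image[OF E] by (auto simp: compact_eq_bounded_closed bounded_iff)
  have inQ: "Complex x (Y n) \<in> ?Q" "of_real x \<in> ?Q" if "x \<in> {a..b}" for x n
    using that Y(1,2)[of n] s by auto
  have Fi: "integrable ?M F" using F by (simp add: integrable_lebesgue_on_iff)
  have Gi: "integrable ?M (\<lambda>x. G n (Complex x (Y n)))" for n
    unfolding integrable_lebesgue_on_iff by (rule absolutely_integrable_continuous_real[OF G])
  have cE: "continuous_on {a..b} (\<lambda>x. E (Complex x (Y n)))" "continuous_on {a..b} (\<lambda>x. E (of_real x))" for n
    using inQ Y(1,2)[of n] s by (auto intro!: continuous_on_compose2[OF E] continuous_intros simp: Complex_eq)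
  then have mE: "(\<lambda>x. E (Complex x (Y n))) \<in> borel_measurable ?M" "(\<lambda>x. E (of_real x)) \<in> borel_measurable ?M" for n
    by (auto intro!: continuous_imp_measurable_on_sets_lebesgue)
  have mF: "F \<in> borel_measurable ?M" using Fi by (rule borel_measurable_integrable)
  have mG: "(\<lambda>x. G n (Complex x (Y n))) \<in> borel_measurable ?M" for n using Gi by (rule borel_measurable_integrable)
  have mult_i: "integrable ?M (\<lambda>x. c x * H x)"
    if "integrable ?M H" "c \<in> borel_measurable ?M" "\<And>x. x \<in> {a..b} \<Longrightarrow> norm (c x) \<le> K" for c H :: "real \<Rightarrow> complex" and K
  proof (rule Bochner_Integration.integrable_bound)
    show "integrable ?M (\<lambda>x. K * norm (H x))" using that(1) by simp
    show "(\<lambda>x. c x * H x) \<in> borel_measurable ?M"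
      using that(2) borel_measurable_integrable[OF that(1)] by (rule borel_measurable_times)
    show "AE x in ?M. norm (c x * H x) \<le> norm (K * norm (H x))"
    proof (rule AE_I2)
      fix x assume "x \<in> space ?M"
      then have "norm (c x) \<le> K" using that(3) by (simp add: space_restrict_space)
      then have "norm (c x) * norm (H x) \<le> \<bar>K\<bar> * norm (H x)" by (intro mult_right_mono) auto
      then show "norm (c x * H x) \<le> norm (K * norm (H x))" by (simp add: norm_mult abs_mult)
    qed
  qed
  have EF: "integrable ?M (\<lambda>x. E (of_real x) * F x)" by (rule mult_i[OF Fi mE(2) C[OF inQ(2)]])
  then show "(\<lambda>x. E (of_real x) * F x) absolutely_integrable_on {a..b}"
    by (simp add: integrable_lebesgue_on_iff)
  have EnG: "integrable ?M (\<lambda>x. E (Complex x (Y n)) * G n (Complex x (Y n)))" for n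
    by (rule mult_i[OF Gi mE(1) C[OF inQ(1)]])
  have EnF: "integrable ?M (\<lambda>x. E (Complex x (Y n)) * F x)" for n
    by (rule mult_i[OF Fi mE(1) C[OF inQ(1)]])
  have sec: "(\<lambda>n. LINT x|?M. norm ((E (Complex x (Y n)) - E (of_real x)) * F x)) \<longlonglongrightarrow> (LINT x|?M. 0)"
  proof (rule integral_dominated_convergence[where w="\<lambda>x. (C + C) * norm (F x)"])
    show "integrable ?M (\<lambda>x. (C + C) * norm (F x))" using Fi by simp
    show "(\<lambda>x. norm ((E (Complex x (Y n)) - E (of_real x)) * F x)) \<in> borel_measurable ?M" for n
      by (intro borel_measurable_cmod borel_measurable_times borel_measurable_diff mF mE)
    show "AE x in ?M. norm (norm ((E (Complex x (Y n)) - E (of_real x)) * F x)) \<le> (C + C) * norm (F x)" for n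
    proof (rule AE_I2)
      fix x assume "x \<in> space ?M"
      then have "x \<in> {a..b}" by (simp add: space_restrict_space)
      then have "norm (E (Complex x (Y n)) - E (of_real x)) \<le> C + C"
        by (intro norm_triangle_le_diff add_mono C inQ)
      then show "norm (norm ((E (Complex x (Y n)) - E (of_real x)) * F x)) \<le> (C + C) * norm (F x)"
        unfolding norm_mult by (simp add: mult_right_mono)
    qed
    show "AE x in ?M. (\<lambda>n. norm ((E (Complex x (Y n)) - E (of_real x)) * F x)) \<longlonglongrightarrow> 0"
    proof (rule AE_I2)
      fix x assume "x \<in> space ?M"
      then have x: "x \<in> {a..b}" by (simp add: space_restrict_space)
      have "(\<lambda>n. Complex x (Y n)) \<longlonglongrightarrow> of_real x"
        using tendsto_add[OF tendsto_const tendsto_mult[OF tendsto_const tendsto_of_real[OF Y(3)]], of "of_real x" \<i>]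
        by (simp add: Complex_eq)
      then have "(\<lambda>n. E (Complex x (Y n))) \<longlonglongrightarrow> E (of_real x)"
        by (rule continuous_on_tendsto_compose[OF E]) (use inQ x in auto)
      then have "(\<lambda>n. norm ((E (Complex x (Y n)) - E (of_real x)) * F x)) \<longlonglongrightarrow> norm ((E (of_real x) - E (of_real x)) * F x)"
        by (intro tendsto_intros)
      then show "(\<lambda>n. norm ((E (Complex x (Y n)) - E (of_real x)) * F x)) \<longlonglongrightarrow> 0" by simp
    qed
  qed simp
  have le: "(LINT x|?M. norm (E (Complex x (Y n)) * G n (Complex x (Y n)) - E (of_real x) * F x))
     \<le> \<bar>C\<bar> * (LINT x|?M. norm (G n (Complex x (Y n)) - F x)) + (LINT x|?M. norm ((E (Complex x (Y n)) - E (of_real x)) * F x))" for n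
  proof -
    have i3: "integrable ?M (\<lambda>x. norm ((E (Complex x (Y n)) - E (of_real x)) * F x))"
      using Bochner_Integration.integrable_diff[OF EnF EF] by (simp add: left_diff_distrib)
    have "(LINT x|?M. norm (E (Complex x (Y n)) * G n (Complex x (Y n)) - E (of_real x) * F x))
       \<le> (LINT x|?M. \<bar>C\<bar> * norm (G n (Complex x (Y n)) - F x) + norm ((E (Complex x (Y n)) - E (of_real x)) * F x))"
    proof (rule integral_mono)
      show "integrable ?M (\<lambda>x. norm (E (Complex x (Y n)) * G n (Complex x (Y n)) - E (of_real x) * F x))"
        using Bochner_Integration.integrable_diff[OF EnG EF] by simp
      show "integrable ?M (\<lambda>x. \<bar>C\<bar> * norm (G n (Complex x (Y n)) - F x) + norm ((E (Complex x (Y n)) - E (of_real x)) * F x))"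
        using Gi Fi i3 by auto
      fix x assume "x \<in> space ?M"
      then have x: "x \<in> {a..b}" by (simp add: space_restrict_space)
      have "E (Complex x (Y n)) * G n (Complex x (Y n)) - E (of_real x) * F x
        = E (Complex x (Y n)) * (G n (Complex x (Y n)) - F x) + (E (Complex x (Y n)) - E (of_real x)) * F x"
        by (simp add: algebra_simps)
      also have "norm \<dots> \<le> \<bar>C\<bar> * norm (G n (Complex x (Y n)) - F x) + norm ((E (Complex x (Y n)) - E (of_real x)) * F x)"
        unfolding norm_mult[of "E (Complex x (Y n))"] using C[OF inQ(1)[OF x], of n]
        by (intro order_trans[OF norm_triangle_ineq] add_right_mono) (auto simp: norm_mult intro!: mult_right_mono)
      finally show "norm (E (Complex x (Y n)) * G n (Complex x (Y n)) - E (of_real x) * F x)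
        \<le> \<bar>C\<bar> * norm (G n (Complex x (Y n)) - F x) + norm ((E (Complex x (Y n)) - E (of_real x)) * F x)" .
    qed
    also have "\<dots> = \<bar>C\<bar> * (LINT x|?M. norm (G n (Complex x (Y n)) - F x)) + (LINT x|?M. norm ((E (Complex x (Y n)) - E (of_real x)) * F x))"
      using Gi Fi i3 by simp
    finally show ?thesis .
  qed
  have "(\<lambda>n. \<bar>C\<bar> * (LINT x|?M. norm (G n (Complex x (Y n)) - F x)) + (LINT x|?M. norm ((E (Complex x (Y n)) - E (of_real x)) * F x))) \<longlonglongrightarrow> \<bar>C\<bar> * 0 + (LINT x|?M. 0)"
    by (intro tendsto_intros conv sec)
  then have lim: "(\<lambda>n. \<bar>C\<bar> * (LINT x|?M. norm (G n (Complex x (Y n)) - F x)) + (LINT x|?M. norm ((E (Complex x (Y n)) - E (of_real x)) * F x))) \<longlonglongrightarrow> 0"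
    by simp
  show "(\<lambda>n. LINT x|?M. norm (E (Complex x (Y n)) * G n (Complex x (Y n)) - E (of_real x) * F x)) \<longlonglongrightarrow> 0"
    by (rule tendsto_sandwich[OF _ _ tendsto_const lim])
      (use le in \<open>auto intro!: always_eventually integral_nonneg_AE\<close>)
qed

text \<open>\<open>K\<close> is \<open>E * f\<close> completed by its boundary values at the two lower corners of the rectangle.\<close>

lemma smirnov_Cauchy_rectangle:
  assumes f: "f \<in> smirnov" and F: "F absolutely_integrable_on {a..b}" "AE x in lebesgue. has_boundary_value f x (F x)"
    and ab: "a < b" and s: "0 < s" and rect: "\<And>x t. x \<in> {a..b} \<Longrightarrow> t \<in> {0..s} \<Longrightarrow> Complex x t \<in> ball (of_real x0) r"
    and good: "has_boundary_value f a (F a)" "has_boundary_value f b (F b)"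
    and E: "E holomorphic_on ball (of_real x0) r"
    and K_def: "K = (\<lambda>w. E w * (if Im w = 0 then F (Re w) else f w))"
  shows "Im z < 0 \<Longrightarrow> three_sides K a b s z + integral {a..b} (\<lambda>x. E (of_real x) * F x / (of_real x - z)) = 0"
    and "a < Re z \<Longrightarrow> Re z < b \<Longrightarrow> 0 < Im z \<Longrightarrow> Im z < s \<Longrightarrow>
      three_sides K a b s z + integral {a..b} (\<lambda>x. E (of_real x) * F x / (of_real x - z)) = 2 * of_real pi * \<i> * (E z * f z)"
    and "continuous_on {0..s} (\<lambda>t. K (Complex a t))" "continuous_on {0..s} (\<lambda>t. K (Complex b t))"
    and "continuous_on {a..b} (\<lambda>x. K (Complex x s))"
proof -
  note fh = smirnov_holomorphic[OF f]
  let ?S = "upper_half_plane \<inter> ball (of_real x0) r"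
  have Ec: "continuous_on (ball (of_real x0) r) E" using E by (rule holomorphic_on_imp_continuous_on)
  have Ks: "continuous_on {0..s} (\<lambda>t. K (Complex e t))" if "has_boundary_value f e (F e)" "e \<in> {a..b}" for e
  proof -
    have "continuous_on {0..s} (\<lambda>t. E (Complex e t) * (if t = 0 then F e else f (Complex e t)))"
      using rect[OF that(2)]
      by (intro continuous_on_mult continuous_on_vertical_closed[OF that(1) fh] continuous_on_compose2[OF Ec])
        (auto simp: Complex_eq intro!: continuous_intros)
    then show ?thesis by (simp add: K_def cong: if_cong)
  qed
  show sides: "continuous_on {0..s} (\<lambda>t. K (Complex a t))" "continuous_on {0..s} (\<lambda>t. K (Complex b t))"
    using Ks good ab by auto
  have "continuous_on {a..b} (\<lambda>x. E (Complex x s) * f (Complex x s))"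
    using rect s by (intro continuous_on_mult continuous_on_compose2[OF Ec] continuous_on_compose2[OF holomorphic_on_imp_continuous_on[OF fh]])
      (auto simp: Complex_eq upper_half_plane_iff intro!: continuous_intros)
  then show top: "continuous_on {a..b} (\<lambda>x. K (Complex x s))" using s by (simp add: K_def)
  obtain G0 Y0 where G0: "\<And>n. G0 n holomorphic_on upper_half_plane"
    "\<And>n z. z \<in> upper_half_plane \<Longrightarrow> norm (G0 n z) \<le> norm (f z)"
    "\<And>z. z \<in> upper_half_plane \<Longrightarrow> (\<lambda>n::nat. G0 n z) \<longlonglongrightarrow> f z" and Y0: "\<And>n. Y0 n > 0" "Y0 \<longlonglongrightarrow> 0"
    "(\<lambda>n. LINT x|lebesgue_on {a..b}. norm (G0 n (Complex x (Y0 n)) - F x)) \<longlonglongrightarrow> 0"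
    by (rule smirnov_L1_approximation[OF f ab F], rule that)
  \<comment> \<open>Finitely many terms are discarded so that all heights lie inside the
    rectangle.\<close>
  obtain N where N: "\<And>n. n \<ge> N \<Longrightarrow> Y0 n < s"
    using order_tendstoD(2)[OF Y0(2) s] by (auto simp: eventually_sequentially)
  define G where "G = (\<lambda>n. G0 (n + N))"
  define Y where "Y = (\<lambda>n. Y0 (n + N))"
  have Y: "\<And>n. Y n > 0" "\<And>n. Y n < s" "Y \<longlonglongrightarrow> 0"
    using Y0(1) N LIMSEQ_ignore_initial_segment[OF Y0(2)] by (auto simp: Y_def)
  have conv: "(\<lambda>n. LINT x|lebesgue_on {a..b}. norm (G n (Complex x (Y n)) - F x)) \<longlonglongrightarrow> 0"
    using LIMSEQ_ignore_initial_segment[OF Y0(3), of N] by (simp add: G_def Y_def)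
  have Glim: "(\<lambda>n. G n z) \<longlonglongrightarrow> f z" if "z \<in> upper_half_plane" for z
    using LIMSEQ_ignore_initial_segment[OF G0(3)[OF that], of N] by (simp add: G_def)
  have EQ: "continuous_on {w. Re w \<in> {a..b} \<and> Im w \<in> {0..s}} E"
    by (rule continuous_on_subset[OF Ec]) (use rect complex.exhaust_sel in \<open>force\<close>)
  have Gc: "continuous_on {a..b} (\<lambda>x. G n (Complex x (Y n)))" for n
    unfolding G_def using Y(1)
    by (intro continuous_on_compose2[OF holomorphic_on_imp_continuous_on[OF G0(1)]])
      (auto simp: Complex_eq upper_half_plane_iff intro!: continuous_intros)
  note L1 = L1_convergence_times_continuous[OF EQ s F(1) Gc Y conv]
  have main: "three_sides K a b s z + integral {a..b} (\<lambda>x. E (of_real x) * F x / (of_real x - z)) = c"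
    if z: "Im z < 0 \<and> c = 0 \<or> a < Re z \<and> Re z < b \<and> 0 < Im z \<and> Im z < s \<and> c = 2 * of_real pi * \<i> * K z" for z c
  proof (rule Cauchy_rectangle_boundary[where G="\<lambda>n w. E w * G n w" and S="?S", OF ab s])
    show "open ?S" "convex ?S" "?S \<subseteq> upper_half_plane"
      using open_upper_half_plane convex_upper_half_plane by (auto intro: convex_Int)
    show "Complex x t \<in> ?S" if "x \<in> {a..b}" "t \<in> {0<..s}" for x t
      using that rect by (auto simp: upper_half_plane_iff)
    show "(\<lambda>w. E w * G n w) holomorphic_on ?S" for n
      unfolding G_def by (intro holomorphic_intros holomorphic_on_subset[OF E] holomorphic_on_subset[OF G0(1)]) auto
    show "norm (E w * G n w) \<le> norm (K w)" if "w \<in> ?S" for n w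
      using that G0(2) by (auto simp: K_def G_def norm_mult upper_half_plane_iff intro!: mult_left_mono)
    show "(\<lambda>n. E w * G n w) \<longlonglongrightarrow> K w" if "w \<in> ?S" for w
      using that by (auto simp: K_def upper_half_plane_iff intro!: tendsto_intros Glim)
  qed (use sides top L1 Y z in auto)
  show "three_sides K a b s z + integral {a..b} (\<lambda>x. E (of_real x) * F x / (of_real x - z)) = 0" if "Im z < 0"
    by (rule main) (use that in auto)
  show "three_sides K a b s z + integral {a..b} (\<lambda>x. E (of_real x) * F x / (of_real x - z)) = 2 * of_real pi * \<i> * (E z * f z)"
    if "a < Re z" "Re z < b" "0 < Im z" "Im z < s"
    by (rule main) (use that in \<open>auto simp: K_def\<close>)
qed

text \<open>The Cauchy integral of \<open>f\<close> over a rectangle above the real line and that of \<open>exp (\<i> \<beta>) cnj (g (cnj z))\<close> over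
  its mirror image share the integral over the real side, which therefore drops out of the formula
  for \<open>f z\<close>; the remaining sides define a function holomorphic across the real line.\<close>

lemma smirnov_local_extension:
  assumes f: "f \<in> smirnov" and g: "g \<in> smirnov"
    and F: "locally_integrable F" "boundary_function f F"
    and G: "boundary_function g (\<lambda>x. cnj (U x * F x))"
    and U: "U = (\<lambda>x. exp (- \<i> * of_real (\<beta> x)))" and beta: "real_analytic \<beta>"
  shows "\<exists>r>0. \<exists>h. h holomorphic_on ball (of_real x0) r \<and> (\<forall>z\<in>ball (of_real x0) r \<inter> upper_half_plane. h z = f z)"
proof -
  obtain r B where r: "r > 0" and B: "B holomorphic_on ball (of_real x0) r"
    and Bb: "\<And>y. \<bar>y - x0\<bar> < r \<Longrightarrow> B (of_real y) = of_real (\<beta> y)"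
    using real_analytic_local_extension[OF beta] by metis
  let ?G = "\<lambda>x. cnj (U x * F x)"
  have AEb: "AE x in lebesgue. has_boundary_value f x (F x) \<and> has_boundary_value g x (?G x)"
    using F(2) G unfolding boundary_function_def by eventually_elim simp
  \<comment> \<open>Almost every real point has boundary values of both f and g, so the vertical
    sides can be placed at such points, one on each side of x0 and within r / 2 of it. With height r
    / 4 the rectangle stays in the disc.\<close>
  obtain a where a: "x0 - r / 2 < a" "a < x0" "has_boundary_value f a (F a)" "has_boundary_value g a (?G a)"
    using AE_lebesgue_obtain[OF AEb, of "x0 - r/2" x0] r by auto
  obtain b where b: "x0 < b" "b < x0 + r / 2" "has_boundary_value f b (F b)" "has_boundary_value g b (?G b)"
    using AE_lebesgue_obtain[OF AEb, of x0 "x0 + r/2"] r by auto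
  define s where "s = r / 4"
  have s: "s > 0" using r by (simp add: s_def)
  have ab: "a < b" using a b by simp
  have rect: "Complex x t \<in> ball (of_real x0) r" if "x \<in> {a..b}" "t \<in> {0..s}" for x t
  proof -
    have "norm (Complex x t - of_real x0) \<le> \<bar>x - x0\<bar> + \<bar>t\<bar>"
      using cmod_le[of "Complex x t - of_real x0"] by simp
    also have "\<dots> < r" using that a b r by (auto simp: s_def abs_if)
    finally show ?thesis by (simp add: dist_norm norm_minus_commute)
  qed
  \<comment> \<open>On the line \<open>E\<close> equals \<open>U\<close>, and |U| = 1, so E times
    the boundary function cnj (U F) of g is cnj F there: the conjugate of what f has.\<close>
  define E where "E = (\<lambda>w. exp (- \<i> * B w))"
  have E: "E holomorphic_on ball (of_real x0) r" unfolding E_def by (intro holomorphic_intros B)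
  have EU: "E (of_real x) = U x" if "x \<in> {a..b}" for x
  proof -
    have "\<bar>x - x0\<bar> < r" using that a b r by (auto simp: abs_if)
    then show ?thesis by (simp add: E_def U Bb)
  qed
  have UU: "U x * cnj (U x) = 1" for x by (simp add: U exp_cnj exp_add[symmetric])
  have Fi: "F absolutely_integrable_on {a..b}" using F(1) by (simp add: locally_integrable_def)
  have Gi: "?G absolutely_integrable_on {a..b}"
  proof -
    have "continuous_on UNIV U" unfolding U by (intro continuous_intros real_analytic_continuous[OF beta])
    moreover have "norm (U x) = 1" for x by (simp add: U)
    ultimately show ?thesis
      using locally_integrable_cnj_times[OF F(1)] unfolding locally_integrable_def by blast
  qed
  define k where "k = (\<lambda>w. 1 * (if Im w = 0 then F (Re w) else f w))"
  define m where "m = (\<lambda>w. E w * (if Im w = 0 then ?G (Re w) else g w))"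
  note fk = smirnov_Cauchy_rectangle[OF f Fi F(2)[unfolded boundary_function_def] ab s rect a(3) b(3) holomorphic_on_const k_def]
  note gm = smirnov_Cauchy_rectangle[OF g Gi G[unfolded boundary_function_def] ab s rect a(4) b(4) E m_def]
  have ks: "continuous_on {0..s} (\<lambda>t. k (Complex a t))" "continuous_on {0..s} (\<lambda>t. k (Complex b t))"
    "continuous_on {a..b} (\<lambda>x. k (Complex x s))" by (rule fk; assumption)+
  have ms: "continuous_on {0..s} (\<lambda>t. m (Complex a t))" "continuous_on {0..s} (\<lambda>t. m (Complex b t))"
    "continuous_on {a..b} (\<lambda>x. m (Complex x s))" by (rule gm; assumption)+
  \<comment> \<open>Cauchy's formula for f with the integral over the real side replaced by its
    expression through the other three sides of the rectangle for E g, conjugated and evaluated at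
    cnj z.\<close>
  define h where "h = (\<lambda>z. (three_sides k a b s z - cnj (three_sides m a b s (cnj z))) / (2 * of_real pi * \<i>))"
  define r' where "r' = Min {x0 - a, b - x0, s}"
  have r': "r' > 0" "r' \<le> x0 - a" "r' \<le> b - x0" "r' \<le> s" using a b s by (auto simp: r'_def)
  let ?V = "ball (complex_of_real x0) r'"
  have V: "a < Re z \<and> Re z < b \<and> Im z < s" if "z \<in> ?V" for z
  proof -
    have "norm (z - of_real x0) < r'" using that by (simp add: dist_norm norm_minus_commute)
    then have "\<bar>Re (z - of_real x0)\<bar> < r'" "\<bar>Im (z - of_real x0)\<bar> < r'"
      using abs_Re_le_cmod abs_Im_le_cmod le_less_trans by blast+
    then show ?thesis using r' by (simp add: abs_less_iff)
  qed
  have W1: "three_sides k a b s holomorphic_on ?V"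
    by (rule holomorphic_on_subset[OF three_sides_holomorphic[OF ks]]) (intro subsetI CollectI V)
  have cV: "cnj ` ?V \<subseteq> ?V"
  proof
    fix w assume "w \<in> cnj ` ?V"
    then obtain z where z: "z \<in> ?V" "w = cnj z" by auto
    have "cnj z - of_real x0 = cnj (z - of_real x0)" by simp
    then have "norm (cnj z - of_real x0) = norm (z - of_real x0)" by (metis complex_mod_cnj)
    then show "w \<in> ?V" using z by (simp add: dist_norm norm_minus_commute)
  qed
  have "three_sides m a b s holomorphic_on cnj ` ?V"
  proof (rule holomorphic_on_subset[OF three_sides_holomorphic[OF ms]])
    show "cnj ` ?V \<subseteq> {z. a < Re z \<and> Re z < b \<and> Im z < s}"
      using cV by (intro subsetI CollectI V) blast
  qed
  from holomorphic_on_compose_cnj_cnj[OF this] have W2: "(\<lambda>z. cnj (three_sides m a b s (cnj z))) holomorphic_on ?V"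
    by (simp add: o_def)
  have "h holomorphic_on ?V" unfolding h_def by (intro holomorphic_intros W1 W2) auto
  moreover have "h z = f z" if z: "z \<in> ?V \<inter> upper_half_plane" for z
  proof -
    have z': "a < Re z" "Re z < b" "0 < Im z" "Im z < s" using z V[of z] by (auto simp: upper_half_plane_iff)
    have 1: "three_sides k a b s z + integral {a..b} (\<lambda>x. F x / (of_real x - z)) = 2 * of_real pi * \<i> * f z"
    proof -
      have "three_sides k a b s z + integral {a..b} (\<lambda>x. 1 * F x / (of_real x - z)) = 2 * of_real pi * \<i> * (1 * f z)"
        by (rule fk(2)) (use z' in auto)
      then show ?thesis by simp
    qed
    \<comment> \<open>For z in the upper half plane the point cnj z lies outside the rectangle, so
      the full Cauchy integral of E g vanishes.\<close>
    have "three_sides m a b s (cnj z) + integral {a..b} (\<lambda>x. E (of_real x) * ?G x / (of_real x - cnj z)) = 0"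
      by (rule gm(1)) (use z' in auto)
    also have "integral {a..b} (\<lambda>x. E (of_real x) * ?G x / (of_real x - cnj z)) = integral {a..b} (\<lambda>x. cnj (F x / (of_real x - z)))"
    proof (rule Henstock_Kurzweil_Integration.integral_cong)
      fix x assume "x \<in> {a..b}"
      then have "E (of_real x) * ?G x = (U x * cnj (U x)) * cnj (F x)" by (simp add: EU)
      then show "E (of_real x) * ?G x / (of_real x - cnj z) = cnj (F x / (of_real x - z))" by (simp add: UU)
    qed
    also have "\<dots> = cnj (integral {a..b} (\<lambda>x. F x / (of_real x - z)))" by (rule integral_cnj[symmetric])
    finally have "cnj (three_sides m a b s (cnj z) + cnj (integral {a..b} (\<lambda>x. F x / (of_real x - z)))) = cnj 0" by simp
    then have 2: "integral {a..b} (\<lambda>x. F x / (of_real x - z)) = - cnj (three_sides m a b s (cnj z))"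
      by (simp add: eq_neg_iff_add_eq_0 add.commute)
    show ?thesis using 1 unfolding 2 h_def by simp
  qed
  ultimately show ?thesis using r'(1) by blast
qed

text \<open>Two discs centred on the real line that meet also meet inside the upper half plane,
  where both local extensions equal f. Their intersection is convex, so the identity theorem makes
  the extensions agree on all of it.\<close>

lemma holomorphic_extension_across_reals:
  assumes f: "f holomorphic_on upper_half_plane"
    and loc: "\<And>x. \<exists>r>0. \<exists>h. h holomorphic_on ball (of_real x) r \<and> (\<forall>z\<in>ball (of_real x) r \<inter> upper_half_plane. h z = f z)"
  obtains \<Omega> f' where "open \<Omega>" "\<And>z. Im z \<ge> 0 \<Longrightarrow> z \<in> \<Omega>" "f' holomorphic_on \<Omega>" "\<And>z. z \<in> upper_half_plane \<Longrightarrow> f' z = f z"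
proof -
  have "\<forall>x. \<exists>p. fst p > 0 \<and> snd p holomorphic_on ball (complex_of_real x) (fst p) \<and>
      (\<forall>z\<in>ball (of_real x) (fst p) \<inter> upper_half_plane. snd p z = f z)"
    using loc by simp
  then obtain p where p: "\<And>x. fst (p x) > 0 \<and> snd (p x) holomorphic_on ball (complex_of_real x) (fst (p x)) \<and>
      (\<forall>z\<in>ball (of_real x) (fst (p x)) \<inter> upper_half_plane. snd (p x) z = f z)"
    by (rule choice[THEN exE]) blast
  define r h where "r = (\<lambda>x. fst (p x))" and "h = (\<lambda>x. snd (p x))"
  have r: "\<And>x. r x > 0" and h: "\<And>x. h x holomorphic_on ball (complex_of_real x) (r x)"
    and hf: "\<And>x z. z \<in> ball (of_real x) (r x) \<Longrightarrow> Im z > 0 \<Longrightarrow> h x z = f z"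
    using p by (simp_all add: r_def h_def upper_half_plane_iff)
  \<comment> \<open>The disc is an arbitrary choice among those containing z; \<open>eq\<close>
    shows that the value does not depend on it.\<close>
  define f' where "f' = (\<lambda>z. if Im z > 0 then f z else h (SOME x. z \<in> ball (of_real x) (r x)) z)"
  have eq: "f' z = h x z" if z: "z \<in> ball (of_real x) (r x)" for x z
  proof (cases "Im z > 0")
    case True
    then show ?thesis using hf[OF z True] by (simp add: f'_def)
  next
    case False
    define x' where "x' = (SOME x. z \<in> ball (of_real x) (r x))"
    have z': "z \<in> ball (of_real x') (r x')" unfolding x'_def using z by (rule someI)
    let ?W = "ball (complex_of_real x) (r x) \<inter> ball (of_real x') (r x')"
    have "\<exists>w\<in>?W. Im w > 0"
    proof (cases "Im z = 0")
      case True
      obtain e where e: "e > 0" "ball z e \<subseteq> ?W"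
        using z z' open_contains_ball[of ?W] by (metis Int_iff open_Int open_ball)
      have "z + \<i> * of_real (e / 2) \<in> ball z e" using e(1) by (simp add: dist_norm norm_mult)
      moreover have "Im (z + \<i> * of_real (e / 2)) > 0" using True e(1) by simp
      ultimately show ?thesis using e(2) by blast
    next
      case False2: False
      \<comment> \<open>Discs centred on the real line are symmetric under conjugation, so a point
        below the line has its mirror image in the same two discs.\<close>
      have c: "norm (of_real y - cnj z) = norm (of_real y - z)" for y
        by (metis complex_cnj_complex_of_real complex_cnj_diff complex_mod_cnj)
      have "cnj z \<in> ?W" using z z' by (simp add: dist_norm c)
      moreover have "Im (cnj z) > 0" using False False2 by simp
      ultimately show ?thesis by blast
    qed
    then have ne: "?W \<inter> upper_half_plane \<noteq> {}" by (auto simp: upper_half_plane_iff)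
    have "h x z = h x' z"
    proof (rule analytic_continuation_open[of "?W \<inter> upper_half_plane" ?W "h x" "h x'"])
      show "open (?W \<inter> upper_half_plane)" using open_upper_half_plane by auto
      show "connected ?W" by (intro convex_connected convex_Int) auto
      show "h x holomorphic_on ?W" "h x' holomorphic_on ?W" using h holomorphic_on_subset by blast+
      show "h x w = h x' w" if "w \<in> ?W \<inter> upper_half_plane" for w
        using that hf[of w x] hf[of w x'] by (simp add: upper_half_plane_iff)
    qed (use ne z z' in auto)
    then show ?thesis using False by (simp add: f'_def x'_def)
  qed
  have "f' holomorphic_on (\<Union>x\<in>UNIV. ball (complex_of_real x) (r x))"
  proof (rule holomorphic_on_UN_open)
    show "f' holomorphic_on ball (of_real x) (r x)" for x
      by (rule holomorphic_transform[OF h]) (rule eq[symmetric])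
  qed simp
  moreover have "f' holomorphic_on upper_half_plane"
    by (rule holomorphic_transform[OF f]) (simp add: f'_def upper_half_plane_iff)
  ultimately have "f' holomorphic_on (upper_half_plane \<union> (\<Union>x\<in>UNIV. ball (complex_of_real x) (r x)))"
    by (intro holomorphic_on_Un open_upper_half_plane) auto
  moreover have "z \<in> upper_half_plane \<union> (\<Union>x\<in>UNIV. ball (complex_of_real x) (r x))" if "Im z \<ge> 0" for z
  proof (cases "Im z = 0")
    case True
    then have "z = of_real (Re z)" by (simp add: complex_eq_iff)
    then have "z \<in> ball (of_real (Re z)) (r (Re z))" using r by simp
    then show ?thesis by blast
  qed (use that in \<open>auto simp: upper_half_plane_iff\<close>)
  ultimately show ?thesis
    using that[of "upper_half_plane \<union> (\<Union>x\<in>UNIV. ball (complex_of_real x) (r x))" f'] open_upper_half_plane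
    by (auto simp: f'_def upper_half_plane_iff)
qed

section \<open>Jensen's formula on a half disc\<close>

definition half_disc :: "real \<Rightarrow> complex set" where
  "half_disc R = {z. 0 \<le> Im z \<and> cmod z \<le> R}"

lemma half_disc_eq: "half_disc R = {z. 0 \<le> Im z} \<inter> cball 0 R"
  by (auto simp: half_disc_def)

lemma compact_half_disc: "compact (half_disc R)"
  unfolding half_disc_eq by (intro closed_Int_compact closed_halfspace_Im_ge compact_cball)

lemma convex_half_disc: "convex (half_disc R)"
  unfolding half_disc_eq by (intro convex_Int convex_halfspace_Im_ge convex_cball)

text \<open>The e-neighbourhood of a convex set is its Minkowski sum with a ball, hence convex.
  Convexity provides primitives, logarithms and connectedness around the half disc.\<close>

lemma half_disc_convex_neighbourhood:
  assumes "open \<Omega>" "half_disc R \<subseteq> \<Omega>"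
  obtains D where "open D" "convex D" "half_disc R \<subseteq> D" "D \<subseteq> \<Omega>"
proof -
  obtain e where e: "e > 0" "(\<Union>x\<in>half_disc R. ball x e) \<subseteq> \<Omega>"
    using compact_subset_open_imp_ball_epsilon_subset[OF compact_half_disc assms] by blast
  have ball_sum: "ball x e = (\<Union>y\<in>ball 0 e. {x + y})" for x :: complex
  proof (intro equalityI subsetI)
    fix z assume "z \<in> ball x e"
    then have "z - x \<in> ball 0 e" "z = x + (z - x)" by (auto simp: dist_norm norm_minus_commute)
    then show "z \<in> (\<Union>y\<in>ball 0 e. {x + y})" by blast
  qed (auto simp: dist_norm)
  have "(\<Union>x\<in>half_disc R. ball x e) = (\<Union>x\<in>half_disc R. \<Union>y\<in>ball 0 e. {x + y})"
    by (intro SUP_cong refl ball_sum)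
  then have "convex (\<Union>x\<in>half_disc R. ball x e)"
    using convex_sums[OF convex_half_disc convex_ball] by simp
  moreover have "half_disc R \<subseteq> (\<Union>x\<in>half_disc R. ball x e)" using e(1) by force
  ultimately show ?thesis using e(2) that[of "\<Union>x\<in>half_disc R. ball x e"] by blast
qed

lemma half_disc_finite_zeros:
  assumes "R \<ge> 0" "open \<Omega>" "half_disc R \<subseteq> \<Omega>" "\<Phi> holomorphic_on \<Omega>" "\<Phi> 0 \<noteq> 0"
  shows "finite {z \<in> half_disc R. \<Phi> z = 0}"
proof -
  obtain D where D: "open D" "convex D" "half_disc R \<subseteq> D" "D \<subseteq> \<Omega>"
    using half_disc_convex_neighbourhood[OF assms(2,3)] by blast
  have D0: "0 \<in> D" using D(3) assms(1) by (auto simp: half_disc_def)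
  show ?thesis
  proof (cases "\<Phi> constant_on D")
    case True
    then have "{z \<in> half_disc R. \<Phi> z = 0} = {}"
      using D0 D(3) assms(5) unfolding constant_on_def by (metis (mono_tags, lifting) Collect_empty_eq subsetD)
    then show ?thesis by (simp only: finite.emptyI)
  next
    case False
    then show ?thesis
      by (intro holomorphic_compact_finite_zeros[OF holomorphic_on_subset[OF assms(4) D(4)] D(1) convex_connected[OF D(2)] compact_half_disc D(3)])
  qed
qed

text \<open>Up to a constant in \<open>2 \<pi> \<int>\<close>, \<open>\<beta>\<close> is a continuous argument of \<open>\<Phi>\<close> on the real diameter, where
  zeros of even order are permitted.\<close>

definition phase_on :: "real \<Rightarrow> (complex \<Rightarrow> complex) \<Rightarrow> (real \<Rightarrow> real) \<Rightarrow> bool" where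
  "phase_on R \<Phi> \<beta> \<longleftrightarrow> (\<forall>x\<in>{-R..R}. Re (\<Phi> (of_real x) * cis (- \<beta> x)) \<ge> 0 \<and> Im (\<Phi> (of_real x) * cis (- \<beta> x)) = 0)"

text \<open>With L a logarithm of \<Psi>, the function (L z - L 0) / z has a primitive near the half
  disc, so its integrals along the diameter and the arc cancel. On the diameter its imaginary part
  is (\<beta> x - \<beta> 0) / x; on the arc, dz / z = i d\<theta> makes the imaginary part of the
  integral that of ln |\<Psi>| - ln |\<Psi> 0|.\<close>

lemma half_disc_log_mean_nonvanishing:
  assumes R: "R > 0" and Om: "open \<Omega>" "half_disc R \<subseteq> \<Omega>" and hol: "\<Psi> holomorphic_on \<Omega>"
    and nz: "\<And>z. z \<in> half_disc R \<Longrightarrow> \<Psi> z \<noteq> 0"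
    and beta: "continuous_on {-R..R} \<beta>" and ph: "phase_on R \<Psi> \<beta>"
  obtains J where "((\<lambda>x. (\<beta> x - \<beta> 0) / x) has_integral J) {-R..R}"
    "((\<lambda>\<theta>. ln (cmod (\<Psi> (of_real R * cis \<theta>)))) has_integral (pi * ln (cmod (\<Psi> 0)) - J)) {0..pi}"
proof -
  define \<Omega>0 where "\<Omega>0 = {z \<in> \<Omega>. \<Psi> z \<noteq> 0}"
  have "\<Omega>0 = \<Omega> \<inter> \<Psi> -` (- {0})" by (auto simp: \<Omega>0_def)
  moreover have "open (\<Omega> \<inter> \<Psi> -` (- {0}))"
    by (rule continuous_open_preimage[OF holomorphic_on_imp_continuous_on[OF hol] Om(1)]) auto
  ultimately have "open \<Omega>0" by simp
  moreover have "half_disc R \<subseteq> \<Omega>0" using Om nz by (auto simp: \<Omega>0_def)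
  ultimately obtain D where D: "open D" "convex D" "half_disc R \<subseteq> D" "D \<subseteq> \<Omega>0"
    by (rule half_disc_convex_neighbourhood)
  obtain L where L: "L holomorphic_on D" and eL: "\<And>z. z \<in> D \<Longrightarrow> \<Psi> z = exp (L z)"
  proof (rule simply_connected_imp_holomorphic_log[of \<Psi> D])
    show "\<Psi> holomorphic_on D" by (rule holomorphic_on_subset[OF hol]) (use D(4) in \<open>auto simp: \<Omega>0_def\<close>)
    show "simply_connected D" using D(2) by (rule convex_imp_simply_connected)
    show "locally path_connected D" using D(2) by (rule convex_imp_locally_path_connected)
    show "\<Psi> z \<noteq> 0" if "z \<in> D" for z using that D(4) by (auto simp: \<Omega>0_def)
  qed blast
  define M where "M = (\<lambda>z. if z = 0 then deriv L 0 else (L z - L 0) / z)"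
  have "M holomorphic_on D"
    using pole_lemma_open[OF L D(1), of 0] by (simp add: M_def cong: if_cong)
  then obtain P where "\<And>z. z \<in> D \<Longrightarrow> (P has_field_derivative M z) (at z within D)"
    using holomorphic_convex_primitive'[OF D(2,1)] by blast
  then have P: "(P has_field_derivative M z) (at z)" if "z \<in> D" for z
    using that at_within_open[OF that D(1)] by metis
  have rD: "of_real x \<in> D" if "x \<in> {-R..R}" for x
    using D(3) that by (auto simp: half_disc_def)
  have aD: "of_real R * cis \<theta> \<in> D" if "\<theta> \<in> {0..pi}" for \<theta>
  proof -
    have "0 \<le> sin \<theta>" using that by (intro sin_ge_zero) auto
    then show ?thesis using D(3) R by (auto simp: half_disc_def norm_mult)
  qed
  define X where "X = P (of_real R) - P (of_real (-R))"
  have "((\<lambda>x. M (of_real x)) has_integral (P (of_real R) - P (of_real (-R)))) {-R..R}"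
  proof (rule fundamental_theorem_of_calculus)
    fix x assume x: "x \<in> {-R..R}"
    have "((\<lambda>x. P (of_real x)) has_vector_derivative M (of_real x)) (at x)"
      using has_vector_derivative_real_field[OF P[OF rD[OF x]]] .
    then show "((\<lambda>x. P (of_real x)) has_vector_derivative M (of_real x)) (at x within {-R..R})"
      by (rule has_vector_derivative_at_within)
  qed (use R in simp)
  then have lineM: "((\<lambda>x. Im (M (of_real x))) has_integral Im X) {-R..R}"
    unfolding X_def by (rule has_integral_Im)
  have "((\<lambda>\<theta>. (\<i> * of_real R * cis \<theta>) * M (of_real R * cis \<theta>)) has_integral
      (P (of_real R * cis pi) - P (of_real R * cis 0))) {0..pi}"
  proof (rule fundamental_theorem_of_calculus)
    fix \<theta> assume t: "\<theta> \<in> {0..pi}"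
    have "((\<lambda>\<theta>. of_real R * cis \<theta>) has_vector_derivative (\<i> * of_real R * cis \<theta>)) (at \<theta> within {0..pi})"
    proof -
      have "((\<lambda>z. of_real R * exp (\<i> * z)) has_field_derivative (\<i> * of_real R * exp (\<i> * of_real \<theta>))) (at (complex_of_real \<theta>))"
        by (auto intro!: derivative_eq_intros)
      from has_vector_derivative_at_within[OF has_vector_derivative_real_field[OF this]]
      show ?thesis by (simp add: cis_conv_exp)
    qed
    from field_vector_diff_chain_within[OF this has_field_derivative_at_within[OF P[OF aD[OF t]]]]
    show "((\<lambda>\<theta>. P (of_real R * cis \<theta>)) has_vector_derivative (\<i> * of_real R * cis \<theta>) * M (of_real R * cis \<theta>)) (at \<theta> within {0..pi})"
      by (simp add: o_def)
  qed simp
  moreover have "(\<i> * of_real R * cis \<theta>) * M (of_real R * cis \<theta>) = \<i> * (L (of_real R * cis \<theta>) - L 0)" for \<theta>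
    using R by (simp add: M_def)
  ultimately have "((\<lambda>\<theta>. \<i> * (L (of_real R * cis \<theta>) - L 0)) has_integral - X) {0..pi}"
    by (simp add: X_def cis_pi)
  from has_integral_mult_right[OF this, of "- \<i>"]
  have "((\<lambda>\<theta>. L (of_real R * cis \<theta>) - L 0) has_integral \<i> * X) {0..pi}" by simp
  from has_integral_Re[OF this] have "((\<lambda>\<theta>. Re (L (of_real R * cis \<theta>)) - Re (L 0)) has_integral - Im X) {0..pi}"
    by simp
  from has_integral_add[OF this has_integral_const_real[of "Re (L 0)" 0 pi]]
  have "((\<lambda>\<theta>. Re (L (of_real R * cis \<theta>))) has_integral (pi * Re (L 0) - Im X)) {0..pi}" by simp
  moreover have "ln (cmod (\<Psi> (of_real R * cis \<theta>))) = Re (L (of_real R * cis \<theta>))" if "\<theta> \<in> {0..pi}" for \<theta>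
    using eL[OF aD[OF that]] by simp
  moreover have "ln (cmod (\<Psi> 0)) = Re (L 0)" using eL[of 0] rD[of 0] R by simp
  ultimately have arc: "((\<lambda>\<theta>. ln (cmod (\<Psi> (of_real R * cis \<theta>)))) has_integral (pi * ln (cmod (\<Psi> 0)) - Im X)) {0..pi}"
    by (subst has_integral_cong[where g="\<lambda>\<theta>. Re (L (of_real R * cis \<theta>))"]) auto
  \<comment> \<open>The phase condition, together with \<Psi> having no zeros, forces this
    difference into the multiples of 2 \<pi>; being continuous on the diameter, it is
    constant.\<close>
  define c where "c = (\<lambda>x. Im (L (of_real x)) - \<beta> x)"
  have cper: "\<exists>n::int. c x = 2 * pi * of_int n" if x: "x \<in> {-R..R}" for x
  proof -
    have e: "\<Psi> (of_real x) * cis (- \<beta> x) = exp (Re (L (of_real x))) *\<^sub>R cis (c x)"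
      unfolding eL[OF rD[OF x]] c_def
      by (simp add: exp_eq_polar cis_mult scaleR_conv_of_real)
    have "Re (\<Psi> (of_real x) * cis (- \<beta> x)) \<ge> 0 \<and> Im (\<Psi> (of_real x) * cis (- \<beta> x)) = 0"
      using ph x unfolding phase_on_def by blast
    then have "exp (Re (L (of_real x))) * cos (c x) \<ge> 0" "exp (Re (L (of_real x))) * sin (c x) = 0"
      unfolding e by auto
    then have cs: "cos (c x) \<ge> 0" "sin (c x) = 0" by (auto simp: zero_le_mult_iff)
    then have "cos (c x) = 1" using sin_cos_squared_add[of "c x"] by (simp add: power2_eq_1_iff)
    then show ?thesis by (simp add: cos_one_2pi_int mult_ac)
  qed
  have "c constant_on {-R..R}"
  proof (rule continuous_discrete_range_constant)
    show "continuous_on {-R..R} c" unfolding c_def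
      by (intro continuous_intros beta continuous_on_compose2[OF holomorphic_on_imp_continuous_on[OF L]]) (use rD in auto)
    show "\<exists>e>0. \<forall>y. y \<in> {-R..R} \<and> c y \<noteq> c x \<longrightarrow> e \<le> norm (c y - c x)" if x: "x \<in> {-R..R}" for x
    proof (intro exI[of _ "2 * pi"] conjI allI impI)
      fix y assume y: "y \<in> {-R..R} \<and> c y \<noteq> c x"
      obtain m n :: int where mn: "c x = 2 * pi * of_int m" "c y = 2 * pi * of_int n"
        using cper[OF x] cper[of y] y by blast
      then have "m \<noteq> n" using y by auto
      then have "\<bar>of_int (n - m)\<bar> \<ge> (1::real)" by linarith
      then have "2 * pi * 1 \<le> 2 * pi * \<bar>of_int (n - m)\<bar>" by (intro mult_left_mono) auto
      also have "\<dots> = norm (c y - c x)" by (simp add: mn right_diff_distrib[symmetric] abs_mult)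
      finally show "2 * pi \<le> norm (c y - c x)" by simp
    qed simp
  qed simp
  then have cc: "c x = c 0" if "x \<in> {-R..R}" for x using that R by (auto simp: constant_on_def)
  have "((\<lambda>x. (\<beta> x - \<beta> 0) / x) has_integral Im X) {-R..R}"
  \<comment> \<open>At x = 0 the quotient is 0 by convention while \<open>M\<close> has the value of
    the derivative; a single point does not matter.\<close>
  proof (rule has_integral_spike[OF _ _ lineM, of "{0}"])
    fix x assume x: "x \<in> {-R..R} - {0}"
    then have "Im (L (of_real x)) - Im (L 0) = \<beta> x - \<beta> 0" using cc[of x] by (simp add: c_def)
    then show "(\<beta> x - \<beta> 0) / x = Im (M (of_real x))"
      using x by (simp add: M_def Im_divide_of_real)
  qed simp
  then show ?thesis using arc that by blast
qed

section \<open>Order of zeros on the diameter, and removal of zeros by Blaschke factors\<close>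

lemma holomorphic_zero_factor:
  assumes f: "f holomorphic_on S" "open S" "connected S" and a: "a \<in> S" "f a = 0" and nc: "w \<in> S" "f w \<noteq> 0"
  obtains n h where "n > 0" "h holomorphic_on S" "h a \<noteq> 0" "\<And>z. z \<in> S \<Longrightarrow> f z = (z - a) ^ n * h z"
proof -
  have "\<not> f constant_on S" using a nc unfolding constant_on_def by metis
  from holomorphic_factor_zero_nonconstant[OF f a this]
  obtain g r n where g: "0 < n" "0 < r" "ball a r \<subseteq> S" "g holomorphic_on ball a r"
    "\<And>w. w \<in> ball a r \<Longrightarrow> f w = (w - a)^n * g w" "\<And>w. w \<in> ball a r \<Longrightarrow> g w \<noteq> 0"
    by (metis (no_types, lifting))
  \<comment> \<open>The local cofactor at a and the quotient away from a agree on the punctured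
    disc, so together they are holomorphic on all of S.\<close>
  define h where "h = (\<lambda>z. if z = a then g a else f z / (z - a) ^ n)"
  have "h holomorphic_on ball a r"
    by (rule holomorphic_transform[OF g(4)]) (auto simp: h_def g(5))
  moreover have "h holomorphic_on (S - {a})"
  proof (rule holomorphic_transform)
    show "(\<lambda>z. f z / (z - a) ^ n) holomorphic_on (S - {a})"
      by (intro holomorphic_intros holomorphic_on_subset[OF f(1)]) auto
  qed (auto simp: h_def)
  ultimately have "h holomorphic_on (ball a r \<union> (S - {a}))"
    using f(2) by (intro holomorphic_on_Un open_delete) auto
  then have "h holomorphic_on S" by (rule holomorphic_on_subset) (use g(2) in auto)
  moreover have "h a \<noteq> 0" using g(2,6) by (simp add: h_def)
  moreover have "f z = (z - a) ^ n * h z" if "z \<in> S" for z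
    using a g(1) by (auto simp: h_def)
  ultimately show ?thesis using that g(1) by blast
qed

text \<open>\<Phi> times cis (- \<beta>) is nonnegative on both sides of x0, while an odd power of x
  - x0 changes sign. So h times cis (- \<beta>) would be real, nonnegative on the right and
  nonpositive on the left, hence zero at x0.\<close>

lemma phase_zero_even:
  assumes R: "R > 0" and x0: "\<bar>x0\<bar> < R" and beta: "continuous_on {-R..R} \<beta>" and ph: "phase_on R \<Phi> \<beta>"
    and fac: "\<And>x. \<bar>x\<bar> \<le> R \<Longrightarrow> \<Phi> (of_real x) = (of_real x - of_real x0) ^ n * h (of_real x)"
    and h: "continuous_on {-R..R} (\<lambda>x. h (complex_of_real x))" and hnz: "h (of_real x0) \<noteq> 0"
  shows "even n"
proof (rule ccontr)
  assume odd: "odd n"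
  define k where "k = (\<lambda>x. h (of_real x) * cis (- \<beta> x))"
  have ck: "continuous_on {-R..R} k" unfolding k_def cis_conv_exp by (intro continuous_intros h beta)
  have kx: "\<Phi> (of_real x) * cis (- \<beta> x) = of_real ((x - x0) ^ n) * k x" if "\<bar>x\<bar> \<le> R" for x
    using fac[OF that] by (simp add: k_def)
  have key: "Im (k x) = 0 \<and> (x > x0 \<longrightarrow> Re (k x) \<ge> 0) \<and> (x < x0 \<longrightarrow> Re (k x) \<le> 0)" if x: "\<bar>x\<bar> \<le> R" "x \<noteq> x0" for x
  proof -
    have "x \<in> {-R..R}" using x by (auto simp: abs_le_iff)
    then have "Re (of_real ((x - x0) ^ n) * k x) \<ge> 0" "Im (of_real ((x - x0) ^ n) * k x) = 0"
      using ph \<open>x \<in> {-R..R}\<close> unfolding phase_on_def kx[OF x(1), symmetric] by blast+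
    moreover have "Re (of_real c * w) = c * Re w" "Im (of_real c * w) = c * Im w" for c w by simp_all
    ultimately have p: "(x - x0) ^ n * Re (k x) \<ge> 0" "(x - x0) ^ n * Im (k x) = 0"
      by (simp_all only:)
    define q where "q = (x - x0) ^ n"
    have q: "q * Re (k x) \<ge> 0" "q * Im (k x) = 0" using p by (simp_all add: q_def)
    show ?thesis
    proof (cases "x < x0")
      case True
      then have "q < 0" using odd by (simp add: q_def power_less_zero_eq)
      then show ?thesis using q True by (auto simp: zero_le_mult_iff)
    next
      case False
      then have "q > 0" using x(2) by (simp add: q_def)
      then show ?thesis using q False by (auto simp: zero_le_mult_iff)
    qed
  qed
  have x0m: "x0 \<in> {-R<..<R}" using x0 by auto
  have cont: "isCont k x0"
    using ck x0m by (intro continuous_on_interior[OF ck]) (simp add: interior_atLeastAtMost_real)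
  then have lim: "(k \<longlongrightarrow> k x0) (at x0)" by (simp add: isCont_def)
  have ev: "eventually (\<lambda>x. \<bar>x\<bar> \<le> R) (at x0)"
    using eventually_at_in_open'[of "{-R<..<R}" x0] x0m by (auto elim!: eventually_mono)
  have evr: "eventually (\<lambda>x. \<bar>x\<bar> \<le> R \<and> x > x0) (at_right x0)"
    using ev eventually_at_right_less[of x0] unfolding eventually_at_split by (auto intro: eventually_conj)
  have evl: "eventually (\<lambda>x. \<bar>x\<bar> \<le> R \<and> x < x0) (at_left x0)"
  proof -
    have "eventually (\<lambda>x. x < x0) (at_left x0)" by (simp add: eventually_at_filter)
    then show ?thesis using ev unfolding eventually_at_split by (auto intro: eventually_conj)
  qed
  have limr: "(k \<longlongrightarrow> k x0) (at_right x0)" and liml: "(k \<longlongrightarrow> k x0) (at_left x0)"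
    using lim by (simp_all add: filterlim_at_split)
  have "Re (k x0) \<ge> 0"
    by (rule tendsto_lowerbound[OF tendsto_Re[OF limr]]) (use evr key in \<open>auto elim: eventually_mono\<close>)
  moreover have "Re (k x0) \<le> 0"
    by (rule tendsto_upperbound[OF tendsto_Re[OF liml]]) (use evl key in \<open>auto elim: eventually_mono\<close>)
  moreover have "Im (k x0) \<ge> 0"
    by (rule tendsto_lowerbound[OF tendsto_Im[OF limr]]) (use evr key in \<open>auto elim: eventually_mono\<close>)
  moreover have "Im (k x0) \<le> 0"
    by (rule tendsto_upperbound[OF tendsto_Im[OF limr]]) (use evr key in \<open>auto elim: eventually_mono\<close>)
  ultimately have "k x0 = 0" by (simp add: complex_eq_iff)
  then show False using hnz by (simp add: k_def)
qed

text \<open>Dividing by a power of the Blaschke factor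
  \<open>R\<^sup>2 * (z - a) * (z - cnj a) / ((R\<^sup>2 - cnj a * z) * (R\<^sup>2 - a * z))\<close>, which is positive on the real
  diameter and unimodular on the arc; its value at \<open>0\<close> is \<open>\<bar>a\<bar>\<^sup>2 / R\<^sup>2\<close>.\<close>

lemma half_disc_remove_zero:
  assumes R: "R > 0" and Om: "open \<Omega>" "half_disc R \<subseteq> \<Omega>" and hol: "\<Phi> holomorphic_on \<Omega>"
    and arc: "\<And>z. z \<in> half_disc R \<Longrightarrow> cmod z = R \<Longrightarrow> \<Phi> z \<noteq> 0" and nz0: "\<Phi> 0 \<noteq> 0"
    and beta: "continuous_on {-R..R} \<beta>" and ph: "phase_on R \<Phi> \<beta>"
    and a: "a \<in> half_disc R" "\<Phi> a = 0"
  obtains \<Omega>' \<Phi>' where "open \<Omega>'" "half_disc R \<subseteq> \<Omega>'" "\<Phi>' holomorphic_on \<Omega>'"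
    "\<And>z. z \<in> half_disc R \<Longrightarrow> \<Phi>' z = 0 \<longleftrightarrow> \<Phi> z = 0 \<and> z \<noteq> a"
    "\<And>z. z \<in> half_disc R \<Longrightarrow> cmod z = R \<Longrightarrow> cmod (\<Phi>' z) = cmod (\<Phi> z)"
    "phase_on R \<Phi>' \<beta>" "cmod (\<Phi>' 0) \<ge> cmod (\<Phi> 0)" "Im a = 0 \<Longrightarrow> cmod (\<Phi>' 0) \<ge> cmod (\<Phi> 0) * (R / cmod a)\<^sup>2"
proof -
  obtain D where D: "open D" "convex D" "half_disc R \<subseteq> D" "D \<subseteq> \<Omega>"
    using half_disc_convex_neighbourhood[OF Om] by blast
  have a0: "a \<noteq> 0" using a nz0 by auto
  have aR: "cmod a < R" using a arc[of a] by (force simp: half_disc_def)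
  have aD: "a \<in> D" and D0: "0 \<in> D" using a D(3) R by (auto simp: half_disc_def)
  obtain n h where n: "n > 0" and h: "h holomorphic_on D" "h a \<noteq> 0" and fac: "\<And>z. z \<in> D \<Longrightarrow> \<Phi> z = (z - a) ^ n * h z"
    using holomorphic_zero_factor[OF holomorphic_on_subset[OF hol D(4)] D(1) convex_connected[OF D(2)] aD a(2) D0 nz0]
    by metis
  have hc: "continuous_on D h" using h(1) by (rule holomorphic_on_imp_continuous_on)
  have rD: "of_real x \<in> D" "of_real x \<in> half_disc R" if "x \<in> {-R..R}" for x
    using D(3) that by (auto simp: half_disc_def)
  define W where "W = (\<lambda>z. (of_real (R\<^sup>2) - cnj a * z) * (of_real (R\<^sup>2) - a * z) / of_real (R\<^sup>2))"
  define T where "T = (\<lambda>z. (z - a) * (z - cnj a))"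
  have even_n: "even n" if "Im a = 0"
  proof -
    have ra: "a = of_real (Re a)" using that by (simp add: complex_eq_iff)
    have "\<bar>Re a\<bar> < R" using aR abs_Re_le_cmod le_less_trans by blast
    then show ?thesis
    proof (rule phase_zero_even[OF R _ beta ph])
      show "\<Phi> (of_real x) = (of_real x - of_real (Re a)) ^ n * h (of_real x)" if "\<bar>x\<bar> \<le> R" for x
        using fac[of "of_real x"] rD[of x] that ra by (auto simp: abs_le_iff)
      show "continuous_on {-R..R} (\<lambda>x. h (complex_of_real x))"
        by (intro continuous_on_compose2[OF hc] continuous_intros) (use rD in auto)
      show "h (of_real (Re a)) \<noteq> 0" using h(2) ra by simp
    qed
  qed
  \<comment> \<open>For real a the two zeros of the Blaschke factor coincide, so n / 2 copies cancel
    a zero of even order n; otherwise each copy cancels one order of a.\<close>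
  define k where "k = (if Im a = 0 then n div 2 else n)"
  have k: "k > 0"
  proof (cases "Im a = 0")
    case True
    then obtain m where "n = 2 * m" using even_n by (blast elim: evenE)
    then show ?thesis using True n by (simp add: k_def)
  qed (simp add: k_def n)
  \<comment> \<open>For non-real a, dividing also by the powers of z - cnj a may create a pole at
    cnj a, which lies below the real line and so outside the half disc.\<close>
  define \<Omega>' where "\<Omega>' = (if Im a = 0 then D else D - {cnj a})"
  define \<Phi>' where "\<Phi>' = (\<lambda>z. h z * W z ^ k / (if Im a = 0 then 1 else (z - cnj a) ^ n))"
  have K': "half_disc R \<subseteq> \<Omega>'"
    using D(3) a(1) by (auto simp: \<Omega>'_def half_disc_def)
  have hol': "\<Phi>' holomorphic_on \<Omega>'"
    unfolding \<Phi>'_def \<Omega>'_def W_def using R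
    by (auto intro!: holomorphic_intros holomorphic_on_subset[OF h(1)])
  have eq: "\<Phi>' z = \<Phi> z * (W z / T z) ^ k" if "z \<in> half_disc R" "z \<noteq> a" for z
  proof -
    have zD: "z \<in> D" using that D(3) by auto
    show ?thesis
    proof (cases "Im a = 0")
      case True
      then have "n = 2 * k" "cnj a = a" using even_n by (auto simp: k_def complex_eq_iff)
      then have "T z ^ k = (z - a) ^ n" by (simp add: T_def power_mult power2_eq_square)
      then show ?thesis using that True unfolding \<Phi>'_def fac[OF zD] by (simp add: power_divide)
    next
      case False
      then have "Im a > 0" using a(1) by (simp add: half_disc_def)
      then have "z \<noteq> cnj a" using that by (auto simp: half_disc_def)
      then show ?thesis using that False unfolding \<Phi>'_def fac[OF zD] T_def k_def
        by (simp add: power_divide power_mult_distrib)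
    qed
  qed
  have Wnz: "W z \<noteq> 0" if "z \<in> half_disc R" for z
  proof -
    have "cmod (a * z) < R\<^sup>2" "cmod (cnj a * z) < R\<^sup>2"
      using that aR R by (auto simp: half_disc_def norm_mult power2_eq_square intro!: mult_strict_mono' le_less_trans[OF mult_left_mono[of "cmod z" R "cmod a"]] mult_strict_right_mono)
    then have "of_real (R\<^sup>2) \<noteq> a * z" "of_real (R\<^sup>2) \<noteq> cnj a * z"
      by (metis abs_of_nonneg less_irrefl norm_of_real zero_le_power2)+
    then show ?thesis using R by (simp add: W_def)
  qed
  have Tnz: "T z \<noteq> 0" if "z \<in> half_disc R" "z \<noteq> a" for z
  proof -
    have "z \<noteq> cnj a" 
    proof
      assume "z = cnj a"
      then have "Im a = 0" using that(1) a(1) by (simp add: half_disc_def)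
      then have "cnj a = a" by (simp add: complex_eq_iff)
      then show False using \<open>z = cnj a\<close> that(2) by simp
    qed
    then show ?thesis using that by (simp add: T_def)
  qed
  have zeros: "\<Phi>' z = 0 \<longleftrightarrow> \<Phi> z = 0 \<and> z \<noteq> a" if z: "z \<in> half_disc R" for z
  proof (cases "z = a")
    case True
    have "cnj a \<noteq> a" if "Im a \<noteq> 0" using that by (auto simp: complex_eq_iff)
    then have "\<Phi>' a \<noteq> 0" using h(2) Wnz[OF a(1)] by (auto simp: \<Phi>'_def)
    then show ?thesis using True by simp
  next
    case False
    then show ?thesis using eq[OF z False] Wnz[OF z] Tnz[OF z False] by simp
  qed
  have real_pos: "\<exists>r>0. W (of_real x) / T (of_real x) = of_real r" if x: "x \<in> {-R..R}" "of_real x \<noteq> a" for x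
  proof -
    have "W (of_real x) = of_real ((cmod (of_real (R\<^sup>2) - a * of_real x))\<^sup>2 / R\<^sup>2)"
      unfolding W_def of_real_divide complex_norm_square by (simp add: mult.commute)
    moreover have "T (of_real x) = of_real ((cmod (of_real x - a))\<^sup>2)"
      unfolding T_def complex_norm_square by simp
    moreover have "W (of_real x) \<noteq> 0" "T (of_real x) \<noteq> 0" using Wnz Tnz rD x by auto
    ultimately show ?thesis using R
      by (intro exI[of _ "((cmod (of_real (R\<^sup>2) - a * of_real x))\<^sup>2 / R\<^sup>2) / (cmod (of_real x - a))\<^sup>2"]) (auto simp: of_real_divide)
  qed
  have ph1: "Re (\<Phi>' (of_real x) * cis (- \<beta> x)) \<ge> 0 \<and> Im (\<Phi>' (of_real x) * cis (- \<beta> x)) = 0"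
    if x: "x \<in> {-R..R}" "of_real x \<noteq> a" for x
  proof -
    obtain r where r: "r > 0" "W (of_real x) / T (of_real x) = of_real r" using real_pos[OF x] by blast
    have e: "\<Phi>' (of_real x) * cis (- \<beta> x) = of_real (r ^ k) * (\<Phi> (of_real x) * cis (- \<beta> x))"
      unfolding eq[OF rD(2)[OF x(1)] x(2)] r(2) by simp
    have p: "Re (\<Phi> (of_real x) * cis (- \<beta> x)) \<ge> 0" "Im (\<Phi> (of_real x) * cis (- \<beta> x)) = 0"
      using ph x(1) unfolding phase_on_def by auto
    have "Re (of_real c * w) = c * Re w" "Im (of_real c * w) = c * Im w" for c w by simp_all
    then show ?thesis unfolding e using p r(1) by (metis mult_nonneg_nonneg mult_zero_right zero_le_power less_imp_le)
  qed
  have "phase_on R \<Phi>' \<beta>"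
    unfolding phase_on_def
  proof (intro ballI)
    fix x assume x: "x \<in> {-R..R}"
    show "Re (\<Phi>' (of_real x) * cis (- \<beta> x)) \<ge> 0 \<and> Im (\<Phi>' (of_real x) * cis (- \<beta> x)) = 0"
    proof (cases "of_real x = a")
      case False
      then show ?thesis using ph1 x by blast
    next
      \<comment> \<open>The formula through \<open>W\<close> and \<open>T\<close> is available only
        away from a; at x = a the sign conditions follow by continuity from neighbouring points of
        the diameter.\<close>
      case True
      define g where "g = (\<lambda>x. \<Phi>' (of_real x) * cis (- \<beta> x))"
      have gc: "continuous_on {-R..R} g" unfolding g_def cis_conv_exp
        by (intro continuous_intros beta continuous_on_compose2[OF holomorphic_on_imp_continuous_on[OF hol']])
          (use rD K' in auto)
      have lim: "(g \<longlongrightarrow> g x) (at x within {-R..R})"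
        using gc x by (simp add: continuous_on_def)
      have nt: "at x within {-R..R} \<noteq> bot"
        using x R by (simp add: at_within_Icc_at_left trivial_limit_within islimpt_Icc)
      have ev: "eventually (\<lambda>y. Re (g y) \<ge> 0 \<and> Im (g y) = 0) (at x within {-R..R})"
        unfolding eventually_at_filter
        using ph1 True by (intro always_eventually) (auto simp: g_def)
      have "Re (g x) \<ge> 0"
        by (rule tendsto_lowerbound[OF tendsto_Re[OF lim] _ nt]) (use ev in \<open>auto elim: eventually_mono\<close>)
      moreover have "Im (g x) \<ge> 0"
        by (rule tendsto_lowerbound[OF tendsto_Im[OF lim] _ nt]) (use ev in \<open>auto elim: eventually_mono\<close>)
      moreover have "Im (g x) \<le> 0"
        by (rule tendsto_upperbound[OF tendsto_Im[OF lim] _ nt]) (use ev in \<open>auto elim: eventually_mono\<close>)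
      ultimately show ?thesis by (simp add: g_def)
    qed
  qed
  moreover have "cmod (\<Phi>' z) = cmod (\<Phi> z)" if z: "z \<in> half_disc R" "cmod z = R" for z
  proof -
    have za: "z \<noteq> a" using z aR by auto
    \<comment> \<open>On the arc this identity gives R^2 - w z = z (cnj z - w), so the moduli of
      \<open>W\<close> and \<open>T\<close> agree.\<close>
    have RR: "of_real (R\<^sup>2) = z * cnj z" using complex_norm_square[of z] z(2) by simp
    have "cmod (of_real (R\<^sup>2) - w * z) = R * cmod (cnj z - w)" for w
    proof -
      have "of_real (R\<^sup>2) - w * z = z * (cnj z - w)" unfolding RR by (simp add: algebra_simps)
      then show ?thesis by (simp only: norm_mult z(2))
    qed
    moreover have "cmod (cnj z - cnj a) = cmod (z - a)" "cmod (cnj z - a) = cmod (z - cnj a)"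
      by (metis complex_cnj_cnj complex_cnj_diff complex_mod_cnj)+
    ultimately have "cmod (W z) = cmod (T z)"
      using R by (simp add: W_def T_def norm_mult norm_divide power2_eq_square)
    then show ?thesis unfolding eq[OF z(1) za] using Tnz[OF z(1) za]
      by (simp add: norm_mult norm_power norm_divide)
  qed
  moreover have at0: "cmod (\<Phi>' 0) = cmod (\<Phi> 0) * ((R / cmod a)\<^sup>2) ^ k"
  proof -
    have "0 \<in> half_disc R" using R by (simp add: half_disc_def)
    have "W 0 = of_real (R\<^sup>2)" "T 0 = of_real ((cmod a)\<^sup>2)"
      using R unfolding W_def T_def complex_norm_square by (auto simp: power2_eq_square)
    then have "cmod (W 0 / T 0) = (R / cmod a)\<^sup>2" by (simp add: norm_divide norm_power power_divide)
    then show ?thesis unfolding eq[OF \<open>0 \<in> half_disc R\<close> a0[symmetric]]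
      by (simp only: norm_mult norm_power)
  qed
  moreover have ge1: "(R / cmod a)\<^sup>2 \<ge> 1" using aR a0 by (simp add: one_le_power)
  then have "((R / cmod a)\<^sup>2) ^ k \<ge> 1" by (rule one_le_power)
  then have "cmod (\<Phi>' 0) \<ge> cmod (\<Phi> 0)" unfolding at0 by (simp add: mult_le_cancel_left1)
  \<comment> \<open>As k \<ge> 1, at least one factor (R / |a|)^2 is gained at 0: the worth of a
    real zero of order two.\<close>
  moreover have "((R / cmod a)\<^sup>2) ^ 1 \<le> ((R / cmod a)\<^sup>2) ^ k" using k ge1 by (intro power_increasing) auto
  then have "cmod (\<Phi>' 0) \<ge> cmod (\<Phi> 0) * (R / cmod a)\<^sup>2" unfolding at0 by (intro mult_left_mono) auto
  ultimately show ?thesis using that[of \<Omega>' \<Phi>'] K' hol' zeros D(1) by (auto simp: \<Omega>'_def open_delete)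
qed

text \<open>Induction on the number of distinct zeros, each step removing one zero with its full
  multiplicity. Moduli on the arc are kept, the modulus at 0 never decreases, and it grows by at
  least (R / |x|)^2 when the zero is a point x of \<Lambda>.\<close>

lemma half_disc_remove_zeros:
  assumes R: "R > 0" and beta: "continuous_on {-R..R} \<beta>"
    and Om: "open \<Omega>" "half_disc R \<subseteq> \<Omega>" "\<Phi> holomorphic_on \<Omega>"
    and arc: "\<And>z. z \<in> half_disc R \<Longrightarrow> cmod z = R \<Longrightarrow> \<Phi> z \<noteq> 0" and nz0: "\<Phi> 0 \<noteq> 0" and ph: "phase_on R \<Phi> \<beta>"
    and fin: "finite {z \<in> half_disc R. \<Phi> z = 0}"
    and Lam: "finite \<Lambda>" "\<And>x. x \<in> \<Lambda> \<Longrightarrow> \<bar>x\<bar> < R \<and> \<Phi> (of_real x) = 0"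
  shows "\<exists>\<Omega>' \<Psi>. open \<Omega>' \<and> half_disc R \<subseteq> \<Omega>' \<and> \<Psi> holomorphic_on \<Omega>' \<and> (\<forall>z\<in>half_disc R. \<Psi> z \<noteq> 0) \<and>
    (\<forall>z\<in>half_disc R. cmod z = R \<longrightarrow> cmod (\<Psi> z) = cmod (\<Phi> z)) \<and> phase_on R \<Psi> \<beta> \<and>
    ln (cmod (\<Psi> 0)) \<ge> ln (cmod (\<Phi> 0)) + 2 * (\<Sum>x\<in>\<Lambda>. ln (R / \<bar>x\<bar>))"
  using fin Om arc nz0 ph Lam
proof (induction "card {z \<in> half_disc R. \<Phi> z = 0}" arbitrary: \<Phi> \<Omega> \<Lambda>)
  case 0
  then have "{z \<in> half_disc R. \<Phi> z = 0} = {}" by auto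
  then have nz: "\<forall>z\<in>half_disc R. \<Phi> z \<noteq> 0" by blast
  have "\<Lambda> = {}"
  proof (rule ccontr)
    assume "\<Lambda> \<noteq> {}"
    then obtain x where "x \<in> \<Lambda>" by auto
    then have "complex_of_real x \<in> half_disc R" "\<Phi> (of_real x) = 0" using 0(10)[of x] by (auto simp: half_disc_def)
    then show False using nz by blast
  qed
  then show ?case using 0 nz by (intro exI[of _ \<Omega>] exI[of _ \<Phi>]) auto
next
  case (Suc m)
  have "{z \<in> half_disc R. \<Phi> z = 0} \<noteq> {}" using Suc(2) by (metis card.empty nat.distinct(1))
  then obtain a where a: "a \<in> half_disc R" "\<Phi> a = 0" by blast
  obtain \<Omega>' \<Phi>' where P: "open \<Omega>'" "half_disc R \<subseteq> \<Omega>'" "\<Phi>' holomorphic_on \<Omega>'"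
    and z: "\<And>z. z \<in> half_disc R \<Longrightarrow> \<Phi>' z = 0 \<longleftrightarrow> \<Phi> z = 0 \<and> z \<noteq> a"
    and ar: "\<And>z. z \<in> half_disc R \<Longrightarrow> cmod z = R \<Longrightarrow> cmod (\<Phi>' z) = cmod (\<Phi> z)"
    and ph': "phase_on R \<Phi>' \<beta>" and ge: "cmod (\<Phi>' 0) \<ge> cmod (\<Phi> 0)" "Im a = 0 \<Longrightarrow> cmod (\<Phi>' 0) \<ge> cmod (\<Phi> 0) * (R / cmod a)\<^sup>2"
    by (rule half_disc_remove_zero[OF R Suc(4,5,6,7,8) beta Suc(9) a]) blast+
  have Z: "{z \<in> half_disc R. \<Phi>' z = 0} = {z \<in> half_disc R. \<Phi> z = 0} - {a}" using z by auto
  have Lin: "complex_of_real x \<in> half_disc R" if "x \<in> \<Lambda>" for x using Suc(11)[OF that] by (auto simp: half_disc_def)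
  have cr: "complex_of_real x = a \<longleftrightarrow> Im a = 0 \<and> x = Re a" for x by (auto simp: complex_eq_iff)
  define \<Lambda>1 where "\<Lambda>1 = (if Im a = 0 then \<Lambda> - {Re a} else \<Lambda>)"
  have "m = card {z \<in> half_disc R. \<Phi>' z = 0}" unfolding Z using Suc(2,3) a by simp
  moreover have "finite {z \<in> half_disc R. \<Phi>' z = 0}" unfolding Z using Suc(3) by simp
  moreover have "\<Phi>' w \<noteq> 0" if "w \<in> half_disc R" "cmod w = R" for w
    using ar[OF that] Suc(7)[OF that] by auto
  moreover have nz': "\<Phi>' 0 \<noteq> 0" using ge(1) Suc(8) by auto
  moreover have "finite \<Lambda>1" using Suc(10) by (simp add: \<Lambda>1_def)
  moreover have "\<bar>x\<bar> < R \<and> \<Phi>' (of_real x) = 0" if "x \<in> \<Lambda>1" for x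
    using that Suc(11)[of x] z[OF Lin[of x]] cr[of x] by (auto simp: \<Lambda>1_def split: if_splits)
  ultimately obtain \<Omega>'' \<Psi> where Q: "open \<Omega>''" "half_disc R \<subseteq> \<Omega>''" "\<Psi> holomorphic_on \<Omega>''" "\<forall>z\<in>half_disc R. \<Psi> z \<noteq> 0"
    "\<forall>z\<in>half_disc R. cmod z = R \<longrightarrow> cmod (\<Psi> z) = cmod (\<Phi>' z)" "phase_on R \<Psi> \<beta>"
    "ln (cmod (\<Psi> 0)) \<ge> ln (cmod (\<Phi>' 0)) + 2 * (\<Sum>x\<in>\<Lambda>1. ln (R / \<bar>x\<bar>))"
    using Suc.hyps(1)[of \<Phi>' \<Omega>' \<Lambda>1] P ph' by blast
  have pos: "cmod (\<Phi> 0) > 0" "cmod (\<Phi>' 0) > 0" using Suc(8) nz' by auto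
  have "ln (cmod (\<Phi>' 0)) + 2 * (\<Sum>x\<in>\<Lambda>1. ln (R / \<bar>x\<bar>)) \<ge> ln (cmod (\<Phi> 0)) + 2 * (\<Sum>x\<in>\<Lambda>. ln (R / \<bar>x\<bar>))"
  proof (cases "Im a = 0 \<and> Re a \<in> \<Lambda>")
    case True
    have a0: "a \<noteq> 0" using a Suc(8) by auto
    have ca: "cmod a = \<bar>Re a\<bar>" using True by (simp add: cmod_eq_Re)
    have "ln (cmod (\<Phi> 0)) + 2 * ln (R / \<bar>Re a\<bar>) = ln (cmod (\<Phi> 0) * (R / cmod a)\<^sup>2)"
      using pos R a0 by (simp add: ln_mult ln_realpow ca[symmetric])
    also have "\<dots> \<le> ln (cmod (\<Phi>' 0))"
      using ge(2) True pos R a0 by (subst ln_le_cancel_iff) auto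
    finally show ?thesis using True sum.remove[of \<Lambda> "Re a" "\<lambda>x. ln (R / \<bar>x\<bar>)"] Suc(10) by (simp add: \<Lambda>1_def)
  next
    case False
    then have "\<Lambda>1 = \<Lambda>" by (auto simp: \<Lambda>1_def)
    then show ?thesis using ge(1) pos by simp
  qed
  then have "ln (cmod (\<Psi> 0)) \<ge> ln (cmod (\<Phi> 0)) + 2 * (\<Sum>x\<in>\<Lambda>. ln (R / \<bar>x\<bar>))" using Q(7) by linarith
  moreover have "\<forall>z\<in>half_disc R. cmod z = R \<longrightarrow> cmod (\<Psi> z) = cmod (\<Phi> z)" using Q(5) ar by simp
  ultimately show ?case using Q by blast
qed

text \<open>An inequality rather than an identity, because zeros off \<Lambda> and multiplicities
  above two are simply given away. The weight 2 \<pi> is the length \<pi> of the arc times the order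
  two of a boundary zero.\<close>

lemma half_disc_Jensen:
  assumes R: "R > 0" and beta: "continuous_on {-R..R} \<beta>"
    and Om: "open \<Omega>" "half_disc R \<subseteq> \<Omega>" "\<Phi> holomorphic_on \<Omega>"
    and arc: "\<And>z. z \<in> half_disc R \<Longrightarrow> cmod z = R \<Longrightarrow> \<Phi> z \<noteq> 0" and nz0: "\<Phi> 0 \<noteq> 0" and ph: "phase_on R \<Phi> \<beta>"
    and Lam: "finite \<Lambda>" "\<And>x. x \<in> \<Lambda> \<Longrightarrow> \<bar>x\<bar> < R \<and> \<Phi> (of_real x) = 0"
  obtains I J where "((\<lambda>\<theta>. ln (cmod (\<Phi> (of_real R * cis \<theta>)))) has_integral I) {0..pi}"
    "((\<lambda>x. (\<beta> x - \<beta> 0) / x) has_integral J) {-R..R}"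
    "I \<ge> pi * ln (cmod (\<Phi> 0)) + 2 * pi * (\<Sum>x\<in>\<Lambda>. ln (R / \<bar>x\<bar>)) - J"
proof -
  have "finite {z \<in> half_disc R. \<Phi> z = 0}" by (rule half_disc_finite_zeros) (use R Om nz0 in auto)
  from half_disc_remove_zeros[OF R beta Om arc nz0 ph this Lam]
  obtain \<Omega>' \<Psi> where Q: "open \<Omega>'" "half_disc R \<subseteq> \<Omega>'" "\<Psi> holomorphic_on \<Omega>'" "\<forall>z\<in>half_disc R. \<Psi> z \<noteq> 0"
    "\<forall>z\<in>half_disc R. cmod z = R \<longrightarrow> cmod (\<Psi> z) = cmod (\<Phi> z)" "phase_on R \<Psi> \<beta>"
    "ln (cmod (\<Psi> 0)) \<ge> ln (cmod (\<Phi> 0)) + 2 * (\<Sum>x\<in>\<Lambda>. ln (R / \<bar>x\<bar>))" by blast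
  obtain J where J: "((\<lambda>x. (\<beta> x - \<beta> 0) / x) has_integral J) {-R..R}"
    "((\<lambda>\<theta>. ln (cmod (\<Psi> (of_real R * cis \<theta>)))) has_integral (pi * ln (cmod (\<Psi> 0)) - J)) {0..pi}"
    using half_disc_log_mean_nonvanishing[OF R Q(1-3) _ beta Q(6)] Q(4) by blast
  have "cmod (\<Psi> (of_real R * cis \<theta>)) = cmod (\<Phi> (of_real R * cis \<theta>))" if "\<theta> \<in> {0..pi}" for \<theta>
  proof -
    have "0 \<le> sin \<theta>" using that by (intro sin_ge_zero) auto
    then have "of_real R * cis \<theta> \<in> half_disc R" "cmod (of_real R * cis \<theta>) = R"
      using R by (auto simp: half_disc_def norm_mult)
    then show ?thesis using Q(5) by blast
  qed
  then have I: "((\<lambda>\<theta>. ln (cmod (\<Phi> (of_real R * cis \<theta>)))) has_integral (pi * ln (cmod (\<Psi> 0)) - J)) {0..pi}"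
    using J(2) by (subst has_integral_cong[where g="\<lambda>\<theta>. ln (cmod (\<Psi> (of_real R * cis \<theta>)))"]) auto
  have "pi * ln (cmod (\<Psi> 0)) \<ge> pi * (ln (cmod (\<Phi> 0)) + 2 * (\<Sum>x\<in>\<Lambda>. ln (R / \<bar>x\<bar>)))"
    using Q(7) by (intro mult_left_mono) auto
  then have "pi * ln (cmod (\<Psi> 0)) - J \<ge> pi * ln (cmod (\<Phi> 0)) + 2 * pi * (\<Sum>x\<in>\<Lambda>. ln (R / \<bar>x\<bar>)) - J"
    by (simp add: algebra_simps)
  with I J(1) show ?thesis by (rule that)
qed

section \<open>Counting zeros\<close>

locale expanding_phase =
  fixes \<alpha> :: "real \<Rightarrow> real" and c :: real
  assumes deriv: "\<And>x. (\<alpha> has_real_derivative deriv \<alpha> x) (at x)"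
    and cont: "continuous_on UNIV (deriv \<alpha>)"
    and c: "c > 0" "\<And>x. deriv \<alpha> x \<ge> c"
begin

lemma alpha_expands: "x \<le> y \<Longrightarrow> c * (y - x) \<le> \<alpha> y - \<alpha> x"
proof -
  assume xy: "x \<le> y"
  have "\<alpha> x - c * x \<le> \<alpha> y - c * y"
  proof (rule DERIV_nonneg_imp_nondecreasing[OF xy])
    fix z
    show "\<exists>D. ((\<lambda>z. \<alpha> z - c * z) has_real_derivative D) (at z) \<and> 0 \<le> D"
      using c(2)[of z] by (intro exI[of _ "deriv \<alpha> z - c"]) (auto intro!: derivative_eq_intros deriv)
  qed
  then show ?thesis by (simp add: algebra_simps)
qed

lemma alpha_less_iff: "\<alpha> x < \<alpha> y \<longleftrightarrow> x < y"
proof -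
  have "x < y \<Longrightarrow> \<alpha> x < \<alpha> y" for x y
    using alpha_expands[of x y] mult_pos_pos[OF c(1), of "y - x"] by simp
  then show ?thesis by (metis less_asym linorder_neqE_linordered_idom order_less_irrefl)
qed

lemma alpha_continuous: "continuous_on S \<alpha>"
  by (meson DERIV_continuous_on deriv has_field_derivative_at_within)

lemma alpha_attains:
  assumes "d \<ge> 0" obtains y where "x \<le> y" "\<alpha> y = \<alpha> x + d"
proof -
  have "\<exists>y\<ge>x. y \<le> x + d / c \<and> \<alpha> y = \<alpha> x + d"
  proof (rule IVT')
    show "\<alpha> x + d \<le> \<alpha> (x + d / c)" using alpha_expands[of x "x + d / c"] assms c(1) by simp
  qed (use assms c(1) alpha_continuous in auto)
  then show ?thesis using that by blast
qed

lemma interval_mass_eq: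
  assumes ab: "a \<le> b" and I: "{a<..<b} \<subseteq> I" "I \<subseteq> {a..b}"
  shows "interval_mass \<alpha> I = \<alpha> b - \<alpha> a"
proof -
  have "I = {a<..<b} \<union> (I \<inter> {a, b})" using I by force
  moreover have "finite (I \<inter> {a, b})" by simp
  ultimately have Ib: "I \<in> sets borel"
    by (metis borel_open finite_imp_closed borel_closed open_greaterThanLessThan sets.Un)
  have dm: "deriv \<alpha> \<in> borel_measurable borel" using cont by (rule borel_measurable_continuous_onI)
  have "interval_mass \<alpha> I = (LINT x|lborel. deriv \<alpha> x * indicator {a..b} x)"
    unfolding interval_mass_def set_lebesgue_integral_def
  proof (rule integral_cong_AE)
    have "AE x in lborel. x \<noteq> a \<and> x \<noteq> b"
      using AE_lborel_singleton[of a] AE_lborel_singleton[of b] by eventually_elim simp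
    then show "AE x in lborel. indicat_real I x *\<^sub>R deriv \<alpha> x = deriv \<alpha> x * indicat_real {a..b} x"
    proof eventually_elim
      case (elim x)
      then have "x \<in> {a..b} \<Longrightarrow> x \<in> {a<..<b}" by simp
      then have "x \<in> I \<longleftrightarrow> x \<in> {a..b}" using I by blast
      then show ?case by (auto simp: indicator_def)
    qed
  qed (use Ib dm in auto)
  also have "\<dots> = \<alpha> b - \<alpha> a"
    using ab deriv cont by (intro integral_FTC_Icc_real) (auto simp: continuous_on_eq_continuous_at)
  finally show ?thesis .
qed

text \<open>A positive integral cannot be the default value 0 of a divergent one, so the derivative
  is integrable over I. Since it is at least c, the length of I is at most its mass divided by
  c.\<close>

lemma interval_mass_pos_imp_bounded:
  assumes I: "is_interval I" and r: "interval_mass \<alpha> I > 0"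
  obtains a b where "a < b" "{a<..<b} \<subseteq> I" "I \<subseteq> {a..b}" "interval_mass \<alpha> I = \<alpha> b - \<alpha> a"
proof -
  have int: "integrable lborel (\<lambda>x. indicat_real I x *\<^sub>R deriv \<alpha> x)"
    using r unfolding interval_mass_def set_lebesgue_integral_def
    by (metis less_irrefl not_integrable_integral_eq)
  have ne: "I \<noteq> {}" using r by (auto simp: interval_mass_def set_lebesgue_integral_def)
  have sub: "{x..y} \<subseteq> I" if "x \<in> I" "y \<in> I" for x y
    using I that by (meson atLeastAtMost_iff mem_is_interval_1_I subsetI)
  have len: "c * (y - x) \<le> interval_mass \<alpha> I" if "x \<in> I" "y \<in> I" "x \<le> y" for x y
  proof -
    have "c * (y - x) \<le> \<alpha> y - \<alpha> x" by (rule alpha_expands[OF that(3)])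
    also have "\<dots> = interval_mass \<alpha> {x..y}" using that(3) by (intro interval_mass_eq[symmetric]) auto
    also have "\<dots> \<le> interval_mass \<alpha> I"
      unfolding interval_mass_def set_lebesgue_integral_def
    proof (rule integral_mono[OF _ int])
      have "set_integrable lborel {x..y} (deriv \<alpha>)"
        by (rule borel_integrable_atLeastAtMost') (rule continuous_on_subset[OF cont], simp)
      then show "integrable lborel (\<lambda>t. indicat_real {x..y} t *\<^sub>R deriv \<alpha> t)" by (simp add: set_integrable_def)
      show "indicat_real {x..y} t *\<^sub>R deriv \<alpha> t \<le> indicat_real I t *\<^sub>R deriv \<alpha> t" for t
        using sub[OF that(1,2)] c(1) c(2)[of t] by (auto simp: indicator_def)
    qed
    finally show ?thesis .
  qed
  obtain x0 where x0: "x0 \<in> I" using ne by blast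
  define B where "B = interval_mass \<alpha> I / c"
  have B: "\<bar>y - x0\<bar> \<le> B" if "y \<in> I" for y
    using len[OF that x0] len[OF x0 that] c(1)
    by (cases "y \<le> x0") (auto simp: B_def pos_le_divide_eq mult.commute abs_if)
  have bdd: "bdd_above I" "bdd_below I"
    using B by (auto intro!: bdd_aboveI[of _ "x0 + B"] bdd_belowI[of _ "x0 - B"] simp: abs_le_iff algebra_simps dest: B)
  define a b where "a = Inf I" and "b = Sup I"
  have Iab: "I \<subseteq> {a..b}" using bdd by (auto simp: a_def b_def intro: cInf_lower cSup_upper)
  have abI: "{a<..<b} \<subseteq> I"
  proof
    fix t assume t: "t \<in> {a<..<b}"
    obtain x where "x \<in> I" "x < t" using t ne bdd by (auto simp: a_def cInf_less_iff)
    moreover obtain y where "y \<in> I" "t < y" using t ne bdd by (auto simp: b_def less_cSup_iff)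
    ultimately show "t \<in> I" using sub[of x y] by auto
  qed
  have ab: "a \<le> b" using Iab x0 by force
  have eq: "interval_mass \<alpha> I = \<alpha> b - \<alpha> a" by (rule interval_mass_eq[OF ab abI Iab])
  then have "a \<noteq> b" using r by auto
  then show ?thesis using ab abI Iab eq by (intro that[of a b]) auto
qed

text \<open>Starting at a, blocks of mass r0 are laid side by side. They are half open, so that
  consecutive blocks are disjoint and leave no gap.\<close>

lemma card_packing:
  assumes fin: "\<And>x y. finite (\<Lambda> \<inter> {x..<y})" and r0: "r0 > 0"
    and m: "\<And>x y. x < y \<Longrightarrow> \<alpha> y - \<alpha> x = r0 \<Longrightarrow> m \<le> card (\<Lambda> \<inter> {x..<y})"
  shows "real k * r0 \<le> \<alpha> b - \<alpha> a \<Longrightarrow> k * m \<le> card (\<Lambda> \<inter> {a..<b})"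
proof (induction k arbitrary: a)
  case (Suc k)
  obtain y where y: "a \<le> y" "\<alpha> y = \<alpha> a + r0" using alpha_attains[of r0 a] r0 by auto
  have ay: "a < y" using alpha_less_iff[of a y] y r0 by simp
  have "real k * r0 \<le> \<alpha> b - \<alpha> y" using Suc.prems y by (simp add: algebra_simps)
  then have 1: "k * m \<le> card (\<Lambda> \<inter> {y..<b})" by (rule Suc.IH)
  have "0 \<le> \<alpha> b - \<alpha> y" using \<open>real k * r0 \<le> \<alpha> b - \<alpha> y\<close> r0 by (meson less_imp_le mult_nonneg_nonneg of_nat_0_le_iff order_trans)
  then have yb: "y \<le> b" using alpha_less_iff[of b y] by simp
  have 2: "m \<le> card (\<Lambda> \<inter> {a..<y})" using m[OF ay] y by simp
  have "card (\<Lambda> \<inter> {a..<b}) = card (\<Lambda> \<inter> {a..<y}) + card (\<Lambda> \<inter> {y..<b})"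
  proof -
    have "\<Lambda> \<inter> {a..<b} = (\<Lambda> \<inter> {a..<y}) \<union> (\<Lambda> \<inter> {y..<b})" using y yb by auto
    then show ?thesis by (simp only:) (subst card_Un_disjoint, use fin in auto)
  qed
  then show ?case using 1 2 by simp
qed simp

text \<open>The counting infimum is superadditive in \<open>r\<close> up to an error of one point, so by Fekete's
  argument the limit in the definition of the density exists and equals the supremum.\<close>

lemma lower_density_gt_imp_packing:
  assumes fin: "\<And>x y. finite (\<Lambda> \<inter> {x..y})" and s0: "s0 \<ge> 0" and D: "lower_density \<alpha> \<Lambda> > ereal s0"
  obtains r0 and m :: nat where "r0 > 0" "real m / r0 > s0"
    "\<And>x y. x < y \<Longrightarrow> \<alpha> y - \<alpha> x = r0 \<Longrightarrow> m \<le> card (\<Lambda> \<inter> {x..<y})"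
proof -
  define \<phi> where "\<phi> = (\<lambda>r::real. INF I\<in>{I. is_interval I \<and> interval_mass \<alpha> I = r}. ereal (real (card (\<Lambda> \<inter> I)) / r))"
  have fin': "finite (\<Lambda> \<inter> {x..<y})" for x y by (rule finite_subset[OF _ fin[of x y]]) auto
  have pack: "\<exists>m::nat. real m / r0 \<ge> w \<and> (\<forall>x y. x < y \<and> \<alpha> y - \<alpha> x = r0 \<longrightarrow> m \<le> card (\<Lambda> \<inter> {x..<y}))"
    if r0: "r0 > 0" and w: "w \<ge> 0" "ereal w < \<phi> r0" for r0 w
  \<comment> \<open>The cardinality is an integer exceeding w r0, so rounding w r0 up keeps it a
    lower bound.\<close>
  proof (intro exI[of _ "nat \<lceil>w * r0\<rceil>"] conjI allI impI)
    have "w * r0 \<le> real (nat \<lceil>w * r0\<rceil>)" using r0 w by linarith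
    then show "w \<le> real (nat \<lceil>w * r0\<rceil>) / r0" using r0 by (simp add: pos_le_divide_eq)
    fix x y assume xy: "x < y \<and> \<alpha> y - \<alpha> x = r0"
    have "interval_mass \<alpha> {x..<y} = r0" using xy by (subst interval_mass_eq[of x y]) auto
    then have "\<phi> r0 \<le> ereal (real (card (\<Lambda> \<inter> {x..<y})) / r0)"
      unfolding \<phi>_def by (intro INF_lower) (auto simp: is_interval_co)
    then have "ereal w < ereal (real (card (\<Lambda> \<inter> {x..<y})) / r0)" using w(2) by (rule less_le_trans[rotated])
    then have "w * r0 < real (card (\<Lambda> \<inter> {x..<y}))" using r0 by (simp add: pos_less_divide_eq)
    then show "nat \<lceil>w * r0\<rceil> \<le> card (\<Lambda> \<inter> {x..<y})" by linarith
  qed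
  \<comment> \<open>\<open>Lim\<close> is a definite description, so \<open>lower_density\<close>
    can be evaluated only once convergence is shown. If no r0 existed, the supremum
    \<open>L\<close>, which is the limit, would be at most s0.\<close>
  have "\<exists>r0>0. ereal s0 < \<phi> r0"
  proof (rule ccontr)
    assume "\<not> ?thesis"
    then have le: "\<phi> r \<le> ereal s0" if "r > 0" for r using that by (meson not_less)
    define L where "L = (SUP r\<in>{0<..}. \<phi> r)"
    have L: "L \<le> ereal s0" unfolding L_def using le by (intro SUP_least) auto
    have nonneg: "\<phi> r \<ge> 0" if "r > 0" for r unfolding \<phi>_def using that by (intro INF_greatest) auto
    have "(\<phi> \<longlongrightarrow> L) at_top"
    proof (rule order_tendstoI)
      fix y assume "L < y"
      moreover have "eventually (\<lambda>r. \<phi> r \<le> L) at_top"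
        using eventually_gt_at_top[of 0] by eventually_elim (auto simp: L_def intro: SUP_upper)
      ultimately show "eventually (\<lambda>r. \<phi> r < y) at_top" by (auto elim: eventually_mono)
    next
      fix y assume y: "y < L"
      then obtain r0 where r0: "r0 > 0" "y < \<phi> r0" unfolding L_def by (auto simp: less_SUP_iff)
      show "eventually (\<lambda>r. y < \<phi> r) at_top"
      proof (cases "y < 0")
        case True
        show ?thesis using eventually_gt_at_top[of 0]
          by eventually_elim (use True nonneg in \<open>auto intro: less_le_trans\<close>)
      next
        case False
        obtain w where w: "y < ereal w" "ereal w < \<phi> r0" using r0(2) ereal_dense2 by blast
        have w0: "w \<ge> 0" using w(1) False by (metis ereal_less_eq(5) less_imp_le not_less order_trans)
        obtain m :: nat where m: "real m / r0 \<ge> w" "\<And>x y. x < y \<Longrightarrow> \<alpha> y - \<alpha> x = r0 \<Longrightarrow> m \<le> card (\<Lambda> \<inter> {x..<y})"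
          using pack[OF r0(1) w0 w(2)] by blast
        \<comment> \<open>The m + 1 lost points are the m of an incomplete last block and the left
          end point a, which the half-open blocks may count although I need not contain it.\<close>
        have low: "ereal (real m / r0 - (real m + 1) / r) \<le> \<phi> r" if r: "r > 0" for r
          unfolding \<phi>_def
        proof (rule INF_greatest, clarify)
          fix I assume I: "is_interval I" "r = interval_mass \<alpha> I"
          then obtain a b where ab: "a < b" "{a<..<b} \<subseteq> I" "I \<subseteq> {a..b}" "r = \<alpha> b - \<alpha> a"
            using interval_mass_pos_imp_bounded[OF I(1)] r by metis
          define k where "k = nat \<lfloor>r / r0\<rfloor>"
          have k: "real k \<le> r / r0" "r / r0 - 1 < real k"
            using r r0(1) by (auto simp: k_def)
          have "real k * r0 \<le> \<alpha> b - \<alpha> a" using k(1) r0(1) ab(4) by (simp add: pos_le_divide_eq)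
          then have "k * m \<le> card (\<Lambda> \<inter> {a..<b})" by (intro card_packing[OF fin' r0(1) m(2)])
          moreover have fI: "finite (\<Lambda> \<inter> I)" by (rule finite_subset[OF _ fin[of a b]]) (use ab in auto)
          ultimately have "k * m \<le> card (\<Lambda> \<inter> {a..<b})" by simp
          also have "\<dots> \<le> card (insert a (\<Lambda> \<inter> I))"
            using ab fI by (intro card_mono) auto
          also have "\<dots> \<le> card (\<Lambda> \<inter> I) + 1" using fI by (simp add: card_insert_if)
          finally have "real k * real m \<le> real (card (\<Lambda> \<inter> I)) + 1" by (metis of_nat_1 of_nat_add of_nat_le_iff of_nat_mult)
          moreover have "(r / r0 - 1) * real m \<le> real k * real m" using k(2) by (intro mult_right_mono) auto
          ultimately have "(r / r0 - 1) * real m - 1 \<le> real (card (\<Lambda> \<inter> I))" by simp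
          then have "((r / r0 - 1) * real m - 1) / r \<le> real (card (\<Lambda> \<inter> I)) / r" using r by (intro divide_right_mono) auto
          moreover have "((r / r0 - 1) * real m - 1) / r = real m / r0 - (real m + 1) / r"
            using r r0(1) by (simp add: field_simps)
          ultimately show "ereal (real m / r0 - (real m + 1) / interval_mass \<alpha> I) \<le> ereal (real (card (\<Lambda> \<inter> I)) / interval_mass \<alpha> I)"
            using I(2) by simp
        qed
        obtain v where v: "y < ereal v" "ereal v < ereal w" using w(1) ereal_dense2 by blast
        have "((\<lambda>r. real m / r0 - (real m + 1) / r) \<longlongrightarrow> real m / r0) at_top" by real_asymp
        then have "eventually (\<lambda>r. v < real m / r0 - (real m + 1) / r) at_top"
          by (rule order_tendstoD(1)) (use v(2) m(1) in auto)
        with eventually_gt_at_top[of 0] show ?thesis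
        proof eventually_elim
          case (elim r)
          have "y < ereal v" by (rule v)
          also have "\<dots> < ereal (real m / r0 - (real m + 1) / r)" using elim by simp
          also have "\<dots> \<le> \<phi> r" by (rule low[OF elim(1)])
          finally show ?case .
        qed
      qed
    qed
    then have "Lim at_top \<phi> = L" by (intro tendsto_Lim) auto
    then have "lower_density \<alpha> \<Lambda> = L" by (simp add: lower_density_def \<phi>_def)
    then show False using D L by simp
  qed
  then obtain r0 where r0: "r0 > 0" "ereal s0 < \<phi> r0" by blast
  obtain w where w: "ereal s0 < ereal w" "ereal w < \<phi> r0" using ereal_dense2[OF r0(2)] by blast
  obtain m :: nat where m: "real m / r0 \<ge> w" "\<And>x y. x < y \<Longrightarrow> \<alpha> y - \<alpha> x = r0 \<Longrightarrow> m \<le> card (\<Lambda> \<inter> {x..<y})"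
    using pack[OF r0(1) _ w(2)] w(1) s0 by (metis less_ereal.simps(1) less_imp_le order_trans)
  then show ?thesis using that[OF r0(1), of m] w(1) by simp
qed

text \<open>Blocks of mass r0 with at least m points each give 2 \<pi> times the count at least 2
  \<pi> m / r0 times the mass, up to a constant; the factor exceeds 1 by \<epsilon>.\<close>

lemma counting_lower_bound:
  assumes fin: "\<And>x y. finite (\<Lambda> \<inter> {x..y})" and D: "lower_density \<alpha> \<Lambda> > ereal (1 / (2 * pi))"
  obtains \<delta> C where "\<delta> > 0"
    "\<And>x y. x \<le> y \<Longrightarrow> 2 * pi * card (\<Lambda> \<inter> {x<..<y}) - (\<alpha> y - \<alpha> x) \<ge> \<delta> * (y - x) - C"
proof -
  obtain r0 and m :: nat where r0: "r0 > 0" "real m / r0 > 1 / (2 * pi)"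
    and m: "\<And>x y. x < y \<Longrightarrow> \<alpha> y - \<alpha> x = r0 \<Longrightarrow> m \<le> card (\<Lambda> \<inter> {x..<y})"
    using lower_density_gt_imp_packing[OF fin _ D] by (metis divide_nonneg_nonneg mult_nonneg_nonneg pi_ge_zero zero_le_numeral zero_le_one)
  have fin': "finite (\<Lambda> \<inter> {x..<y})" for x y by (rule finite_subset[OF _ fin[of x y]]) auto
  define \<epsilon> where "\<epsilon> = 2 * pi * (real m / r0) - 1"
  have eps: "\<epsilon> > 0" using r0(2) by (simp add: \<epsilon>_def field_simps)
  show ?thesis
  \<comment> \<open>The factor c turns the surplus \<epsilon> per unit of mass into a surplus per
    unit of length. The constant pays for an incomplete block and for the left end point.\<close>
  proof (rule that[of "\<epsilon> * c" "2 * pi * (real m + 1)"])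
    show "\<epsilon> * c > 0" using eps c by simp
    fix x y :: real assume xy: "x \<le> y"
    define d where "d = \<alpha> y - \<alpha> x"
    have d: "c * (y - x) \<le> d" using alpha_expands[OF xy] by (simp add: d_def)
    then have d0: "d \<ge> 0" using xy c(1) by (meson diff_ge_0_iff_ge less_imp_le mult_nonneg_nonneg order_trans)
    define k where "k = nat \<lfloor>d / r0\<rfloor>"
    have fo: "finite (\<Lambda> \<inter> {x<..<y})" by (rule finite_subset[OF _ fin[of x y]]) auto
    have k: "real k \<le> d / r0" "d / r0 - 1 \<le> real k" using d0 r0(1) by (auto simp: k_def)
    have "real k * r0 \<le> \<alpha> y - \<alpha> x" using k(1) r0(1) by (simp add: pos_le_divide_eq d_def)
    then have "k * m \<le> card (\<Lambda> \<inter> {x..<y})" by (intro card_packing[OF fin' r0(1) m])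
    also have "\<dots> \<le> card (insert x (\<Lambda> \<inter> {x<..<y}))"
      using fo by (intro card_mono) (auto simp: subset_eq)
    also have "\<dots> \<le> card (\<Lambda> \<inter> {x<..<y}) + 1" using fo by (simp add: card_insert_if)
    finally have 1: "real k * real m \<le> real (card (\<Lambda> \<inter> {x<..<y})) + 1" by (metis of_nat_1 of_nat_add of_nat_le_iff of_nat_mult)
    have "(d / r0 - 1) * real m \<le> real k * real m" using k(2) by (intro mult_right_mono) auto
    with 1 have "2 * pi * ((d / r0 - 1) * real m - 1) \<le> 2 * pi * real (card (\<Lambda> \<inter> {x<..<y}))"
      by (intro mult_left_mono) auto
    moreover have "2 * pi * ((d / r0 - 1) * real m - 1) - d = \<epsilon> * d - 2 * pi * (real m + 1)"
      using r0(1) by (simp add: \<epsilon>_def field_simps)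
    moreover have "\<epsilon> * c * (y - x) \<le> \<epsilon> * d" using d eps by (simp add: mult.assoc)
    ultimately show "2 * pi * card (\<Lambda> \<inter> {x<..<y}) - (\<alpha> y - \<alpha> x) \<ge> \<epsilon> * c * (y - x) - 2 * pi * (real m + 1)"
      unfolding d_def[symmetric] by linarith
  qed
qed

end

section \<open>Jensen sums as integrals of the counting function\<close>

lemma has_integral_counting_over_x:
  assumes R: "R > 0" and fin: "finite S" and S: "\<And>l. l \<in> S \<Longrightarrow> 0 < l \<and> l < R"
  shows "((\<lambda>x. real (card (S \<inter> {0<..<x})) / x) has_integral (\<Sum>l\<in>S. ln (R / l))) {0..R}"
proof -
  \<comment> \<open>A point l contributes ln (R / l), the integral of 1 / x from l to R.\<close>
  have one: "((\<lambda>x. if l < x then 1 / x else 0) has_integral ln (R / l)) {0..R}" if l: "l \<in> S" for l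
  proof -
    have l': "0 < l" "l < R" using S[OF l] by auto
    have "((\<lambda>x. 1 / x) has_integral (ln R - ln l)) {l..R}"
      using l' by (intro fundamental_theorem_of_calculus)
        (auto intro!: derivative_eq_intros simp: has_real_derivative_iff_has_vector_derivative[symmetric])
    then have "((\<lambda>x. if x \<in> {l..R} then 1 / x else 0) has_integral (ln R - ln l)) {0..R}"
      using l' by (subst has_integral_restrict) auto
    then have "((\<lambda>x. if l < x then 1 / x else 0) has_integral (ln R - ln l)) {0..R}"
      by (rule has_integral_spike[of "{l}", rotated 2]) auto
    then show ?thesis using l' by (simp add: ln_div)
  qed
  have "((\<lambda>x. \<Sum>l\<in>S. if l < x then 1 / x else 0) has_integral (\<Sum>l\<in>S. ln (R / l))) {0..R}"
    using fin one by (intro has_integral_sum) auto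
  moreover have "(\<Sum>l\<in>S. if l < x then 1 / x else 0) = real (card (S \<inter> {0<..<x})) / x" for x :: real
  proof -
    have "(\<Sum>l\<in>S. if l < x then 1 / x else 0) = (\<Sum>l\<in>S \<inter> {l. l < x}. 1 / x)"
      by (simp add: sum.If_cases[OF fin])
    also have "S \<inter> {l. l < x} = S \<inter> {0<..<x}" using S by auto
    finally show ?thesis by simp
  qed
  ultimately show ?thesis by simp
qed

text \<open>Both terms form the integral of (2 \<pi> n x - b x) / x. On [1, R] the counting
  hypothesis bounds the integrand below by \<delta> - C / x. On [0, 1], where C / x is not
  integrable for nonzero C, dropping the count leaves a constant independent of R.\<close>

lemma one_sided_Jensen_lower_bound:
  fixes \<Lambda> :: "real set" and b :: "real \<Rightarrow> real"
  assumes fin: "\<And>R. finite (\<Lambda> \<inter> {0<..<R})"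
    and b: "\<And>R. R > 0 \<Longrightarrow> (\<lambda>x. b x / x) integrable_on {0..R}"
    and count: "\<And>x. x > 0 \<Longrightarrow> 2 * pi * card (\<Lambda> \<inter> {0<..<x}) - b x \<ge> \<delta> * x - C"
  obtains C' where "\<And>R. R \<ge> 1 \<Longrightarrow> 2 * pi * (\<Sum>l\<in>\<Lambda> \<inter> {0<..<R}. ln (R / l)) - integral {0..R} (\<lambda>x. b x / x) \<ge> \<delta> * R - C * ln R - C'"
proof (rule that)
  fix R :: real assume R: "R \<ge> 1"
  define n where "n = (\<lambda>x. real (card (\<Lambda> \<inter> {0<..<x})))"
  have n: "((\<lambda>x. n x / x) has_integral (\<Sum>l\<in>\<Lambda> \<inter> {0<..<R}. ln (R / l))) {0..R}"
  proof (rule has_integral_spike[of "{}"])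
    show "((\<lambda>x. real (card ((\<Lambda> \<inter> {0<..<R}) \<inter> {0<..<x})) / x) has_integral (\<Sum>l\<in>\<Lambda> \<inter> {0<..<R}. ln (R / l))) {0..R}"
      by (rule has_integral_counting_over_x) (use R fin in auto)
    fix x assume "x \<in> {0..R} - {}"
    then have "(\<Lambda> \<inter> {0<..<R}) \<inter> {0<..<x} = \<Lambda> \<inter> {0<..<x}" by auto
    then show "n x / x = real (card ((\<Lambda> \<inter> {0<..<R}) \<inter> {0<..<x})) / x" by (simp add: n_def)
  qed simp
  define F where "F = (\<lambda>x. 2 * pi * (n x / x) - b x / x)"
  have F: "(F has_integral (2 * pi * (\<Sum>l\<in>\<Lambda> \<inter> {0<..<R}. ln (R / l)) - integral {0..R} (\<lambda>x. b x / x))) {0..R}"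
    unfolding F_def using R by (intro has_integral_diff has_integral_mult_right n integrable_integral b) auto
  then have Fi: "F integrable_on {0..R}" by blast
  have F1: "F integrable_on {0..1}" "F integrable_on {1..R}"
    using R by (auto intro: integrable_on_subinterval[OF Fi])
  have "2 * pi * (\<Sum>l\<in>\<Lambda> \<inter> {0<..<R}. ln (R / l)) - integral {0..R} (\<lambda>x. b x / x) = integral {0..1} F + integral {1..R} F"
    using integral_unique[OF F] Henstock_Kurzweil_Integration.integral_combine[OF _ R Fi, of] by simp
  moreover have "integral {0..1} F \<ge> integral {0..1} (\<lambda>x. - (b x / x))"
    using b[of 1] by (intro integral_le F1 integrable_neg) (auto simp: F_def n_def)
  moreover have "integral {1..R} F \<ge> \<delta> * (R - 1) - C * ln R"
  proof -
    have h: "((\<lambda>x. \<delta> - C * (1 / x)) has_integral ((\<delta> * R - C * ln R) - (\<delta> * 1 - C * ln 1))) {1..R}"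
      using R by (intro fundamental_theorem_of_calculus)
        (auto intro!: derivative_eq_intros simp: has_real_derivative_iff_has_vector_derivative[symmetric])
    have "(\<delta> * R - C * ln R) - (\<delta> * 1 - C * ln 1) \<le> integral {1..R} F"
    proof (rule has_integral_le[OF h integrable_integral[OF F1(2)]])
      fix x assume "x \<in> {1..R}"
      then have x: "x > 0" by simp
      have "(\<delta> * x - C) / x \<le> (2 * pi * n x - b x) / x"
        using count[OF x] x by (intro divide_right_mono) (auto simp: n_def)
      then show "\<delta> - C * (1 / x) \<le> F x" using x by (simp add: F_def diff_divide_distrib)
    qed
    then show ?thesis by (simp add: algebra_simps)
  qed
  ultimately show "2 * pi * (\<Sum>l\<in>\<Lambda> \<inter> {0<..<R}. ln (R / l)) - integral {0..R} (\<lambda>x. b x / x)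
     \<ge> \<delta> * R - C * ln R - (\<delta> + integral {0..1} (\<lambda>x. b x / x))"
    by (simp add: algebra_simps)
qed

section \<open>Arc means of Poisson integrals\<close>

text \<open>The Poisson kernel at R cis \<theta> in real coordinates. This form is jointly
  measurable in R, \<theta>, t at sight, and its denominator is symmetric in R and t.\<close>

definition polar_poisson_kernel :: "real \<Rightarrow> real \<Rightarrow> real \<Rightarrow> real" where
  "polar_poisson_kernel R \<theta> t = R * sin \<theta> / (pi * (R\<^sup>2 - 2 * R * t * cos \<theta> + t\<^sup>2))"

lemma cmod_polar_diff: "(cmod (of_real t - of_real R * cis \<theta>))\<^sup>2 = R\<^sup>2 - 2 * R * t * cos \<theta> + t\<^sup>2"
proof -
  have "(cmod (of_real t - of_real R * cis \<theta>))\<^sup>2 = (t - R * cos \<theta>)\<^sup>2 + (R * sin \<theta>)\<^sup>2"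
    by (simp add: cmod_power2)
  also have "\<dots> = R\<^sup>2 * ((sin \<theta>)\<^sup>2 + (cos \<theta>)\<^sup>2) - 2 * R * t * cos \<theta> + t\<^sup>2"
    by algebra
  finally show ?thesis by simp
qed

lemma poisson_kernel_polar: "poisson_kernel (of_real R * cis \<theta>) t = polar_poisson_kernel R \<theta> t"
  unfolding poisson_kernel_def polar_poisson_kernel_def cmod_polar_diff by simp

lemma borel_measurable_polar_poisson_kernel [measurable]:
  assumes [measurable]: "f \<in> borel_measurable M" "g \<in> borel_measurable M" "h \<in> borel_measurable M"
  shows "(\<lambda>x. polar_poisson_kernel (f x) (g x) (h x)) \<in> borel_measurable M"
  unfolding polar_poisson_kernel_def by measurable

text \<open>\<open>R\<close> and \<open>t\<close> trade roles: \<open>\<bar>t\<bar>\<close> times the kernel at \<open>R cis \<theta>\<close> is \<open>R\<close> times a kernel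
  seen as a function of \<open>R\<close>, whose integral over the whole line is at most one. This absorbs the
  singularity at \<open>R = \<bar>t\<bar>\<close>.\<close>

lemma polar_poisson_kernel_radial_nn_integral_le:
  assumes t: "t \<noteq> 0" and th: "\<theta> \<in> {0<..<pi}" and S: "S > 0"
  shows "(\<integral>\<^sup>+R. ennreal (polar_poisson_kernel R \<theta> t) * indicator {S..2*S} R \<partial>lborel) \<le> ennreal (2 * S / \<bar>t\<bar>)"
proof -
  \<comment> \<open>The point t cis \<theta>, reflected into the upper half plane when t is
    negative; its squared distance to R is the denominator of the kernel, up to \<pi>.\<close>
  define w where "w = Complex (t * cos \<theta>) (\<bar>t\<bar> * sin \<theta>)"
  have s: "sin \<theta> > 0" using th by (simp add: sin_gt_zero)
  have w: "Im w > 0" using t s by (simp add: w_def)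
  have eq: "polar_poisson_kernel R \<theta> t = (R / \<bar>t\<bar>) * poisson_kernel w R" for R
  proof -
    have "(cmod (of_real R - w))\<^sup>2 = (R - t * cos \<theta>)\<^sup>2 + (\<bar>t\<bar> * sin \<theta>)\<^sup>2"
      by (simp add: cmod_power2 w_def)
    also have "\<dots> = (R - t * cos \<theta>)\<^sup>2 + (t * sin \<theta>)\<^sup>2"
      by (simp add: power_mult_distrib)
    also have "\<dots> = t\<^sup>2 * ((sin \<theta>)\<^sup>2 + (cos \<theta>)\<^sup>2) - 2 * R * t * cos \<theta> + R\<^sup>2"
      by algebra
    finally have "(cmod (of_real R - w))\<^sup>2 = R\<^sup>2 - 2 * R * t * cos \<theta> + t\<^sup>2" by simp
    then show ?thesis using t by (simp add: poisson_kernel_def polar_poisson_kernel_def w_def)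
  qed
  have "(\<integral>\<^sup>+R. ennreal (polar_poisson_kernel R \<theta> t) * indicator {S..2*S} R \<partial>lborel)
    \<le> (\<integral>\<^sup>+R. ennreal (2 * S / \<bar>t\<bar>) * ennreal (poisson_kernel w R) \<partial>lborel)"
  proof (rule nn_integral_mono)
    fix R
    have "R / \<bar>t\<bar> * poisson_kernel w R \<le> 2 * S / \<bar>t\<bar> * poisson_kernel w R" if "R \<in> {S..2*S}"
      using that w by (intro mult_right_mono divide_right_mono poisson_kernel_nonneg) auto
    then show "ennreal (polar_poisson_kernel R \<theta> t) * indicator {S..2*S} R \<le> ennreal (2 * S / \<bar>t\<bar>) * ennreal (poisson_kernel w R)"
      using S w unfolding eq
      by (auto simp: indicator_def ennreal_mult[symmetric] poisson_kernel_nonneg less_imp_le intro!: ennreal_leI)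
  qed
  also have "\<dots> = ennreal (2 * S / \<bar>t\<bar>) * (\<integral>\<^sup>+R. ennreal (poisson_kernel w R) \<partial>lborel)"
    by (intro nn_integral_cmult) measurable
  also have "\<dots> \<le> ennreal (2 * S / \<bar>t\<bar>) * 1"
    by (intro mult_left_mono poisson_kernel_nn_integral_le w) simp
  finally show ?thesis by simp
qed

text \<open>If |t| is below S / 2 or at least 4 S, the distance from t to the half annulus is at
  least S / 2 or |t| / 2, and a uniform bound of the kernel suffices. In between, the arc of radius
  |t| may lie in the half annulus, and the radial estimate is used for each angle.\<close>

lemma polar_poisson_kernel_annulus_le:
  assumes S: "S > 0"
  shows "(\<integral>\<^sup>+R. (\<integral>\<^sup>+\<theta>. ennreal (polar_poisson_kernel R \<theta> t) * indicator {0<..<pi} \<theta> \<partial>lborel) * indicator {S..2*S} R \<partial>lborel)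
    \<le> ennreal (220 * (S\<^sup>2 / (S\<^sup>2 + t\<^sup>2)))"
proof -
  have S2: "S\<^sup>2 > 0" using S by simp
  have unif: "(\<integral>\<^sup>+R. (\<integral>\<^sup>+\<theta>. ennreal (polar_poisson_kernel R \<theta> t) * indicator {0<..<pi} \<theta> \<partial>lborel) * indicator {S..2*S} R \<partial>lborel)
    \<le> ennreal (k * pi * S)"
    if k: "\<And>R \<theta>. R \<in> {S..2*S} \<Longrightarrow> \<theta> \<in> {0<..<pi} \<Longrightarrow> polar_poisson_kernel R \<theta> t \<le> k" "k \<ge> 0" for k
  proof -
    have "(\<integral>\<^sup>+R. (\<integral>\<^sup>+\<theta>. ennreal (polar_poisson_kernel R \<theta> t) * indicator {0<..<pi} \<theta> \<partial>lborel) * indicator {S..2*S} R \<partial>lborel)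
      \<le> (\<integral>\<^sup>+R. ennreal (k * pi) * indicator {S..2*S} R \<partial>lborel)"
    proof (rule nn_integral_mono)
      fix R
      show "(\<integral>\<^sup>+\<theta>. ennreal (polar_poisson_kernel R \<theta> t) * indicator {0<..<pi} \<theta> \<partial>lborel) * indicator {S..2*S} R
        \<le> ennreal (k * pi) * indicator {S..2*S} R"
      proof (cases "R \<in> {S..2*S}")
        case True
        have "(\<integral>\<^sup>+\<theta>. ennreal (polar_poisson_kernel R \<theta> t) * indicator {0<..<pi} \<theta> \<partial>lborel)
          \<le> (\<integral>\<^sup>+\<theta>. ennreal k * indicator {0<..<pi} \<theta> \<partial>lborel)"
          using k(1)[OF True] by (intro nn_integral_mono) (auto simp: indicator_def intro!: ennreal_leI)
        also have "\<dots> = ennreal k * ennreal pi" by (simp add: nn_integral_cmult_indicator)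
        finally show ?thesis using True k(2) by (simp add: ennreal_mult)
      qed simp
    qed
    also have "\<dots> = ennreal (k * pi) * ennreal S" using S by (simp add: nn_integral_cmult_indicator)
    also have "\<dots> = ennreal (k * pi * S)" using k(2) S by (simp add: ennreal_mult)
    finally show ?thesis .
  qed
  have far: "polar_poisson_kernel R \<theta> t \<le> 2 * S / (pi * d\<^sup>2)"
    if "R \<in> {S..2*S}" "\<theta> \<in> {0<..<pi}" "d > 0" "d \<le> \<bar>\<bar>t\<bar> - R\<bar>" for R \<theta> d
  proof -
    have "\<bar>\<bar>t\<bar> - R\<bar> \<le> cmod (of_real t - of_real R * cis \<theta>)"
      using norm_triangle_ineq3[of "complex_of_real t" "of_real R * cis \<theta>"] that S by (simp add: norm_mult)
    then have "d \<le> cmod (of_real t - of_real R * cis \<theta>)" using that(4) by simp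
    then have "d\<^sup>2 \<le> R\<^sup>2 - 2 * R * t * cos \<theta> + t\<^sup>2"
      unfolding cmod_polar_diff[symmetric] using that(3) by (intro power_mono) auto
    moreover have "0 \<le> sin \<theta>" "sin \<theta> \<le> 1" using that(2) by (auto intro: less_imp_le sin_gt_zero)
    moreover from this have "0 \<le> R * sin \<theta>" using that(1) S by simp
    moreover have "R * sin \<theta> \<le> 2 * S * 1"
      by (rule mult_mono) (use that(1) S \<open>0 \<le> sin \<theta>\<close> \<open>sin \<theta> \<le> 1\<close> in auto)
    ultimately show ?thesis unfolding polar_poisson_kernel_def using that(3) S
      by (intro frac_le mult_pos_pos mult_left_mono) auto
  qed
  consider "\<bar>t\<bar> < S / 2" | "4 * S \<le> \<bar>t\<bar>" | "S / 2 \<le> \<bar>t\<bar>" "\<bar>t\<bar> < 4 * S" by linarith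
  then show ?thesis
  proof cases
    case 1
    have "t\<^sup>2 \<le> (S/2)\<^sup>2" using 1 abs_le_square_iff[of t "S/2"] S by simp
    then have "4 / 5 \<le> S\<^sup>2 / (S\<^sup>2 + t\<^sup>2)" using S2 by (simp add: field_simps add_pos_nonneg)
    moreover have "(\<integral>\<^sup>+R. (\<integral>\<^sup>+\<theta>. ennreal (polar_poisson_kernel R \<theta> t) * indicator {0<..<pi} \<theta> \<partial>lborel) * indicator {S..2*S} R \<partial>lborel)
       \<le> ennreal (2 * S / (pi * (S/2)\<^sup>2) * pi * S)"
      by (rule unif) (use far[of _ _ "S/2"] 1 S in auto)
    moreover have "2 * S / (pi * (S/2)\<^sup>2) * pi * S = 8" using S by (simp add: field_simps power2_eq_square)
    ultimately show ?thesis by (auto elim!: order_trans intro!: ennreal_leI)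
  next
    case 2
    have "t \<noteq> 0" using 2 S by auto
    have "(4 * S)\<^sup>2 \<le> t\<^sup>2" using 2 abs_le_square_iff[of "4 * S" t] S by simp
    then have t2: "16 * S\<^sup>2 \<le> t\<^sup>2" by (simp add: power_mult_distrib)
    have "8 * S\<^sup>2 / t\<^sup>2 \<le> 220 * (S\<^sup>2 / (S\<^sup>2 + t\<^sup>2))"
    proof -
      have "8 * S\<^sup>2 * (S\<^sup>2 + t\<^sup>2) \<le> 220 * S\<^sup>2 * t\<^sup>2"
        using t2 S2 mult_left_mono[of "8 * (S\<^sup>2 + t\<^sup>2)" "220 * t\<^sup>2" "S\<^sup>2"] by (simp add: algebra_simps)
      then show ?thesis using S2 \<open>t \<noteq> 0\<close> by (simp add: divide_simps add_pos_nonneg mult_ac)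
    qed
    moreover have "(\<integral>\<^sup>+R. (\<integral>\<^sup>+\<theta>. ennreal (polar_poisson_kernel R \<theta> t) * indicator {0<..<pi} \<theta> \<partial>lborel) * indicator {S..2*S} R \<partial>lborel)
       \<le> ennreal (2 * S / (pi * (\<bar>t\<bar>/2)\<^sup>2) * pi * S)"
      by (rule unif) (use far[of _ _ "\<bar>t\<bar>/2"] 2 S in auto)
    moreover have "2 * S / (pi * (\<bar>t\<bar>/2)\<^sup>2) * pi * S = 8 * S\<^sup>2 / t\<^sup>2" using \<open>t \<noteq> 0\<close> by (simp add: field_simps power2_eq_square)
    ultimately show ?thesis by (auto elim!: order_trans intro!: ennreal_leI)
  next
    case 3
    have t0: "t \<noteq> 0" using 3 S by auto
    have "t\<^sup>2 \<le> (4 * S)\<^sup>2" using 3 abs_le_square_iff[of t "4 * S"] S by simp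
    then have t2: "t\<^sup>2 \<le> 16 * S\<^sup>2" by (simp add: power_mult_distrib)
    then have "1 / 17 \<le> S\<^sup>2 / (S\<^sup>2 + t\<^sup>2)" using S2 by (simp add: field_simps add_pos_nonneg)
    \<comment> \<open>This case determines the constant: 220 is a little more than 17 times 4
      \<pi>.\<close>
    moreover have "4 * pi \<le> 220 * (1 / 17)" using pi_less_4 pi_approx by simp
    ultimately have le: "4 * pi \<le> 220 * (S\<^sup>2 / (S\<^sup>2 + t\<^sup>2))" by linarith
    have "(\<integral>\<^sup>+R. (\<integral>\<^sup>+\<theta>. ennreal (polar_poisson_kernel R \<theta> t) * indicator {0<..<pi} \<theta> \<partial>lborel) * indicator {S..2*S} R \<partial>lborel)
      = (\<integral>\<^sup>+R. \<integral>\<^sup>+\<theta>. ennreal (polar_poisson_kernel R \<theta> t) * indicator {0<..<pi} \<theta> * indicator {S..2*S} R \<partial>lborel \<partial>lborel)"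
      by (intro nn_integral_cong nn_integral_multc[symmetric]) measurable
    \<comment> \<open>The integral over R must come first: for R = |t| the integral over \<theta>
      diverges.\<close>
    also have "\<dots> = (\<integral>\<^sup>+\<theta>. \<integral>\<^sup>+R. ennreal (polar_poisson_kernel R \<theta> t) * indicator {0<..<pi} \<theta> * indicator {S..2*S} R \<partial>lborel \<partial>lborel)"
      by (rule lborel_pair.Fubini') measurable
    also have "\<dots> \<le> (\<integral>\<^sup>+\<theta>. ennreal 4 * indicator {0<..<pi} \<theta> \<partial>lborel)"
    proof (rule nn_integral_mono)
      fix \<theta>
      show "(\<integral>\<^sup>+R. ennreal (polar_poisson_kernel R \<theta> t) * indicator {0<..<pi} \<theta> * indicator {S..2*S} R \<partial>lborel) \<le> ennreal 4 * indicator {0<..<pi} \<theta>"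
      proof (cases "\<theta> \<in> {0<..<pi}")
        case True
        have "2 * S / \<bar>t\<bar> \<le> 4" using 3 t0 by (simp add: divide_simps)
        then show ?thesis
          using True order_trans[OF polar_poisson_kernel_radial_nn_integral_le[OF t0 True S] ennreal_leI, of 4] by simp
      qed simp
    qed
    also have "\<dots> = ennreal 4 * ennreal pi" by (simp add: nn_integral_cmult_indicator)
    also have "\<dots> = ennreal (4 * pi)" by (simp add: ennreal_mult)
    also have "\<dots> \<le> ennreal (220 * (S\<^sup>2 / (S\<^sup>2 + t\<^sup>2)))" by (intro ennreal_leI le)
    finally show ?thesis .
  qed
qed

lemma poisson_annulus_le:
  assumes v: "log_integrable v" "\<And>t. v t \<ge> 0" and S: "S > 0"
  shows "(\<integral>\<^sup>+R. (\<integral>\<^sup>+\<theta>. ennreal (poisson v (of_real R * cis \<theta>)) * indicator {0<..<pi} \<theta> \<partial>lborel) * indicator {S..2*S} R \<partial>lborel)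
    \<le> (\<integral>\<^sup>+t. ennreal (v t * (220 * (S\<^sup>2 / (S\<^sup>2 + t\<^sup>2)))) \<partial>lborel)"
proof -
  have [measurable]: "v \<in> borel_measurable borel" using v(1) by (rule log_integrable_measurable)
  let ?k = "\<lambda>R \<theta> t. ennreal (polar_poisson_kernel R \<theta> t)"
  have pk: "ennreal (poisson v (of_real R * cis \<theta>)) = (\<integral>\<^sup>+t. ?k R \<theta> t * ennreal (v t) \<partial>lborel)"
    if "\<theta> \<in> {0<..<pi}" "R \<in> {S..2*S}" for R \<theta>
  proof -
    have z: "Im (of_real R * cis \<theta>) > 0" using that S by (simp add: sin_gt_zero)
    have "ennreal (poisson v (of_real R * cis \<theta>)) = (\<integral>\<^sup>+t. ennreal (poisson_kernel (of_real R * cis \<theta>) t * v t) \<partial>lborel)"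
      unfolding poisson_def
      by (rule nn_integral_eq_integral[OF Re_herglotz(2)[OF v(1) z], symmetric])
        (use v(2) poisson_kernel_nonneg[OF less_imp_le[OF z]] in auto)
    also have "\<dots> = (\<integral>\<^sup>+t. ?k R \<theta> t * ennreal (v t) \<partial>lborel)"
      using v(2) poisson_kernel_nonneg[OF less_imp_le[OF z]]
      by (intro nn_integral_cong) (simp add: poisson_kernel_polar ennreal_mult')
    finally show ?thesis .
  qed
  have "(\<integral>\<^sup>+R. (\<integral>\<^sup>+\<theta>. ennreal (poisson v (of_real R * cis \<theta>)) * indicator {0<..<pi} \<theta> \<partial>lborel) * indicator {S..2*S} R \<partial>lborel)
    = (\<integral>\<^sup>+R. (\<integral>\<^sup>+\<theta>. (\<integral>\<^sup>+t. ?k R \<theta> t * ennreal (v t) \<partial>lborel) * indicator {0<..<pi} \<theta> \<partial>lborel) * indicator {S..2*S} R \<partial>lborel)"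
  proof (rule nn_integral_cong)
    fix R :: real
    show "(\<integral>\<^sup>+\<theta>. ennreal (poisson v (of_real R * cis \<theta>)) * indicator {0<..<pi} \<theta> \<partial>lborel) * indicator {S..2*S} R
      = (\<integral>\<^sup>+\<theta>. (\<integral>\<^sup>+t. ?k R \<theta> t * ennreal (v t) \<partial>lborel) * indicator {0<..<pi} \<theta> \<partial>lborel) * indicator {S..2*S} R"
    proof (cases "R \<in> {S..2*S}")
      case True
      have "(\<integral>\<^sup>+\<theta>. ennreal (poisson v (of_real R * cis \<theta>)) * indicator {0<..<pi} \<theta> \<partial>lborel)
        = (\<integral>\<^sup>+\<theta>. (\<integral>\<^sup>+t. ?k R \<theta> t * ennreal (v t) \<partial>lborel) * indicator {0<..<pi} \<theta> \<partial>lborel)"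
        using pk[OF _ True] by (intro nn_integral_cong) (auto simp: indicator_def)
      then show ?thesis by simp
    qed simp
  qed
  also have "\<dots> = (\<integral>\<^sup>+R. (\<integral>\<^sup>+\<theta>. (\<integral>\<^sup>+t. ?k R \<theta> t * ennreal (v t) * indicator {0<..<pi} \<theta> * indicator {S..2*S} R \<partial>lborel) \<partial>lborel) \<partial>lborel)"
    by (simp add: nn_integral_multc)
  also have "\<dots> = (\<integral>\<^sup>+R. (\<integral>\<^sup>+t. (\<integral>\<^sup>+\<theta>. ?k R \<theta> t * ennreal (v t) * indicator {0<..<pi} \<theta> * indicator {S..2*S} R \<partial>lborel) \<partial>lborel) \<partial>lborel)"
    by (intro nn_integral_cong lborel_pair.Fubini') measurable
  also have "\<dots> = (\<integral>\<^sup>+t. (\<integral>\<^sup>+R. (\<integral>\<^sup>+\<theta>. ?k R \<theta> t * ennreal (v t) * indicator {0<..<pi} \<theta> * indicator {S..2*S} R \<partial>lborel) \<partial>lborel) \<partial>lborel)"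
    by (rule lborel_pair.Fubini') measurable
  also have "\<dots> = (\<integral>\<^sup>+t. ennreal (v t) * (\<integral>\<^sup>+R. (\<integral>\<^sup>+\<theta>. ?k R \<theta> t * indicator {0<..<pi} \<theta> \<partial>lborel) * indicator {S..2*S} R \<partial>lborel) \<partial>lborel)"
  proof (rule nn_integral_cong)
    fix t
    have "?k R \<theta> t * ennreal (v t) * indicator {0<..<pi} \<theta> * indicator {S..2*S} R
       = ennreal (v t) * (?k R \<theta> t * indicator {0<..<pi} \<theta> * indicator {S..2*S} R)" for R \<theta> by (simp add: mult_ac)
    then show "(\<integral>\<^sup>+R. (\<integral>\<^sup>+\<theta>. ?k R \<theta> t * ennreal (v t) * indicator {0<..<pi} \<theta> * indicator {S..2*S} R \<partial>lborel) \<partial>lborel)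
      = ennreal (v t) * (\<integral>\<^sup>+R. (\<integral>\<^sup>+\<theta>. ?k R \<theta> t * indicator {0<..<pi} \<theta> \<partial>lborel) * indicator {S..2*S} R \<partial>lborel)"
      by (simp add: nn_integral_cmult nn_integral_multc)
  qed
  also have "\<dots> \<le> (\<integral>\<^sup>+t. ennreal (v t) * ennreal (220 * (S\<^sup>2 / (S\<^sup>2 + t\<^sup>2))) \<partial>lborel)"
    by (intro nn_integral_mono mult_left_mono polar_poisson_kernel_annulus_le S) simp
  also have "\<dots> = (\<integral>\<^sup>+t. ennreal (v t * (220 * (S\<^sup>2 / (S\<^sup>2 + t\<^sup>2)))) \<partial>lborel)"
    using v(2) by (intro nn_integral_cong) (rule ennreal_mult'[symmetric])
  finally show ?thesis .
qed

lemma log_integrable_tail_tendsto_0: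
  assumes "log_integrable v"
  shows "(\<lambda>n. LINT t|lborel. v t / ((real n)\<^sup>2 + t\<^sup>2)) \<longlonglongrightarrow> 0"
proof -
  have [measurable]: "v \<in> borel_measurable borel" using assms by (rule log_integrable_measurable)
  \<comment> \<open>The term with n = 0 is skipped: its weight 1 / t^2 is not dominated by 1 / (1 +
    t^2).\<close>
  have "(\<lambda>n. LINT t|lborel. v t / ((real (Suc n))\<^sup>2 + t\<^sup>2)) \<longlonglongrightarrow> (LINT t::real|lborel. 0)"
  proof (rule integral_dominated_convergence)
    show "integrable lborel (\<lambda>t. norm (v t / (1 + t\<^sup>2)))"
      using assms by (intro integrable_norm) (simp add: log_integrable_def)
    show "AE t in lborel. (\<lambda>n. v t / ((real (Suc n))\<^sup>2 + t\<^sup>2)) \<longlonglongrightarrow> 0"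
      by (intro AE_I2) real_asymp
    show "AE t in lborel. norm (v t / ((real (Suc n))\<^sup>2 + t\<^sup>2)) \<le> norm (v t / (1 + t\<^sup>2))" for n
    proof (rule AE_I2)
      fix t
      have "1 \<le> (real (Suc n))\<^sup>2" by (simp add: one_le_power)
      then show "norm (v t / ((real (Suc n))\<^sup>2 + t\<^sup>2)) \<le> norm (v t / (1 + t\<^sup>2))"
        by (auto simp: abs_mult intro!: divide_left_mono mult_pos_pos add_pos_nonneg)
    qed
  qed auto
  then show ?thesis by (subst filterlim_sequentially_Suc[symmetric]) simp
qed

text \<open>Integrated over S \<le> R \<le> 2 S, the lower bound is of order \<delta> S^2, whereas
  the upper bound is 220 S^2 times the integral of v t / (S^2 + t^2), which tends to 0. The bound is
  asked only for almost every R, since radii through zeros of \<Phi> will be excluded.\<close>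

lemma poisson_arc_mean_not_linear:
  assumes v: "log_integrable v" "\<And>t. v t \<ge> 0" and d: "\<delta> > 0" and C: "C \<ge> 0"
    and low: "\<And>S. S \<ge> 1 \<Longrightarrow> AE R in lborel. R \<in> {S..2*S} \<longrightarrow>
      ennreal (\<delta> * R - C * ln R - C') \<le> (\<integral>\<^sup>+\<theta>. ennreal (poisson v (of_real R * cis \<theta>)) * indicator {0<..<pi} \<theta> \<partial>lborel)"
  shows False
proof -
  have key: "\<delta> - (C * ln (2 * real n) + C') / real n \<le> 220 * (LINT t|lborel. v t / ((real n)\<^sup>2 + t\<^sup>2))" if n: "n \<ge> 1" for n :: nat
  proof -
    define S where "S = real n"
    have S: "S \<ge> 1" using n by (simp add: S_def)
    \<comment> \<open>A lower bound for \<delta> R - C ln R - C' on the whole interval: the linear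
      term at its left end, the logarithm at its right end.\<close>
    define l where "l = \<delta> * S - C * ln (2 * S) - C'"
    have int: "integrable lborel (\<lambda>t. v t * (220 * (S\<^sup>2 / (S\<^sup>2 + t\<^sup>2))))"
    proof -
      have "integrable lborel (\<lambda>t. (220 * (S\<^sup>2 / (S\<^sup>2 + t\<^sup>2))) * of_real (v t))"
      proof (rule log_integrable_kernel[OF v(1)])
        fix t
        have "1 \<le> S\<^sup>2" using S by (simp add: one_le_power)
        then have "1 + t\<^sup>2 \<le> S\<^sup>2 + t\<^sup>2" by simp
        then show "norm (220 * (S\<^sup>2 / (S\<^sup>2 + t\<^sup>2))) \<le> (220 * S\<^sup>2) / (1 + t\<^sup>2)"
          using S by (auto intro!: divide_left_mono mult_pos_pos add_pos_nonneg)
      qed simp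
      then show ?thesis by (simp add: mult.commute)
    qed
    \<comment> \<open>For negative l both sides are 0.\<close>
    have "ennreal (l * S) \<le> ennreal l * ennreal S"
      using S by (cases "l \<ge> 0") (auto simp: ennreal_mult ennreal_neg mult_nonpos_nonneg)
    also have "\<dots> = (\<integral>\<^sup>+R. ennreal l * indicator {S..2*S} R \<partial>lborel)"
      using S by (simp add: nn_integral_cmult_indicator)
    also have "\<dots> \<le> (\<integral>\<^sup>+R. (\<integral>\<^sup>+\<theta>. ennreal (poisson v (of_real R * cis \<theta>)) * indicator {0<..<pi} \<theta> \<partial>lborel) * indicator {S..2*S} R \<partial>lborel)"
    proof (rule nn_integral_mono_AE)
      show "AE R in lborel. ennreal l * indicator {S..2*S} R \<le> (\<integral>\<^sup>+\<theta>. ennreal (poisson v (of_real R * cis \<theta>)) * indicator {0<..<pi} \<theta> \<partial>lborel) * indicator {S..2*S} R"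
        using low[OF S]
      proof eventually_elim
        case (elim R)
        show ?case
        proof (cases "R \<in> {S..2*S}")
          case True
          then have "\<delta> * S \<le> \<delta> * R" "C * ln R \<le> C * ln (2 * S)"
            using S d C by (auto intro!: mult_left_mono)
          then have "ennreal l \<le> ennreal (\<delta> * R - C * ln R - C')"
            unfolding l_def by (intro ennreal_leI) linarith
          also have "\<dots> \<le> (\<integral>\<^sup>+\<theta>. ennreal (poisson v (of_real R * cis \<theta>)) * indicator {0<..<pi} \<theta> \<partial>lborel)"
            using elim True by blast
          finally show ?thesis using True by simp
        qed simp
      qed
    qed
    also have "\<dots> \<le> (\<integral>\<^sup>+t. ennreal (v t * (220 * (S\<^sup>2 / (S\<^sup>2 + t\<^sup>2)))) \<partial>lborel)"
      by (rule poisson_annulus_le) (use v S in auto)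
    also have "\<dots> = ennreal (LINT t|lborel. v t * (220 * (S\<^sup>2 / (S\<^sup>2 + t\<^sup>2))))"
      using int v(2) by (intro nn_integral_eq_integral) auto
    finally have "l * S \<le> (LINT t|lborel. v t * (220 * (S\<^sup>2 / (S\<^sup>2 + t\<^sup>2))))"
      by (subst (asm) ennreal_le_iff) (use v(2) in \<open>auto intro!: integral_nonneg_AE\<close>)
    also have "\<dots> = (LINT t|lborel. 220 * S\<^sup>2 * (v t / (S\<^sup>2 + t\<^sup>2)))"
      by (simp add: mult_ac)
    also have "\<dots> = 220 * S\<^sup>2 * (LINT t|lborel. v t / (S\<^sup>2 + t\<^sup>2))" by (rule integral_mult_right_zero)
    finally have "l * S / S\<^sup>2 \<le> 220 * S\<^sup>2 * (LINT t|lborel. v t / (S\<^sup>2 + t\<^sup>2)) / S\<^sup>2" by (intro divide_right_mono) auto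
    moreover have "l * S / S\<^sup>2 = \<delta> - (C * ln (2 * S) + C') / S"
      using S by (simp add: l_def power2_eq_square field_simps)
    ultimately show ?thesis using S by (simp add: S_def)
  qed
  have "(\<lambda>n. \<delta> - (C * ln (2 * real n) + C') / real n) \<longlonglongrightarrow> \<delta>" by real_asymp
  moreover have "(\<lambda>n. 220 * (LINT t|lborel. v t / ((real n)\<^sup>2 + t\<^sup>2))) \<longlonglongrightarrow> 220 * 0"
    by (intro tendsto_intros log_integrable_tail_tendsto_0 v)
  ultimately have "\<delta> \<le> 220 * 0"
    by (rule LIMSEQ_le) (use key in blast)
  then show False using d by simp
qed

section \<open>Proof of the theorem\<close>

lemma has_boundary_value_extension:
  assumes f': "continuous_on \<Omega> f'" and Om: "open \<Omega>" "of_real x \<in> \<Omega>" and eq: "\<And>z. z \<in> upper_half_plane \<Longrightarrow> f' z = f z"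
  shows "has_boundary_value f x (f' (of_real x))"
  unfolding has_boundary_value_def
proof (intro allI impI)
  fix \<kappa> :: real
  let ?A = "{z \<in> upper_half_plane. \<bar>Re z - x\<bar> < \<kappa> * Im z}"
  have "(f' \<longlongrightarrow> f' (of_real x)) (at (of_real x))"
    using f' Om continuous_on_eq_continuous_at isCont_def by blast
  then have "(f' \<longlongrightarrow> f' (of_real x)) (at (of_real x) within ?A)"
    by (rule tendsto_within_subset) simp
  moreover have "eventually (\<lambda>z. f' z = f z) (at (of_real x) within ?A)"
    unfolding eventually_at_filter by (intro always_eventually) (simp add: eq)
  ultimately show "(f \<longlongrightarrow> f' (of_real x)) (at (of_real x) within ?A)"
    by (rule Lim_transform_eventually)
qed

lemma continuous_AE_eq_imp_eq:
  fixes p q :: "real \<Rightarrow> complex"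
  assumes "continuous_on UNIV p" "continuous_on UNIV q" "AE x in lebesgue. p x = q x"
  shows "p x = q x"
proof (rule ccontr)
  assume ne: "p x \<noteq> q x"
  have "open {y. p y \<noteq> q y}" using assms(1,2) by (intro open_Collect_neq)
  then obtain e where e: "e > 0" "ball x e \<subseteq> {y. p y \<noteq> q y}"
    using ne open_contains_ball by blast
  obtain y where "x - e < y" "y < x + e" "p y = q y"
    using AE_lebesgue_obtain[OF assms(3), of "x - e" "x + e"] e(1) by auto
  then have "y \<in> ball x e" by (auto simp: dist_real_def abs_less_iff)
  then show False using e(2) \<open>p y = q y\<close> by blast
qed

text \<open>The local extension is applied twice. As |U| = 1, the relation between f and g is
  symmetric: conjugating U times the boundary function of g returns F. The relation on the line,
  first known almost everywhere, holds at every point by continuity.\<close>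

lemma smirnov_toeplitz_kernel_extension:
  assumes f: "f \<in> smirnov_toeplitz_kernel U"
    and U: "U = (\<lambda>x. exp (- \<i> * of_real (\<beta> x)))" and beta: "real_analytic \<beta>"
  obtains \<Omega> f' g g' where "open \<Omega>" "\<And>z. Im z \<ge> 0 \<Longrightarrow> z \<in> \<Omega>" "f' holomorphic_on \<Omega>" "g' holomorphic_on \<Omega>"
    "g \<in> smirnov" "\<And>z. z \<in> upper_half_plane \<Longrightarrow> f' z = f z" "\<And>z. z \<in> upper_half_plane \<Longrightarrow> g' z = g z"
    "\<And>x. g' (of_real x) = cnj (U x * f' (of_real x))"
proof -
  obtain F g where fs: "f \<in> smirnov" and F: "boundary_function f F" "locally_integrable F"
    and g: "g \<in> smirnov" "boundary_function g (\<lambda>x. cnj (U x * F x))"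
    using f unfolding smirnov_toeplitz_kernel_def by blast
  have Uc: "continuous_on UNIV U" unfolding U by (intro continuous_intros real_analytic_continuous[OF beta])
  have Un: "norm (U x) = 1" for x by (simp add: U)
  have UU: "cnj (U x) * U x = 1" for x
    by (simp add: U exp_cnj exp_add[symmetric])
  have G: "locally_integrable (\<lambda>x. cnj (U x * F x))" by (rule locally_integrable_cnj_times[OF F(2) Uc Un])
  have e: "cnj (U x * cnj (U x * F x)) = (cnj (U x) * U x) * F x" for x by simp
  have FF: "boundary_function f (\<lambda>x. cnj (U x * cnj (U x * F x)))"
    using F(1) unfolding e UU mult_1 .
  obtain \<Omega>1 f' where 1: "open \<Omega>1" "\<And>z. Im z \<ge> 0 \<Longrightarrow> z \<in> \<Omega>1" "f' holomorphic_on \<Omega>1" "\<And>z. z \<in> upper_half_plane \<Longrightarrow> f' z = f z"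
    by (rule holomorphic_extension_across_reals[OF smirnov_holomorphic[OF fs] smirnov_local_extension[OF fs g(1) F(2,1) g(2) U beta]], rule that)
  obtain \<Omega>2 g' where 2: "open \<Omega>2" "\<And>z. Im z \<ge> 0 \<Longrightarrow> z \<in> \<Omega>2" "g' holomorphic_on \<Omega>2" "\<And>z. z \<in> upper_half_plane \<Longrightarrow> g' z = g z"
    by (rule holomorphic_extension_across_reals[OF smirnov_holomorphic[OF g(1)] smirnov_local_extension[OF g(1) fs G g(2) FF U beta]], rule that)
  note c1 = holomorphic_on_imp_continuous_on[OF 1(3)] and c2 = holomorphic_on_imp_continuous_on[OF 2(3)]
  have rel: "g' (of_real x) = cnj (U x * f' (of_real x))" for x
  proof (rule continuous_AE_eq_imp_eq)
    show "continuous_on UNIV (\<lambda>x. g' (complex_of_real x))"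
      by (rule continuous_on_compose2[OF c2]) (auto intro: continuous_intros 2(2))
    have "continuous_on UNIV (\<lambda>x. f' (complex_of_real x))"
      by (rule continuous_on_compose2[OF c1]) (auto intro: continuous_intros 1(2))
    then show "continuous_on UNIV (\<lambda>x. cnj (U x * f' (of_real x)))" by (intro continuous_intros Uc)
    show "AE x in lebesgue. g' (of_real x) = cnj (U x * f' (of_real x))"
      using F(1) g(2) unfolding boundary_function_def
    proof eventually_elim
      case (elim x)
      have "F x = f' (of_real x)"
        by (rule has_boundary_value_unique[OF elim(1) has_boundary_value_extension[OF c1 1(1) _ 1(4)]]) (simp add: 1(2))
      moreover have "cnj (U x * F x) = g' (of_real x)"
        by (rule has_boundary_value_unique[OF elim(2) has_boundary_value_extension[OF c2 2(1) _ 2(4)]]) (simp add: 2(2))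
      ultimately show ?case by simp
    qed
  qed
  show ?thesis
  proof (rule that[of "\<Omega>1 \<inter> \<Omega>2" f' g' g])
    show "f' holomorphic_on \<Omega>1 \<inter> \<Omega>2" "g' holomorphic_on \<Omega>1 \<inter> \<Omega>2"
      using 1(3) 2(3) by (auto intro: holomorphic_on_subset)
  qed (use 1 2 g rel in auto)
qed

section \<open>Moving the base point to 0, and the contradiction there\<close>

lemma log_integrable_shift:
  assumes "log_integrable v"
  shows "log_integrable (\<lambda>t. v (x + t))"
  unfolding log_integrable_def
proof
  have v: "v \<in> borel_measurable borel" "integrable lborel (\<lambda>t. v t / (1 + t\<^sup>2))"
    using assms by (auto simp: log_integrable_def)
  show m: "(\<lambda>t. v (x + t)) \<in> borel_measurable borel" using v(1) by measurable
  have i: "integrable lborel (\<lambda>t. v (x + 1 * t) / (1 + (x + 1 * t)\<^sup>2))"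
    by (rule lborel_integrable_real_affine[OF v(2)]) simp
  show "integrable lborel (\<lambda>t. v (x + t) / (1 + t\<^sup>2))"
  proof (rule Bochner_Integration.integrable_bound)
    show "integrable lborel (\<lambda>t. (2 + 2 * x\<^sup>2) * (v (x + 1 * t) / (1 + (x + 1 * t)\<^sup>2)))"
      using i by (rule integrable_mult_right)
    show "(\<lambda>t. v (x + t) / (1 + t\<^sup>2)) \<in> borel_measurable lborel" using m by measurable
    show "AE t in lborel. norm (v (x + t) / (1 + t\<^sup>2)) \<le> norm ((2 + 2 * x\<^sup>2) * (v (x + 1 * t) / (1 + (x + 1 * t)\<^sup>2)))"
    proof (rule AE_I2)
      fix t
      have pos: "1 + t\<^sup>2 > 0" "1 + (x + t)\<^sup>2 > 0" by (simp_all add: add_pos_nonneg)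
      have "(x + t)\<^sup>2 \<le> 2 * x\<^sup>2 + 2 * t\<^sup>2" using sum_squares_bound[of x t] by (simp add: power2_sum)
      moreover have "(2 + 2 * x\<^sup>2) * (1 + t\<^sup>2) = 1 + (2 * x\<^sup>2 + 2 * t\<^sup>2) + (1 + 2 * (x * t)\<^sup>2)"
        by (simp add: algebra_simps power2_eq_square)
      ultimately have "1 + (x + t)\<^sup>2 \<le> (2 + 2 * x\<^sup>2) * (1 + t\<^sup>2)"
        using zero_le_power2[of "x * t"] by linarith
      then have "1 / (1 + t\<^sup>2) \<le> (2 + 2 * x\<^sup>2) / (1 + (x + t)\<^sup>2)" using pos by (simp add: divide_simps mult.commute)
      from mult_left_mono[OF this, of "\<bar>v (x + t)\<bar>"]
      show "norm (v (x + t) / (1 + t\<^sup>2)) \<le> norm ((2 + 2 * x\<^sup>2) * (v (x + 1 * t) / (1 + (x + 1 * t)\<^sup>2)))"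
        by (simp add: abs_mult mult.commute)
    qed
  qed
qed

lemma poisson_shift: "poisson (\<lambda>t. v (x + t)) z = poisson v (of_real x + z)"
proof -
  have "poisson v (of_real x + z) = \<bar>1\<bar> *\<^sub>R (LINT t|lborel. poisson_kernel (of_real x + z) (x + 1 * t) * v (x + 1 * t))"
    unfolding poisson_def by (rule lborel_integral_real_affine) simp
  also have "\<dots> = poisson (\<lambda>t. v (x + t)) z"
    by (simp add: poisson_def poisson_kernel_def)
  finally show ?thesis by simp
qed

lemma smirnov_times_norm_le_shift:
  assumes "f \<in> smirnov" "g \<in> smirnov"
  obtains C v where "log_integrable v" "\<And>t. v t \<ge> 0"
    "\<And>z. Im z > 0 \<Longrightarrow> norm (f (of_real x + z) * g (of_real x + z)) \<le> exp (C + poisson v z)"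
proof -
  obtain C1 v1 where 1: "log_integrable v1" "\<And>t. v1 t \<ge> 0"
    "\<And>z. z \<in> upper_half_plane \<Longrightarrow> norm (f z) \<le> exp (C1 + poisson v1 z)" using smirnov_norm_le[OF assms(1)] by metis
  obtain C2 v2 where 2: "log_integrable v2" "\<And>t. v2 t \<ge> 0"
    "\<And>z. z \<in> upper_half_plane \<Longrightarrow> norm (g z) \<le> exp (C2 + poisson v2 z)" using smirnov_norm_le[OF assms(2)] by metis
  define v where "v = (\<lambda>t. v1 t + v2 t)"
  have v: "log_integrable v" using 1(1) 2(1) by (simp add: log_integrable_def v_def add_divide_distrib borel_measurable_add)
  show ?thesis
  proof (rule that[of "\<lambda>t. v (x + t)" "C1 + C2"])
    show "log_integrable (\<lambda>t. v (x + t))" using v by (rule log_integrable_shift)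
    show "v (x + t) \<ge> 0" for t using 1(2) 2(2) by (simp add: v_def)
    fix z assume z: "Im z > 0"
    define w where "w = of_real x + z"
    have w: "w \<in> upper_half_plane" "Im w > 0" using z by (simp_all add: w_def upper_half_plane_iff)
    have pv: "poisson v w = poisson v1 w + poisson v2 w"
      unfolding poisson_def v_def using Re_herglotz(2)[OF 1(1) w(2)] Re_herglotz(2)[OF 2(1) w(2)]
      by (simp add: distrib_left)
    have "norm (f w * g w) \<le> exp (C1 + poisson v1 w) * exp (C2 + poisson v2 w)"
      unfolding norm_mult by (intro mult_mono 1(3) 2(3) w) auto
    also have "\<dots> = exp (C1 + C2 + poisson v w)" by (simp add: pv exp_add[symmetric])
    finally show "norm (f (of_real x + z) * g (of_real x + z)) \<le> exp (C1 + C2 + poisson (\<lambda>t. v (x + t)) z)"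
      by (simp add: w_def poisson_shift)
  qed
qed

lemma difference_quotient_integrable:
  fixes b :: "real \<Rightarrow> real"
  assumes "continuous_on UNIV b" "(b has_real_derivative D) (at 0)" "b 0 = 0"
  shows "(\<lambda>x. b x / x) integrable_on {0..R}"
proof -
  define q where "q = (\<lambda>x. if x = 0 then D else b x / x)"
  have "isCont q x" for x
  proof (cases "x = 0")
    case True
    have "((\<lambda>x. b x / x) \<longlongrightarrow> D) (at 0)" using assms(2,3) by (simp add: has_field_derivative_iff)
    moreover have "eventually (\<lambda>x. b x / x = q x) (at 0)" unfolding eventually_at_filter by (simp add: q_def)
    ultimately have "(q \<longlongrightarrow> D) (at 0)" by (rule Lim_transform_eventually)
    then show ?thesis using True by (simp add: isCont_def q_def)
  next
    case False
    have "isCont (\<lambda>x. b x / x) x" using False assms(1) by (intro continuous_intros) (auto simp: continuous_on_eq_continuous_at)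
    then have "((\<lambda>x. b x / x) \<longlongrightarrow> q x) (at x)" using False by (simp add: isCont_def q_def)
    moreover have "eventually (\<lambda>y. b y / y = q y) (at x)"
      by (rule eventually_mono[OF eventually_at_in_open'[of "- {0}" x]]) (use False in \<open>auto simp: q_def\<close>)
    ultimately show ?thesis unfolding isCont_def by (rule Lim_transform_eventually)
  qed
  then have "continuous_on {0..R} q" by (simp add: continuous_at_imp_continuous_on)
  then have "q integrable_on {0..R}" by (rule integrable_continuous_real)
  then show ?thesis by (rule integrable_spike[of _ _ "{0}"]) (auto simp: q_def)
qed

text \<open>Since \<open>ennreal\<close> replaces negative values by 0, the comparison passes
  through max 0 g; dropping the end points allows h to be arbitrary there.\<close>

lemma integral_le_nn_integral_Ioo:
  fixes g :: "real \<Rightarrow> real"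
  assumes g: "continuous_on {a..b} g" and le: "\<And>x. x \<in> {a<..<b} \<Longrightarrow> g x \<le> h x"
  shows "ennreal (integral {a..b} g) \<le> (\<integral>\<^sup>+x. ennreal (h x) * indicator {a<..<b} x \<partial>lborel)"
proof -
  have i: "set_integrable lborel {a..b} (\<lambda>x. max 0 (g x))" "set_integrable lborel {a..b} g"
    by (intro borel_integrable_atLeastAtMost' continuous_intros g)+
  have "integral {a..b} g \<le> integral {a..b} (\<lambda>x. max 0 (g x))"
    by (intro integral_le integrable_continuous_real continuous_intros g) simp
  also have "\<dots> = (LINT x:{a..b}|lborel. max 0 (g x))" using i(1) by (rule set_borel_integral_eq_integral(2)[symmetric])
  finally have "ennreal (integral {a..b} g) \<le> ennreal (LINT x:{a..b}|lborel. max 0 (g x))" by (rule ennreal_leI)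
  also have "\<dots> = (\<integral>\<^sup>+x. ennreal (indicator {a..b} x *\<^sub>R max 0 (g x)) \<partial>lborel)"
    unfolding set_lebesgue_integral_def
    by (rule nn_integral_eq_integral[symmetric]) (use i(1) in \<open>auto simp: set_integrable_def\<close>)
  also have "\<dots> \<le> (\<integral>\<^sup>+x. ennreal (h x) * indicator {a<..<b} x \<partial>lborel)"
  proof (rule nn_integral_mono_AE)
    have "AE x in lborel. x \<noteq> a \<and> x \<noteq> b"
      using AE_lborel_singleton[of a] AE_lborel_singleton[of b] by eventually_elim simp
    then show "AE x in lborel. ennreal (indicator {a..b} x *\<^sub>R max 0 (g x)) \<le> ennreal (h x) * indicator {a<..<b} x"
    proof eventually_elim
      case (elim x)
      then have "x \<in> {a..b} \<longleftrightarrow> x \<in> {a<..<b}" by auto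
      moreover have "ennreal (max 0 (g x)) \<le> ennreal (h x)" if "x \<in> {a<..<b}"
        using le[OF that] by (cases "g x \<ge> 0") (auto intro: ennreal_leI simp: max_def)
      ultimately show ?case by (cases "x \<in> {a<..<b}") (auto simp: indicator_def)
    qed
  qed
  finally show ?thesis .
qed

text \<open>Jensen's inequality on the half disc of radius R, split at 0 into the positive zeros and
  the reflected negative ones, bounds the arc integral of ln |\<Phi>| below with rate \<delta> from
  each side. The Poisson majorant then contradicts the total rate 2 \<delta>.\<close>

lemma no_function_with_dense_zeros:
  fixes \<Phi> :: "complex \<Rightarrow> complex" and \<beta> v :: "real \<Rightarrow> real" and \<Lambda> :: "real set"
  assumes Om: "open \<Omega>" "\<And>z. Im z \<ge> 0 \<Longrightarrow> z \<in> \<Omega>" "\<Phi> holomorphic_on \<Omega>" and nz0: "\<Phi> 0 \<noteq> 0"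
    and beta: "continuous_on UNIV \<beta>" "(\<beta> has_real_derivative D) (at 0)"
    and ph: "\<And>x. \<exists>r\<ge>0. \<Phi> (of_real x) = of_real r * cis (\<beta> x)"
    and zero: "\<And>x. x \<in> \<Lambda> \<Longrightarrow> \<Phi> (of_real x) = 0" and fin: "\<And>x y. finite (\<Lambda> \<inter> {x..y})"
    and delta: "\<delta> > 0"
    and count: "\<And>x y. x \<le> y \<Longrightarrow> 2 * pi * card (\<Lambda> \<inter> {x<..<y}) - (\<beta> y - \<beta> x) \<ge> \<delta> * (y - x) - C"
    and v: "log_integrable v" "\<And>t. v t \<ge> 0"
    and bound: "\<And>z. Im z > 0 \<Longrightarrow> norm (\<Phi> z) \<le> exp (C0 + poisson v z)"
  shows False
proof -
  \<comment> \<open>A nonnegative constant is wanted so that c ln R is increasing in R.\<close>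
  define c where "c = max 0 C"
  have finO: "finite (\<Lambda> \<inter> {x<..<y})" for x y by (rule finite_subset[OF _ fin[of x y]]) auto
  have z0: "0 \<notin> \<Lambda>" using zero[of 0] nz0 by auto
  define bp where "bp = (\<lambda>x. \<beta> x - \<beta> 0)"
  \<comment> \<open>The phase gained over (- x, 0), so that the negative half line can be treated as
    the positive one with the zeros reflected.\<close>
  define bm where "bm = (\<lambda>x. \<beta> 0 - \<beta> (- x))"
  have bc: "continuous_on UNIV bp" "continuous_on UNIV bm"
    unfolding bp_def bm_def using beta(1) by (auto intro!: continuous_intros continuous_on_compose2[OF beta(1)])
  have "(bp has_real_derivative D) (at 0)" unfolding bp_def by (auto intro!: derivative_eq_intros beta(2))
  note bpi = difference_quotient_integrable[OF bc(1) this]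
  have "((\<lambda>x. \<beta> (- x)) has_real_derivative D * (- 1)) (at 0)"
    by (rule DERIV_chain'[where f="\<lambda>x. - x" and g=\<beta>, OF _ _]) (use beta(2) in \<open>auto intro!: derivative_eq_intros\<close>)
  then have "(bm has_real_derivative D) (at 0)" unfolding bm_def by (auto intro!: derivative_eq_intros)
  note bmi = difference_quotient_integrable[OF bc(2) this]
  define \<Lambda>m where "\<Lambda>m = uminus ` \<Lambda>"
  have Lm: "\<Lambda>m \<inter> {0<..<x} = uminus ` (\<Lambda> \<inter> {-x<..<0})" for x by (force simp: \<Lambda>m_def)
  obtain C1 where C1: "\<And>R. R \<ge> 1 \<Longrightarrow> 2 * pi * (\<Sum>l\<in>\<Lambda> \<inter> {0<..<R}. ln (R / l)) - integral {0..R} (\<lambda>x. bp x / x) \<ge> \<delta> * R - c * ln R - C1"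
  proof (rule one_sided_Jensen_lower_bound[where \<Lambda>=\<Lambda> and b=bp and \<delta>=\<delta> and C=c])
    show "(\<lambda>x. bp x / x) integrable_on {0..R}" for R by (rule bpi) (simp add: bp_def)
    show "\<delta> * x - c \<le> 2 * pi * card (\<Lambda> \<inter> {0<..<x}) - bp x" if "x > 0" for x
      using count[of 0 x] that by (simp add: bp_def c_def)
  qed (use finO in auto)
  obtain C2 where C2: "\<And>R. R \<ge> 1 \<Longrightarrow> 2 * pi * (\<Sum>l\<in>\<Lambda>m \<inter> {0<..<R}. ln (R / l)) - integral {0..R} (\<lambda>x. bm x / x) \<ge> \<delta> * R - c * ln R - C2"
  proof (rule one_sided_Jensen_lower_bound[where \<Lambda>=\<Lambda>m and b=bm and \<delta>=\<delta> and C=c])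
    show "(\<lambda>x. bm x / x) integrable_on {0..R}" for R by (rule bmi) (simp add: bm_def)
    show "\<delta> * x - c \<le> 2 * pi * card (\<Lambda>m \<inter> {0<..<x}) - bm x" if "x > 0" for x
      using count[of "-x" 0] that unfolding Lm by (simp add: card_image bm_def c_def)
    show "finite (\<Lambda>m \<inter> {0<..<R})" for R unfolding Lm using finO by blast
  qed auto
  \<comment> \<open>Collects the constants of the two half lines, the value at the centre, and C0
    integrated over the arc of length \<pi>.\<close>
  define C' where "C' = C1 + C2 - pi * ln (cmod (\<Phi> 0)) + C0 * pi"
  have hd: "half_disc R \<subseteq> \<Omega>" for R using Om(2) by (auto simp: half_disc_def)
  have phR: "phase_on R \<Phi> \<beta>" for R
    unfolding phase_on_def
  proof
    fix x
    obtain r where r: "r \<ge> 0" "\<Phi> (of_real x) = of_real r * cis (\<beta> x)" using ph by blast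
    have "\<Phi> (of_real x) * cis (- \<beta> x) = of_real r" unfolding r(2) by (simp add: mult.assoc cis_mult)
    then show "0 \<le> Re (\<Phi> (of_real x) * cis (- \<beta> x)) \<and> Im (\<Phi> (of_real x) * cis (- \<beta> x)) = 0" using r(1) by simp
  qed
  have main: "ennreal (2 * \<delta> * R - 2 * c * ln R - C') \<le> (\<integral>\<^sup>+\<theta>. ennreal (poisson v (of_real R * cis \<theta>)) * indicator {0<..<pi} \<theta> \<partial>lborel)"
    if R: "R \<ge> 1" and arc: "\<And>z. z \<in> half_disc R \<Longrightarrow> cmod z = R \<Longrightarrow> \<Phi> z \<noteq> 0" for R
  proof -
    have R0: "R > 0" using R by simp
    obtain I J where I: "((\<lambda>\<theta>. ln (cmod (\<Phi> (of_real R * cis \<theta>)))) has_integral I) {0..pi}"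
      and J: "((\<lambda>x. (\<beta> x - \<beta> 0) / x) has_integral J) {-R..R}"
      and IJ: "I \<ge> pi * ln (cmod (\<Phi> 0)) + 2 * pi * (\<Sum>x\<in>\<Lambda> \<inter> {-R<..<R}. ln (R / \<bar>x\<bar>)) - J"
    proof (rule half_disc_Jensen[OF R0 _ Om(1) hd Om(3) arc nz0 phR finO])
      show "continuous_on {-R..R} \<beta>" by (rule continuous_on_subset[OF beta(1)]) simp
    qed (use zero in auto)
    have "((\<lambda>x. bm (- x) / (- x)) has_integral (integral {0..R} (\<lambda>x. bm x / x))) {-R..-0}"
      by (rule iffD2[OF has_integral_reflect_real[of "\<lambda>x. bm x / x"]], rule integrable_integral, rule bmi) (simp add: bm_def)
    moreover have "bm (- x) / (- x) = (\<beta> x - \<beta> 0) / x" for x by (cases "x = 0") (auto simp: bm_def field_simps)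
    ultimately have "((\<lambda>x. (\<beta> x - \<beta> 0) / x) has_integral (integral {0..R} (\<lambda>x. bm x / x))) {-R..0}"
      by (simp only: minus_zero)
    moreover have "((\<lambda>x. (\<beta> x - \<beta> 0) / x) has_integral (integral {0..R} (\<lambda>x. bp x / x))) {0..R}"
      using integrable_integral[OF bpi] by (simp add: bp_def)
    ultimately have "((\<lambda>x. (\<beta> x - \<beta> 0) / x) has_integral (integral {0..R} (\<lambda>x. bm x / x) + integral {0..R} (\<lambda>x. bp x / x))) {-R..R}"
      using R0 by (intro has_integral_combine[of "-R" 0 R]) auto
    then have J': "J = integral {0..R} (\<lambda>x. bm x / x) + integral {0..R} (\<lambda>x. bp x / x)"
      using J has_integral_unique by blast
    have split: "\<Lambda> \<inter> {-R<..<R} = (\<Lambda> \<inter> {-R<..<0}) \<union> (\<Lambda> \<inter> {0<..<R})"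
    proof (intro equalityI subsetI)
      fix x assume "x \<in> \<Lambda> \<inter> {-R<..<R}"
      moreover from this have "x \<noteq> 0" using z0 by auto
      ultimately show "x \<in> (\<Lambda> \<inter> {-R<..<0}) \<union> (\<Lambda> \<inter> {0<..<R})"
        by (cases "x < 0") auto
    qed (use R0 in auto)
    have "(\<Sum>x\<in>\<Lambda> \<inter> {-R<..<R}. ln (R / \<bar>x\<bar>)) = (\<Sum>x\<in>\<Lambda> \<inter> {-R<..<0}. ln (R / \<bar>x\<bar>)) + (\<Sum>x\<in>\<Lambda> \<inter> {0<..<R}. ln (R / \<bar>x\<bar>))"
      unfolding split by (rule sum.union_disjoint) (use finO in auto)
    also have "(\<Sum>x\<in>\<Lambda> \<inter> {-R<..<0}. ln (R / \<bar>x\<bar>)) = (\<Sum>l\<in>\<Lambda>m \<inter> {0<..<R}. ln (R / l))"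
      unfolding Lm by (subst sum.reindex) (auto intro!: sum.cong)
    also have "(\<Sum>x\<in>\<Lambda> \<inter> {0<..<R}. ln (R / \<bar>x\<bar>)) = (\<Sum>l\<in>\<Lambda> \<inter> {0<..<R}. ln (R / l))"
      by (intro sum.cong) auto
    finally have sums: "2 * pi * (\<Sum>x\<in>\<Lambda> \<inter> {-R<..<R}. ln (R / \<bar>x\<bar>))
       = 2 * pi * (\<Sum>l\<in>\<Lambda>m \<inter> {0<..<R}. ln (R / l)) + 2 * pi * (\<Sum>l\<in>\<Lambda> \<inter> {0<..<R}. ln (R / l))"
      by (simp add: distrib_left)
    have arith: "p + 2 * (d - k) - C1 - C2 \<le> I"
      if "t = t1 + t2" "p + t - (i1 + i2) \<le> I" "d - k - C1 \<le> t2 - i2" "d - k - C2 \<le> t1 - i1"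
      for p d k t t1 t2 i1 i2 using that by simp
    have "I \<ge> pi * ln (cmod (\<Phi> 0)) + 2 * (\<delta> * R - c * ln R) - C1 - C2"
      by (rule arith[OF sums IJ[unfolded J'] C1[OF R] C2[OF R]])
    then have lo: "2 * \<delta> * R - 2 * c * ln R - C' \<le> I - C0 * pi" by (simp add: C'_def)
    define g where "g = (\<lambda>\<theta>. ln (cmod (\<Phi> (of_real R * cis \<theta>))) - C0)"
    have onarc: "of_real R * cis \<theta> \<in> half_disc R" "cmod (of_real R * cis \<theta>) = R" if "\<theta> \<in> {0..pi}" for \<theta>
      using that R0 sin_ge_zero[of \<theta>] by (auto simp: half_disc_def norm_mult)
    have gc: "continuous_on {0..pi} g"
    proof -
      have "continuous_on {0..pi} (\<lambda>\<theta>. of_real R * cis \<theta>)"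
        unfolding cis_conv_exp by (intro continuous_intros)
      from continuous_on_compose2[OF holomorphic_on_imp_continuous_on[OF Om(3)] this]
      have "continuous_on {0..pi} (\<lambda>\<theta>. \<Phi> (of_real R * cis \<theta>))" using hd onarc(1) by blast
      then show ?thesis unfolding g_def using arc[OF onarc] by (intro continuous_intros) auto
    qed
    have "(g has_integral (I - C0 * pi)) {0..pi}"
      unfolding g_def using has_integral_diff[OF I has_integral_const_real[of C0 0 pi]] by (simp add: mult.commute)
    then have gi: "integral {0..pi} g = I - C0 * pi" by (rule integral_unique)
    have "ennreal (integral {0..pi} g) \<le> (\<integral>\<^sup>+\<theta>. ennreal (poisson v (of_real R * cis \<theta>)) * indicator {0<..<pi} \<theta> \<partial>lborel)"
    proof (rule integral_le_nn_integral_Ioo[OF gc])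
      fix \<theta> assume t: "\<theta> \<in> {0<..<pi}"
      then have "Im (of_real R * cis \<theta>) > 0" using R0 by (simp add: sin_gt_zero)
      note b = bound[OF this]
      have "cmod (\<Phi> (of_real R * cis \<theta>)) > 0" using arc[OF onarc] t by auto
      then have "ln (cmod (\<Phi> (of_real R * cis \<theta>))) \<le> C0 + poisson v (of_real R * cis \<theta>)"
        using iffD2[OF ln_le_cancel_iff b] by simp
      then show "g \<theta> \<le> poisson v (of_real R * cis \<theta>)" by (simp add: g_def)
    qed
    then show ?thesis using ennreal_leI[OF lo] unfolding gi by (rule order_trans[rotated])
  qed
  show False
  proof (rule poisson_arc_mean_not_linear[OF v, where \<delta>="2 * \<delta>" and C="2 * c" and C'=C'])
    fix S :: real assume S: "S \<ge> 1"
    have "finite {z \<in> half_disc (2 * S). \<Phi> z = 0}"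
      by (rule half_disc_finite_zeros[OF _ Om(1) hd Om(3) nz0]) (use S in simp)
    then have "finite (cmod ` {z \<in> half_disc (2 * S). \<Phi> z = 0})" by (rule finite_imageI)
    \<comment> \<open>The arc avoids all zeros except for finitely many radii up to 2 S.\<close>
    then have "AE R in lborel. R \<notin> cmod ` {z \<in> half_disc (2 * S). \<Phi> z = 0}"
      by (intro AE_not_in finite_imp_null_set_lborel)
    then show "AE R in lborel. R \<in> {S..2 * S} \<longrightarrow> ennreal (2 * \<delta> * R - 2 * c * ln R - C')
      \<le> (\<integral>\<^sup>+\<theta>. ennreal (poisson v (of_real R * cis \<theta>)) * indicator {0<..<pi} \<theta> \<partial>lborel)"
    proof eventually_elim
      case (elim R)
      show ?case
      proof
        assume R: "R \<in> {S..2 * S}"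
        show "ennreal (2 * \<delta> * R - 2 * c * ln R - C')
          \<le> (\<integral>\<^sup>+\<theta>. ennreal (poisson v (of_real R * cis \<theta>)) * indicator {0<..<pi} \<theta> \<partial>lborel)"
        proof (rule main)
          show "R \<ge> 1" using R S by simp
          show "\<Phi> z \<noteq> 0" if "z \<in> half_disc R" "cmod z = R" for z
            using elim that R by (force simp: half_disc_def)
        qed
      qed
    qed
  qed (use delta in \<open>auto simp: c_def\<close>)
qed

lemma real_analytic_diff:
  assumes "real_analytic a" "real_analytic b"
  shows "real_analytic (\<lambda>x. a x - b x)"
  unfolding real_analytic_def
proof
  fix x
  obtain r1 p where 1: "r1 > 0" "\<forall>y. \<bar>y - x\<bar> < r1 \<longrightarrow> (\<lambda>n. p n * (y - x) ^ n) sums a y"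
    using assms(1) unfolding real_analytic_def by blast
  obtain r2 q where 2: "r2 > 0" "\<forall>y. \<bar>y - x\<bar> < r2 \<longrightarrow> (\<lambda>n. q n * (y - x) ^ n) sums b y"
    using assms(2) unfolding real_analytic_def by blast
  show "\<exists>r>0. \<exists>c. \<forall>y. \<bar>y - x\<bar> < r \<longrightarrow> (\<lambda>n. c n * (y - x) ^ n) sums (a y - b y)"
  proof (intro exI[of _ "min r1 r2"] exI[of _ "\<lambda>n. p n - q n"] conjI allI impI)
    fix y assume "\<bar>y - x\<bar> < min r1 r2"
    then show "(\<lambda>n. (p n - q n) * (y - x) ^ n) sums (a y - b y)"
      using sums_diff[of "\<lambda>n. p n * (y - x) ^ n" "a y" "\<lambda>n. q n * (y - x) ^ n" "b y"] 1(2) 2(2)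
      by (simp add: left_diff_distrib)
  qed (use 1 2 in simp)
qed

lemma ess_bounded_continuous_imp_bounded:
  assumes h: "ess_bounded h" and cont: "continuous_on UNIV h"
  shows "\<exists>H. \<forall>x. \<bar>h x\<bar> \<le> H"
proof -
  obtain C where C: "AE x in lebesgue. \<bar>h x\<bar> \<le> C" using h by (auto simp: ess_bounded_def)
  have "\<bar>h x\<bar> \<le> C" for x
  proof (rule ccontr)
    assume x: "\<not> \<bar>h x\<bar> \<le> C"
    have "open {y. C < \<bar>h y\<bar>}" by (intro open_Collect_less continuous_intros cont)
    then obtain e where e: "e > 0" "ball x e \<subseteq> {y. C < \<bar>h y\<bar>}"
      using x open_contains_ball[of "{y. C < \<bar>h y\<bar>}"] by (auto simp: not_le)
    obtain y where "x - e < y" "y < x + e" "\<bar>h y\<bar> \<le> C"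
      using AE_lebesgue_obtain[OF C, of "x - e" "x + e"] e(1) by auto
    then have "y \<in> ball x e" by (auto simp: dist_real_def abs_less_iff)
    then show False using e(2) \<open>\<bar>h y\<bar> \<le> C\<close> by force
  qed
  then show ?thesis by blast
qed

theorem theorem5:
  fixes \<alpha> h :: "real \<Rightarrow> real" and U :: "real \<Rightarrow> complex" and \<Lambda> :: "real set"
  assumes "real_analytic \<alpha>" and "real_analytic h"
    and "\<exists>c>0. \<forall>x. deriv \<alpha> x \<ge> c"
    and "ess_bounded h"
    and "U = (\<lambda>x. exp (\<i> * of_real (- \<alpha> x + h x)))"
    and "\<forall>x. \<not> x islimpt \<Lambda>"
    and "lower_density \<alpha> \<Lambda> > ereal (1 / (2 * pi))"
  shows "\<not> zero_set_of (smirnov_toeplitz_kernel U) \<Lambda>"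
proof
  assume "zero_set_of (smirnov_toeplitz_kernel U) \<Lambda>"
  then obtain f z0 where f: "f \<in> smirnov_toeplitz_kernel U" and z0: "z0 \<in> upper_half_plane" "f z0 \<noteq> 0"
    and van: "\<And>x. x \<in> \<Lambda> \<Longrightarrow> has_boundary_value f x 0"
    unfolding zero_set_of_def vanishes_at_def by blast
  define \<beta> where "\<beta> = (\<lambda>x. \<alpha> x - h x)"
  have beta: "real_analytic \<beta>" unfolding \<beta>_def by (rule real_analytic_diff[OF assms(1,2)])
  have U: "U = (\<lambda>x. exp (- \<i> * of_real (\<beta> x)))"
    unfolding assms(5) \<beta>_def by (intro ext arg_cong[where f=exp]) (simp add: algebra_simps)
  obtain c where c: "c > 0" "\<And>x. deriv \<alpha> x \<ge> c" using assms(3) by blast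
  interpret expanding_phase \<alpha> c
    by unfold_locales (use real_analytic_has_derivative[OF assms(1)] c in auto)
  have fin: "finite (\<Lambda> \<inter> {x..y})" for x y
  proof (rule ccontr)
    assume "infinite (\<Lambda> \<inter> {x..y})"
    then obtain l where "l islimpt (\<Lambda> \<inter> {x..y})"
      using Heine_Borel_imp_Bolzano_Weierstrass[of "{x..y}" "\<Lambda> \<inter> {x..y}"] by auto
    then show False using assms(6) islimpt_subset by blast
  qed
  obtain H where H: "\<And>x. \<bar>h x\<bar> \<le> H"
    using ess_bounded_continuous_imp_bounded[OF assms(4) real_analytic_continuous[OF assms(2)]] by blast
  obtain \<delta> C where delta: "\<delta> > 0"
    and count: "\<And>x y. x \<le> y \<Longrightarrow> 2 * pi * card (\<Lambda> \<inter> {x<..<y}) - (\<alpha> y - \<alpha> x) \<ge> \<delta> * (y - x) - C"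
    using counting_lower_bound[OF fin assms(7)] by metis
  obtain \<Omega> f' g g' where Om: "open \<Omega>" "\<And>z. Im z \<ge> 0 \<Longrightarrow> z \<in> \<Omega>" and f': "f' holomorphic_on \<Omega>" and g': "g' holomorphic_on \<Omega>"
    and g: "g \<in> smirnov" and ff: "\<And>z. z \<in> upper_half_plane \<Longrightarrow> f' z = f z" and gg: "\<And>z. z \<in> upper_half_plane \<Longrightarrow> g' z = g z"
    and rel: "\<And>x. g' (of_real x) = cnj (U x * f' (of_real x))"
    by (rule smirnov_toeplitz_kernel_extension[OF f U beta], rule that)
  have fs: "f \<in> smirnov" using f by (simp add: smirnov_toeplitz_kernel_def)
  \<comment> \<open>The centre of the half discs must be a real point where f does not vanish. If
    there were none, the identity theorem on a convex neighbourhood of a half disc containing z0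
    would give f z0 = 0.\<close>
  obtain x1 where x1: "f' (complex_of_real x1) \<noteq> 0"
  proof (rule ccontr)
    assume "\<not> thesis"
    then have real0: "f' (complex_of_real x) = 0" for x using that by blast
    define R where "R = cmod z0 + 1"
    have "half_disc R \<subseteq> \<Omega>" using Om(2) by (auto simp: half_disc_def)
    then obtain E where E: "open E" "convex E" "half_disc R \<subseteq> E" "E \<subseteq> \<Omega>"
      by (rule half_disc_convex_neighbourhood[OF Om(1)])
    have R1: "R \<ge> 1" by (simp add: R_def)
    have "f' z0 = 0"
    proof (rule analytic_continuation[OF holomorphic_on_subset[OF f' E(4)] E(1) convex_connected[OF E(2)], of "of_real ` {0<..<1}" 0])
      show "complex_of_real ` {0<..<1} \<subseteq> E" "0 \<in> E" using E(3) R1 by (auto simp: half_disc_def)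
      show "0 islimpt complex_of_real ` {0<..<1}"
        unfolding islimpt_approachable
      proof (intro allI impI)
        fix e :: real assume "e > 0"
        then show "\<exists>x'\<in>complex_of_real ` {0<..<1}. x' \<noteq> 0 \<and> dist x' 0 < e"
          by (intro bexI[of _ "complex_of_real (min (e/2) (1/2))"] imageI) (auto simp: min_def)
      qed
      show "z0 \<in> E" using E(3) z0(1) by (auto simp: half_disc_def R_def upper_half_plane_iff)
    qed (use real0 in auto)
    then show False using z0 ff by simp
  qed
  obtain v C0 where v: "log_integrable v" "\<And>t. v t \<ge> 0"
    and bound: "\<And>z. Im z > 0 \<Longrightarrow> norm (f (of_real x1 + z) * g (of_real x1 + z)) \<le> exp (C0 + poisson v z)"
    by (rule smirnov_times_norm_le_shift[OF fs g, of x1], rule that)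
  define \<Phi> where "\<Phi> = (\<lambda>z. f' (of_real x1 + z) * g' (of_real x1 + z))"
  define \<Omega>1 where "\<Omega>1 = (\<lambda>z. of_real x1 + z) -` \<Omega>"
  show False
  \<comment> \<open>The term 2 H is the price of passing from \<alpha> to \<beta> = \<alpha> - h in
    the counting bound: h changes by at most 2 H over an interval.\<close>
  proof (rule no_function_with_dense_zeros[of \<Omega>1 \<Phi> "\<lambda>x. \<beta> (x1 + x)" _ "{x. x1 + x \<in> \<Lambda>}" \<delta> "C + 2 * H" v C0])
    show "open \<Omega>1" unfolding \<Omega>1_def by (intro open_vimage Om(1) continuous_intros)
    show "z \<in> \<Omega>1" if "Im z \<ge> 0" for z using that Om(2) by (simp add: \<Omega>1_def)
    have sh: "(\<lambda>z. k (of_real x1 + z)) holomorphic_on \<Omega>1" if "k holomorphic_on \<Omega>" for k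
    proof -
      have "(\<lambda>z. of_real x1 + z) holomorphic_on \<Omega>1" by (intro holomorphic_intros)
      from holomorphic_on_compose_gen[OF this that] show ?thesis by (auto simp: \<Omega>1_def o_def)
    qed
    show "\<Phi> holomorphic_on \<Omega>1" unfolding \<Phi>_def by (intro holomorphic_on_mult sh f' g')
    \<comment> \<open>On the line |g'| = |f'|, so g' does not vanish at x1 either.\<close>
    show "\<Phi> 0 \<noteq> 0" using x1 rel[of x1] by (simp add: \<Phi>_def U)
    show "continuous_on UNIV (\<lambda>x. \<beta> (x1 + x))"
      by (rule continuous_on_compose2[OF real_analytic_continuous[OF beta, of UNIV]]) (auto intro!: continuous_intros)
    show "((\<lambda>x. \<beta> (x1 + x)) has_real_derivative deriv \<beta> x1) (at 0)"
      using real_analytic_has_derivative(1)[OF beta, of x1] DERIV_shift[of \<beta> "deriv \<beta> x1" 0 x1] by (simp add: add.commute)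
    show "\<exists>r\<ge>0. \<Phi> (of_real x) = of_real r * cis (\<beta> (x1 + x))" for x
    proof (intro exI conjI)
      let ?w = "f' (of_real (x1 + x))"
      have "\<Phi> (of_real x) = ?w * cnj (U (x1 + x) * ?w)" unfolding \<Phi>_def rel[symmetric] by simp
      also have "\<dots> = (?w * cnj ?w) * cnj (U (x1 + x))" by simp
      also have "\<dots> = of_real ((cmod ?w)\<^sup>2) * cis (\<beta> (x1 + x))"
        unfolding complex_norm_square[symmetric] by (simp add: U exp_cnj cis_conv_exp)
      finally show "\<Phi> (of_real x) = of_real ((cmod ?w)\<^sup>2) * cis (\<beta> (x1 + x))" .
    qed simp
    show "\<Phi> (of_real x) = 0" if "x \<in> {x. x1 + x \<in> \<Lambda>}" for x
    proof -
      have "f' (of_real (x1 + x)) = 0"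
        by (rule has_boundary_value_unique[OF has_boundary_value_extension[OF holomorphic_on_imp_continuous_on[OF f'] Om(1) _ ff] van])
          (use that Om(2) in auto)
      then show ?thesis by (simp add: \<Phi>_def)
    qed
    have im: "{x. x1 + x \<in> \<Lambda>} \<inter> {x<..<y} = (\<lambda>t. t - x1) ` (\<Lambda> \<inter> {x1 + x<..<x1 + y})" for x y
      by (force simp: image_iff)
    show "finite ({x. x1 + x \<in> \<Lambda>} \<inter> {x..y})" for x y
    proof (rule finite_subset)
      show "{x. x1 + x \<in> \<Lambda>} \<inter> {x..y} \<subseteq> (\<lambda>t. t - x1) ` (\<Lambda> \<inter> {x1 + x..x1 + y})" by (force simp: image_iff)
    qed (use fin in simp)
    show "\<delta> * (y - x) - (C + 2 * H) \<le> 2 * pi * card ({x. x1 + x \<in> \<Lambda>} \<inter> {x<..<y}) - (\<beta> (x1 + y) - \<beta> (x1 + x))" if "x \<le> y" for x y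
    proof -
      have "card ({x. x1 + x \<in> \<Lambda>} \<inter> {x<..<y}) = card (\<Lambda> \<inter> {x1 + x<..<x1 + y})"
        unfolding im by (intro card_image) (auto simp: inj_on_def)
      then show ?thesis using count[of "x1 + x" "x1 + y"] that H[of "x1 + x"] H[of "x1 + y"] by (simp add: \<beta>_def)
    qed
    show "norm (\<Phi> z) \<le> exp (C0 + poisson v z)" if "Im z > 0" for z
      using bound[OF that] that by (simp add: \<Phi>_def ff gg upper_half_plane_iff)
  qed (use delta v in auto)
qed

end
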